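(* Let $\gamma<1$ and $p\in[1,\infty]$. Let $f$ satisfy $$\|f(\cdot,t)\|_{L^1(\mathbb{R}^N)}\le C(1+t)^{-\gamma}\quad\text{for all }t>0,\text{ for some }C>0,$$ and assume that there exists $g\in L^1(\mathbb{R}^N)$ such that $\|f(\cdot,t)(1+t)^\gamma-g\|_{L^1(\mathbb{R}^N)}\to0$ as $t\to\infty$. Assume moreover that $$\sup_{t>0}\big((1+t)^\gamma\|f(\cdot,t)\|_{L^1(\{|x|>R\})}\big)=o(1)\quad\text{as }R\to\infty$$ if $p\in[1,p_{\rm c})$, and that for some $q\in(q_{\rm c}(p),p]$ $$\sup_{t>0}\big((1+t)^\gamma\|f(\cdot,t)\|_{L^q(\{|x|>R\})}\big)=o\big(R^{-N(1-\frac1q)}\big)\quad\text{as }R\to\infty$$ if $p\ge p_{\rm c}$. Let $M_f(t)=\int_{\mathbb{R}^N}f(x,t)\,dx$ and $M_0=\int_{\mathbb{R}^N}g$. Then $$\int_0^tM_f(s)Y(x,t-s)\,ds=\big(1+o(1)\big)\,t^{-\gamma}M_0c_{2\beta}E_{2\beta}(x)\quad\text{if }|x|t^{-\theta}=o(1)\text{ as }t\to\infty.$$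
   Context: Standing setting: $\alpha\in(0,1)$, $\beta\in(0,1]$, $N$ is the space dimension with $N>4\beta$, $\theta=\alpha/(2\beta)$, $Q=\mathbb{R}^N\times(0,\infty)$, and $f:Q\to\mathbb{R}$ is measurable. Kernels. $Z(\cdot,t)$, $t>0$, is the function whose Fourier transform (convention $\widehat h(\omega)=\int h(x)e^{-ix\cdot\omega}dx$, understood for tempered distributions) is $\widehat Z(\omega,t)=\mathbb{E}_\alpha(-|\omega|^{2\beta}t^\alpha)$, where $\mathbb{E}_\alpha(s)=\sum_{k\ge0}s^k/\Gamma(1+k\alpha)$; it is the fundamental solution of $\partial_t^\alpha u+(-\Delta)^\beta u=0$ (Caputo time derivative; $(-\Delta)^\beta$ has Fourier symbol $|\omega|^{2\beta}$). The kernel $Y$ is $Y=\partial_t^{1-\alpha}Z$, that is, for $x\ne0$, $t>0$ (with $Z(x,0)=0$ for $x\neq 0$), $Y(x,t)=\frac1{\Gamma(\alpha)}\partial_t\int_0^tZ(x,\tau)(t-\tau)^{\alpha-1}d\tau$. Exponents: $p_{\rm c}=N/(N-2\beta)$. For $p\ge p_{\rm c}$: $q_{\rm c}(p)=\frac{Np}{2\beta p+N}$ if $p<\infty$, and $q_{\rm c}(\infty)=\frac{N}{2\beta}$. $E_{2\beta}(x)=|x|^{2\beta-N}$ and $c_{2\beta}=\frac{\Gamma((N-2\beta)/2)}{\pi^{N/2}2^{2\beta}\Gamma(\beta)}$.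
   Formalization: For M_0 = 0 the formula would say that the integral vanishes, which is false in general (g = 0, f = (1+t)^{-γ-1}φ(x)); in that case the statement proved is that the integral is o(t^{-γ} c_{2β} E_{2β}(x)). For M_0 ≠ 0 it is as stated, with x ≠ 0. *)

theory Defs
  imports
    "HOL-Analysis.Analysis"
    "HOL-Probability.Essential_Supremum"
    "HOL-Library.Landau_Symbols"
begin

text \<open>A function that is not measurable gets the norm \<open>\<infinity>\<close>, so a finite norm includes
  membership in \<open>L\<^sup>p\<close>. The space \<open>M\<close> is \<open>lebesgue\<close> or a restriction of it.\<close>

definition Lp_norm :: "ennreal \<Rightarrow> 'a measure \<Rightarrow> ('a \<Rightarrow> real) \<Rightarrow> ennreal" where
  "Lp_norm p M h =
     (if h \<notin> borel_measurable M then \<infinity>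
      else if p = \<infinity> then esssup M (\<lambda>x. ennreal \<bar>h x\<bar>)
      else let I = (\<integral>\<^sup>+ x. ennreal (\<bar>h x\<bar> powr enn2real p) \<partial>M)
           in if I = \<infinity> then \<infinity> else ennreal (enn2real I powr (1 / enn2real p)))"

definition Mittag_Leffler :: "real \<Rightarrow> real \<Rightarrow> real" where
  "Mittag_Leffler \<alpha> s = (\<Sum>k. s ^ k / Gamma (1 + real k * \<alpha>))"

definition partial_deriv :: "'n \<Rightarrow> (real ^ 'n \<Rightarrow> complex) \<Rightarrow> real ^ 'n \<Rightarrow> complex" where
  "partial_deriv i \<phi> x = vector_derivative (\<lambda>s::real. \<phi> (x + s *\<^sub>R axis i 1)) (at 0)"

definition schwartz :: "(real ^ 'n \<Rightarrow> complex) \<Rightarrow> bool" where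
  "schwartz \<phi> \<longleftrightarrow>
     (\<forall>is. (\<forall>x. foldr partial_deriv is \<phi> differentiable at x) \<and>
           (\<forall>k::nat. \<exists>B. \<forall>x. (1 + norm x) ^ k * norm (foldr partial_deriv is \<phi> x) \<le> B))"

definition fourier :: "(real ^ 'n \<Rightarrow> complex) \<Rightarrow> real ^ 'n \<Rightarrow> complex" where
  "fourier h \<omega> = (LINT x|lebesgue. h x * exp (- \<i> * complex_of_real (x \<bullet> \<omega>)))"

text \<open>\<open>h\<close> defines a tempered distribution, and the Fourier transform of that distribution is the
  function \<open>m\<close>, that is, \<open>\<langle>m, \<phi>\<rangle> = \<langle>h, fourier \<phi>\<rangle>\<close> for all Schwartz functions \<open>\<phi>\<close>.\<close>

definition has_tempered_fourier :: "(real ^ 'n \<Rightarrow> real) \<Rightarrow> (real ^ 'n \<Rightarrow> real) \<Rightarrow> bool" where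
  "has_tempered_fourier h m \<longleftrightarrow>
     (\<exists>k::nat. integrable lebesgue (\<lambda>x. h x / (1 + norm x) ^ k)) \<and>
     (\<forall>\<phi>. schwartz \<phi> \<longrightarrow>
        (LINT \<omega>|lebesgue. complex_of_real (m \<omega>) * \<phi> \<omega>) =
        (LINT x|lebesgue. complex_of_real (h x) * fourier \<phi> x))"

text \<open>The Fourier transform determines \<open>Z(\<cdot>,t)\<close> only up to null sets. Continuity off the origin
  then determines its value at every \<open>x \<noteq> 0\<close>. The kernel is singular at \<open>x = 0\<close>, and its value
  there is irrelevant.\<close>

definition Z_kernel :: "real \<Rightarrow> real \<Rightarrow> real ^ 'n \<Rightarrow> real \<Rightarrow> real" where
  "Z_kernel \<alpha> \<beta> x t =
     (if t > 0 then
        (SOME h. continuous_on (- {0}) h \<and>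
           has_tempered_fourier h
             (\<lambda>\<omega>. Mittag_Leffler \<alpha> (- (norm \<omega> powr (2 * \<beta>) * t powr \<alpha>)))) x
      else 0)"

definition Y_kernel :: "real \<Rightarrow> real \<Rightarrow> real ^ 'n \<Rightarrow> real \<Rightarrow> real" where
  "Y_kernel \<alpha> \<beta> x t =
     deriv (\<lambda>t. LINT \<tau>:{0<..<t}|lebesgue. Z_kernel \<alpha> \<beta> x \<tau> * (t - \<tau>) powr (\<alpha> - 1)) t / Gamma \<alpha>"

definition p_crit :: "real \<Rightarrow> real \<Rightarrow> real" where
  "p_crit N \<beta> = N / (N - 2 * \<beta>)"

definition q_crit :: "real \<Rightarrow> real \<Rightarrow> ennreal \<Rightarrow> real" where
  "q_crit N \<beta> p =
     (if p = \<infinity> then N / (2 * \<beta>) else N * enn2real p / (2 * \<beta> * enn2real p + N))"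

definition E_fun :: "real \<Rightarrow> real ^ 'n \<Rightarrow> real" where
  "E_fun \<beta> x = norm x powr (2 * \<beta> - real CARD('n))"

definition c_const :: "real \<Rightarrow> real \<Rightarrow> real" where
  "c_const N \<beta> = Gamma ((N - 2 * \<beta>) / 2) / (pi powr (N / 2) * 2 powr (2 * \<beta>) * Gamma \<beta>)"

text \<open>The regime \<open>t \<rightarrow> \<infinity>\<close>, \<open>x \<noteq> 0\<close>, \<open>|x| t\<^sup>-\<^sup>\<theta> \<rightarrow> 0\<close>, uniformly in \<open>x\<close>: a property holds eventually iff
  there are \<open>T\<close> and \<open>\<delta> > 0\<close> such that it holds for all \<open>(x, t)\<close> with \<open>t \<ge> T\<close>, \<open>x \<noteq> 0\<close> and
  \<open>|x| t\<^sup>-\<^sup>\<theta> < \<delta>\<close>.\<close>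

definition inner_region :: "real \<Rightarrow> ((real ^ 'n) \<times> real) filter" where
  "inner_region \<theta> =
     inf (inf (filtercomap snd at_top)
              (filtercomap (\<lambda>(x, t). norm x * t powr (- \<theta>)) (nhds 0)))
         (principal {(x, t). x \<noteq> 0})"

end

theory Submission
  imports Defs "HOL-Probability.Probability" "HOL-Real_Asymp.Real_Asymp"
begin

text \<open>The proof writes both kernels as averages of Gaussian heat kernels, so that positivity,
  scaling and the total mass of \<open>Y\<close> can be read off.

  Let \<open>S\<close> and \<open>V\<close> be independent positive random variables with Laplace transforms
  \<open>exp (- s\<^sup>\<alpha>)\<close> and \<open>exp (- s\<^sup>\<beta>)\<close>. Such one-sided stable laws exist as weak limits of rescaled sums of
  independent Sibuya variables, whose generating function is \<open>1 - (1 - z)\<^sup>\<alpha>\<close> (\<open>stable_law_exists\<close>).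
  The negative moments of \<open>S\<close> are quotients of Gamma values, and summing the exponential series gives
  \<open>E exp (- l S\<^sup>-\<^sup>\<alpha>) = E\<^sub>\<alpha>(- l)\<close> (\<open>Mittag_Leffler_stable\<close>). Hence, with the operational time
  \<open>u = (t / S)\<^sup>\<alpha>\<^sup>/\<^sup>\<beta> V\<close>, the average of the heat kernel at time \<open>u\<close> has the Fourier transform that
  defines \<open>Z(\<cdot>, t)\<close>. A function that is continuous off the origin is determined there by its tempered
  Fourier transform (\<open>tempered_fourier_unique\<close>), so this average is \<open>Z\<close>.

  The same uniqueness principle identifies \<open>Y\<close>. The fractional integral of \<open>Z\<close> and the integral over
  \<open>(0, t)\<close> of \<open>E [\<alpha> \<tau>\<^sup>\<alpha>\<^sup>-\<^sup>1 S\<^sup>-\<^sup>\<alpha> heat(x, u)]\<close> are both mixtures of heat kernels, with the same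
  transform \<open>(1 - E\<^sub>\<alpha>(- l t\<^sup>\<alpha>)) / l\<close> where \<open>l = |\<xi>|\<^sup>2\<^sup>\<beta>\<close>. Differentiation in \<open>t\<close> gives
  \<open>Y(x, t) = E [\<alpha> t\<^sup>\<alpha>\<^sup>-\<^sup>1 S\<^sup>-\<^sup>\<alpha> heat(x, u)]\<close> (\<open>Y_kernel_eq\<close>).

  This formula has three consequences. First, \<open>Y(x, t) = |x|\<^sup>-\<^sup>N L\<^sup>\<alpha>\<^sup>-\<^sup>1 y(t / L)\<close> with \<open>L = |x|\<^sup>2\<^sup>\<beta>\<^sup>/\<^sup>\<alpha>\<close>
  and \<open>y = Y(e, \<cdot>)\<close> for a unit vector \<open>e\<close>. Second, \<open>y\<close> is nonnegative with total integral
  \<open>c\<^sub>2\<^sub>\<beta>\<close> (\<open>nn_integral_Y_sub_unit\<close>). Third, \<open>y(t) \<le> K y(t')\<close> for \<open>t \<le> t' \<le> 2 t\<close>, because a fixed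
  power of \<open>t\<close> times \<open>y\<close> is increasing; together with integrability this gives \<open>y(t) = o(1 / t)\<close>.

  Since \<open>|x|\<^sup>-\<^sup>N L\<^sup>\<alpha> = E\<^sub>2\<^sub>\<beta>(x)\<close>, the convolution equals \<open>E\<^sub>2\<^sub>\<beta>(x)\<close> times \<open>M\<close> convolved with the density
  \<open>y(\<cdot> / L) / L\<close> of mass \<open>c\<^sub>2\<^sub>\<beta>\<close>. In the region \<open>|x| t\<^sup>-\<^sup>\<theta> \<rightarrow> 0\<close> the scale \<open>L\<close> is small compared with
  \<open>t\<close>, so the density concentrates at time lag zero, where \<open>M(s)\<close> is \<open>(1 + o(1)) M\<^sub>0 t\<^sup>-\<^sup>\<gamma>\<close> (with error
  \<open>o(t\<^sup>-\<^sup>\<gamma>)\<close> if \<open>M\<^sub>0 = 0\<close>). The early times, where \<open>M\<close> may be much larger than \<open>t\<^sup>-\<^sup>\<gamma>\<close>, are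
  controlled by \<open>y(r) = o(1 / r)\<close> and \<open>\<gamma> < 1\<close> (\<open>convolution_asymptotics\<close>).\<close>

section \<open>One-sided stable laws\<close>

definition stable_law :: "real \<Rightarrow> real measure \<Rightarrow> bool" where
  "stable_law a \<mu> \<longleftrightarrow> prob_space \<mu> \<and> sets \<mu> = sets borel \<and> (AE x in \<mu>. 0 < x) \<and>
     (\<forall>s\<ge>0. (LINT x|\<mu>. exp (- (s * x))) = exp (- (s powr a)))"

text \<open>The Taylor coefficients of \<open>1 - (1 - z)\<^sup>a\<close> at \<open>0\<close>: the Sibuya distribution. Its tail is of
  order \<open>k\<^sup>-\<^sup>a\<close>, so it lies in the domain of attraction of the one-sided stable law of index \<open>a\<close>.\<close>

definition sibuya_weight :: "real \<Rightarrow> nat \<Rightarrow> real" where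
  "sibuya_weight a k = (if k = 0 then 0 else - ((a gchoose k) * (-1) ^ k))"

text \<open>The sign of \<open>(-1)\<^sup>k (a choose k)\<close> is constant for \<open>k \<ge> 1\<close>, since passing from \<open>k\<close> to \<open>k + 1\<close>
  multiplies it by \<open>(k - a) / (k + 1) \<ge> 0\<close>.\<close>

lemma sibuya_weight_nonneg:
  assumes "0 < a" "a < 1"
  shows "0 \<le> sibuya_weight a k"
proof -
  have "(a gchoose Suc k) * (-1) ^ Suc k \<le> 0" for k
  proof (induction k)
    case 0
    then show ?case using assms by simp
  next
    case (Suc k)
    have "(a gchoose Suc (Suc k)) = (a gchoose Suc k) * (a - real (Suc k)) / real (Suc (Suc k))"
      using gbinomial_mult_1[of a "Suc k"] by (simp add: field_simps)
    moreover have "(g * (a - c) / d) * (-1) ^ Suc (Suc k) = (g * (-1) ^ Suc k) * ((c - a) / d)"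
      for g c d :: real
      by (simp add: divide_inverse algebra_simps)
    ultimately have "(a gchoose Suc (Suc k)) * (-1) ^ Suc (Suc k)
      = ((a gchoose Suc k) * (-1) ^ Suc k) * ((real (Suc k) - a) / real (Suc (Suc k)))"
      by (simp only:)
    moreover have "0 \<le> (real (Suc k) - a) / real (Suc (Suc k))"
      using assms by simp
    ultimately show ?case
      using Suc mult_nonpos_nonneg by metis
  qed
  then show ?thesis
    by (cases k) (auto simp: sibuya_weight_def simp del: power_Suc)
qed

lemma sibuya_weight_sums:
  assumes "0 \<le> z" "z < 1"
  shows "(\<lambda>k. sibuya_weight a k * z ^ k) sums (1 - (1 - z) powr a)"
proof -
  have "(\<lambda>k. (a gchoose k) * (- z) ^ k) sums (1 + - z) powr a"
    using assms by (intro gen_binomial_real) auto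
  from sums_diff[OF sums_single[of 0 "\<lambda>k. 1"] this]
  have "(\<lambda>k. (if k = 0 then 1 else 0) - (a gchoose k) * (- z) ^ k) sums (1 - (1 - z) powr a)"
    by simp
  moreover have "(\<lambda>k. (if k = 0 then 1 else 0) - (a gchoose k) * (- z) ^ k)
      = (\<lambda>k. sibuya_weight a k * z ^ k)"
    by (auto simp: sibuya_weight_def fun_eq_iff power_minus[of z])
  ultimately show ?thesis by simp
qed

text \<open>Abel summation by hand: all terms are nonnegative, so letting \<open>z \<rightarrow> 1\<close> in the generating
  function bounds the partial sums from above and the full sum from below.\<close>

lemma sibuya_weight_sums_1:
  assumes a: "0 < a" "a < 1"
  shows "sibuya_weight a sums 1"
proof -
  let ?p = "sibuya_weight a"
  have part: "(\<Sum>k<n. ?p k) \<le> 1" for n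
  proof (rule tendsto_upperbound)
    show "((\<lambda>z. \<Sum>k<n. ?p k * z ^ k) \<longlongrightarrow> (\<Sum>k<n. ?p k)) (at_left 1)"
      by (auto intro!: tendsto_eq_intros)
    show "\<forall>\<^sub>F z in at_left 1. (\<Sum>k<n. ?p k * z ^ k) \<le> 1"
    proof (rule eventually_at_leftI[of 0])
      fix z :: real assume "z \<in> {0<..<1}"
      then have z: "0 \<le> z" "z < 1" by auto
      have "(\<Sum>k<n. ?p k * z ^ k) \<le> (\<Sum>k. ?p k * z ^ k)"
        using z sibuya_weight_sums[OF z, of a] sibuya_weight_nonneg[OF a]
        by (intro sum_le_suminf) (auto simp: sums_iff)
      also have "\<dots> = 1 - (1 - z) powr a"
        using sibuya_weight_sums[OF z] by (simp add: sums_iff)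
      finally show "(\<Sum>k<n. ?p k * z ^ k) \<le> 1"
        using powr_ge_zero[of "1 - z" a] by linarith
    qed simp
  qed simp
  have summ: "summable ?p"
    using sibuya_weight_nonneg[OF a] part
    by (intro summableI_nonneg_bounded[where x = 1]) auto
  have "(\<Sum>k. ?p k) \<le> 1"
    using part summ by (intro suminf_le_const) auto
  moreover have "1 \<le> (\<Sum>k. ?p k)"
  proof (rule tendsto_upperbound)
    show "((\<lambda>z. 1 - (1 - z) powr a) \<longlongrightarrow> 1) (at_left 1)"
      using a by real_asymp
    show "\<forall>\<^sub>F z in at_left 1. 1 - (1 - z) powr a \<le> (\<Sum>k. ?p k)"
    proof (rule eventually_at_leftI[of 0])
      fix z :: real assume "z \<in> {0<..<1}"
      then have z: "0 \<le> z" "z < 1" by auto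
      have "1 - (1 - z) powr a = (\<Sum>k. ?p k * z ^ k)"
        using sibuya_weight_sums[OF z] by (simp add: sums_iff)
      also have "\<dots> \<le> (\<Sum>k. ?p k)"
        using z sibuya_weight_sums[OF z, of a] sibuya_weight_nonneg[OF a] summ
        by (intro suminf_le) (auto simp: sums_iff mult_left_le power_le_one)
      finally show "1 - (1 - z) powr a \<le> (\<Sum>k. ?p k)" .
    qed simp
  qed simp
  ultimately show ?thesis
    using summ by (auto simp: sums_iff)
qed

definition sibuya_pmf :: "real \<Rightarrow> nat pmf" where
  "sibuya_pmf a = embed_pmf (sibuya_weight a)"

lemma nn_integral_sibuya_pmf:
  assumes a: "0 < a" "a < 1" and z: "0 \<le> z" "z < 1"
  shows "(\<integral>\<^sup>+k. ennreal (z ^ k) \<partial>measure_pmf (sibuya_pmf a)) = ennreal (1 - (1 - z) powr a)"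
proof -
  have "(\<integral>\<^sup>+k. ennreal (sibuya_weight a k) \<partial>count_space UNIV) = 1"
    using sibuya_weight_sums_1[OF a] sibuya_weight_nonneg[OF a]
    by (simp add: nn_integral_count_space_nat suminf_ennreal2 sums_iff)
  then have pmf: "pmf (sibuya_pmf a) k = sibuya_weight a k" for k
    unfolding sibuya_pmf_def using sibuya_weight_nonneg[OF a] by (intro pmf_embed_pmf)
  have "(\<integral>\<^sup>+k. ennreal (z ^ k) \<partial>measure_pmf (sibuya_pmf a))
      = (\<integral>\<^sup>+k. ennreal (sibuya_weight a k * z ^ k) \<partial>count_space UNIV)"
    using sibuya_weight_nonneg[OF a]
    by (simp add: nn_integral_measure_pmf pmf ennreal_mult' z)
  also have "\<dots> = ennreal (1 - (1 - z) powr a)"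
    using sibuya_weight_sums[OF z, of a] sibuya_weight_nonneg[OF a] z
    by (simp add: nn_integral_count_space_nat suminf_ennreal2 sums_iff)
  finally show ?thesis .
qed

primrec sibuya_sum :: "real \<Rightarrow> nat \<Rightarrow> nat pmf" where
  "sibuya_sum a 0 = return_pmf 0"
| "sibuya_sum a (Suc n) = bind_pmf (sibuya_sum a n) (\<lambda>j. map_pmf (\<lambda>k. j + k) (sibuya_pmf a))"

text \<open>The generating function of a sum of independent variables is the product of the generating
  functions. Nonnegative integrals make the interchange of integrals free of integrability
  conditions.\<close>

lemma nn_integral_sibuya_sum:
  assumes a: "0 < a" "a < 1" and z: "0 \<le> z" "z < 1"
  shows "(\<integral>\<^sup>+k. ennreal (z ^ k) \<partial>measure_pmf (sibuya_sum a n)) = ennreal ((1 - (1 - z) powr a) ^ n)"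
proof (induction n)
  case 0
  then show ?case by (simp add: nn_integral_measure_pmf_finite)
next
  case (Suc n)
  have le: "(1 - z) powr a \<le> 1" using a z by (intro powr_le1) auto
  have "(\<integral>\<^sup>+k. ennreal (z ^ k) \<partial>measure_pmf (sibuya_sum a (Suc n)))
     = (\<integral>\<^sup>+j. (\<integral>\<^sup>+k. ennreal (z ^ j) * ennreal (z ^ k) \<partial>measure_pmf (sibuya_pmf a)) \<partial>measure_pmf (sibuya_sum a n))"
    using z by (simp add: power_add ennreal_mult)
  also have "\<dots> = ennreal ((1 - (1 - z) powr a) ^ Suc n)"
    using le z by (simp add: nn_integral_cmult nn_integral_multc nn_integral_sibuya_pmf[OF a z] Suc
        ennreal_mult' mult.commute)
  finally show ?case .
qed

text \<open>The factor \<open>n\<^sup>-\<^sup>1\<^sup>/\<^sup>a\<close> is the norming of the stable limit theorem; \<open>n + 1\<close> in place of \<open>n\<close>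
  excludes the empty sum.\<close>

definition scaled_sibuya :: "real \<Rightarrow> nat \<Rightarrow> real measure" where
  "scaled_sibuya a n =
     distr (measure_pmf (sibuya_sum a (Suc n))) borel (\<lambda>k. real k * real (Suc n) powr (- 1 / a))"

lemma real_distribution_scaled_sibuya: "real_distribution (scaled_sibuya a n)"
  unfolding scaled_sibuya_def
  by (intro prob_space.real_distribution_distr measure_pmf.prob_space_axioms) auto

lemma scaled_sibuya_laplace:
  assumes a: "0 < a" "a < 1" and s: "0 < s"
  shows "(LINT x|scaled_sibuya a n. exp (- (s * x)))
     = (1 - (1 - exp (- (s * real (Suc n) powr (- 1 / a)))) powr a) ^ Suc n"
proof -
  define z where "z = exp (- (s * real (Suc n) powr (- 1 / a)))"
  have z: "0 \<le> z" "z < 1" using s by (auto simp: z_def)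
  have le: "(1 - z) powr a \<le> 1" using a z by (intro powr_le1) auto
  have "(LINT x|scaled_sibuya a n. exp (- (s * x))) = (LINT k|measure_pmf (sibuya_sum a (Suc n)). z ^ k)"
    unfolding scaled_sibuya_def
    by (subst integral_distr)
      (auto simp: z_def mult_ac simp flip: exp_of_nat_mult simp del: sibuya_sum.simps intro!: Bochner_Integration.integral_cong)
  also have "\<dots> = enn2real (\<integral>\<^sup>+k. ennreal (z ^ k) \<partial>measure_pmf (sibuya_sum a (Suc n)))"
    using z by (intro integral_eq_nn_integral) auto
  also have "\<dots> = (1 - (1 - z) powr a) ^ Suc n"
    using le by (subst nn_integral_sibuya_sum[OF a z]) (simp add: zero_le_power)
  finally show ?thesis by (simp add: z_def)
qed

lemma AE_scaled_sibuya_nonneg: "AE x in scaled_sibuya a n. 0 \<le> x"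
  unfolding scaled_sibuya_def by (subst AE_distr_iff) auto

text \<open>The Laplace transform controls tails: \<open>1 - exp (- x / b)\<close> is at least \<open>1 - exp (- 1)\<close> beyond
  \<open>b\<close>, and Bernoulli's inequality bounds its mean by \<open>b\<^sup>-\<^sup>a\<close>, uniformly in \<open>n\<close>.\<close>

lemma tight_scaled_sibuya:
  assumes a: "0 < a" "a < 1"
  shows "tight (scaled_sibuya a)"
  unfolding tight_def
proof (intro conjI allI impI real_distribution_scaled_sibuya)
  fix e :: real assume e: "e > 0"
  define q where "q = 1 - exp (- 1 :: real)"
  have q: "q > 0" by (simp add: q_def)
  define b where "b = (2 / (e * q)) powr (1 / a)"
  have b: "b > 0" using e q by (simp add: b_def)
  have ba: "b powr (- a) = e * q / 2"
    using a e q by (simp add: b_def powr_powr powr_minus field_simps)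
  show "\<exists>c d. c < d \<and> (\<forall>n. 1 - e < measure (scaled_sibuya a n) {c<..d})"
  proof (rule exI[of _ "-1"], rule exI[of _ b], intro conjI allI)
    show "-1 < b" using b by simp
    fix n
    interpret real_distribution "scaled_sibuya a n" by (rule real_distribution_scaled_sibuya)
    let ?m = "real (Suc n)"
    let ?L = "LINT x|scaled_sibuya a n. exp (- (1 / b * x))"
    define y where "y = 1 / b * ?m powr (- 1 / a)"
    have y: "y > 0" using b by (simp add: y_def)
    have ya: "y powr a = b powr (- a) / ?m"
      using a b by (simp add: y_def powr_mult powr_divide powr_powr powr_minus field_simps)
    have "(1 - exp (- y)) powr a \<le> y powr a"
      using a y exp_ge_add_one_self[of "- y"] by (intro powr_mono2) auto
    also have "\<dots> = b powr (- a) / ?m" by (rule ya)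
    finally have le: "(1 - exp (- y)) powr a \<le> b powr (- a) / ?m" .
    have le1: "(1 - exp (- y)) powr a \<le> 1" using a y by (intro powr_le1) auto
    \<comment> \<open>Bernoulli's inequality for the power \<open>n + 1\<close>\<close>
    have "1 - b powr (- a) = 1 + ?m * (- (b powr (- a) / ?m))"
      by simp
    also have "\<dots> \<le> 1 + ?m * (- ((1 - exp (- y)) powr a))"
      using le by (intro add_left_mono mult_left_mono) auto
    also have "\<dots> \<le> (1 + (- ((1 - exp (- y)) powr a))) ^ Suc n"
      using le1 by (intro Bernoulli_inequality) auto
    also have "\<dots> = ?L"
      using scaled_sibuya_laplace[OF a, of "1 / b" n] b by (simp add: y_def)
    finally have L: "1 - b powr (- a) \<le> ?L" .
    have intg: "integrable (scaled_sibuya a n) (\<lambda>x. 1 - exp (- (1 / b * x)))"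
      using AE_scaled_sibuya_nonneg[of a n] b
      by (intro Bochner_Integration.integrable_diff integrable_const integrable_const_bound[where B = 1]) auto
    have "q * measure (scaled_sibuya a n) (- {-1<..b}) = (LINT x|scaled_sibuya a n. q * indicator (- {-1<..b}) x)"
      by simp
    also have "\<dots> \<le> (LINT x|scaled_sibuya a n. 1 - exp (- (1 / b * x)))"
    proof (rule integral_mono_AE)
      show "AE x in scaled_sibuya a n. q * indicator (- {-1<..b}) x \<le> 1 - exp (- (1 / b * x))"
        using AE_scaled_sibuya_nonneg[of a n]
      proof eventually_elim
        case (elim x)
        then show ?case
          using b by (cases "x \<le> b") (auto simp: q_def field_simps split: split_indicator)
      qed
    qed (use intg q in \<open>auto intro!: integrable_const_bound[where B = "\<bar>q\<bar> + 1"] simp del: integrable_mult_right_iff split: split_indicator\<close>)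
    also have "\<dots> = 1 - ?L"
      using AE_scaled_sibuya_nonneg[of a n] b prob_space
      by (subst Bochner_Integration.integral_diff) (auto intro!: integrable_const_bound[where B = 1])
    also have "\<dots> \<le> e * q / 2" using L ba by simp
    finally have "measure (scaled_sibuya a n) (- {-1<..b}) \<le> e / 2"
      using q by (simp add: field_simps)
    moreover have "measure (scaled_sibuya a n) (- {-1<..b}) = 1 - measure (scaled_sibuya a n) {-1<..b}"
      using prob_compl[of "{-1<..b}"] by (simp add: Compl_eq_Diff_UNIV)
    ultimately show "1 - e < measure (scaled_sibuya a n) {-1<..b}"
      using e by simp
  qed
qed

lemma scaled_sibuya_laplace_limit:
  assumes a: "0 < a" "a < 1" and s: "0 < s"
  shows "(\<lambda>n. (1 - (1 - exp (- (s * real (Suc n) powr (- 1 / a)))) powr a) ^ Suc n)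
     \<longlonglongrightarrow> exp (- (s powr a))"
proof -
  have "((\<lambda>m. (1 - (1 - exp (- (s * m powr (- 1 / a)))) powr a) powr m) \<longlongrightarrow> exp (- (s powr a))) at_top"
    using a s by real_asymp
  moreover have "filterlim (\<lambda>n. real (Suc n)) at_top sequentially"
    by real_asymp
  ultimately have "(\<lambda>n. (1 - (1 - exp (- (s * real (Suc n) powr (- 1 / a)))) powr a) powr real (Suc n))
     \<longlonglongrightarrow> exp (- (s powr a))"
    by (rule filterlim_compose)
  moreover have "(1 - (1 - exp (- (s * real (Suc n) powr (- 1 / a)))) powr a) powr real (Suc n)
      = (1 - (1 - exp (- (s * real (Suc n) powr (- 1 / a)))) powr a) ^ Suc n" for n
  proof (rule powr_realpow)
    have "(1 - exp (- (s * real (Suc n) powr (- 1 / a)))) powr a < 1 powr a"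
      using a s by (intro powr_less_mono2) auto
    then show "0 < 1 - (1 - exp (- (s * real (Suc n) powr (- 1 / a)))) powr a" by simp
  qed
  ultimately show ?thesis by simp
qed

text \<open>Tightness yields a weak limit point. The test functions \<open>exp (- s max(0, x))\<close> are bounded
  and continuous, so the Laplace transforms converge to \<open>exp (- s\<^sup>a)\<close>. This tends to \<open>0\<close> as \<open>s \<rightarrow>
  \<infinity>\<close>, which excludes an atom at the origin.\<close>

lemma stable_law_exists_less_1:
  assumes a: "0 < a" "a < 1"
  shows "\<exists>\<mu>. stable_law a \<mu>"
proof -
  obtain r \<mu> where r: "strict_mono r" and \<mu>: "real_distribution \<mu>"
    and w: "weak_conv_m (scaled_sibuya a \<circ> (\<lambda>n. n) \<circ> r) \<mu>"
    using tight_imp_convergent_subsubsequence[OF tight_scaled_sibuya[OF a], of "\<lambda>n. n"]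
    by (auto simp: strict_mono_def)
  interpret \<mu>: real_distribution \<mu> by (rule \<mu>)
  have conv: "(\<lambda>n. LINT x|scaled_sibuya a (r n). f x) \<longlonglongrightarrow> (LINT x|\<mu>. f x)"
    if "\<And>x. isCont f x" "\<And>x. norm (f x) \<le> B" for f :: "real \<Rightarrow> real" and B
  proof -
    have "(\<lambda>n. LINT x|(scaled_sibuya a \<circ> (\<lambda>n. n) \<circ> r) n. f x) \<longlonglongrightarrow> (LINT x|\<mu>. f x)"
      by (rule weak_conv_imp_integral_bdd_continuous_conv[OF _ \<mu> w])
        (use that in \<open>auto simp: real_distribution_scaled_sibuya\<close>)
    then show ?thesis by simp
  qed
  have nonneg: "AE x in \<mu>. 0 \<le> x"
  proof -
    \<comment> \<open>a bounded continuous test function that detects the negative half-line\<close>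
    let ?g = "\<lambda>x::real. min 1 (max 0 (- x))"
    have "(\<lambda>n. LINT x|scaled_sibuya a (r n). ?g x) \<longlonglongrightarrow> (LINT x|\<mu>. ?g x)"
      by (rule conv[of _ 1]) (auto intro!: continuous_intros)
    moreover have "(LINT x|scaled_sibuya a (r n). ?g x) = 0" for n
      using AE_scaled_sibuya_nonneg[of a "r n"]
      by (intro integral_eq_zero_AE) (auto elim!: eventually_mono)
    ultimately have "(LINT x|\<mu>. ?g x) = 0"
      by (simp add: LIMSEQ_const_iff)
    then have "AE x in \<mu>. ?g x = 0"
      by (subst (asm) integral_nonneg_eq_0_iff_AE)
        (auto intro!: \<mu>.integrable_const_bound[where B = 1])
    then show ?thesis by eventually_elim (auto simp: min_def max_def split: if_splits)
  qed
  have lap: "(LINT x|\<mu>. exp (- (s * x))) = exp (- (s powr a))" if "s > 0" for s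
  proof -
    let ?g = "\<lambda>x. exp (- (s * max 0 x))"
    have "(\<lambda>n. LINT x|scaled_sibuya a (r n). ?g x) \<longlonglongrightarrow> (LINT x|\<mu>. ?g x)"
      using that by (intro conv[of _ 1]) (auto intro!: continuous_intros)
    moreover have "(LINT x|scaled_sibuya a (r n). ?g x) = (LINT x|scaled_sibuya a (r n). exp (- (s * x)))" for n
    proof (intro integral_cong_AE)
      show "AE x in scaled_sibuya a (r n). ?g x = exp (- (s * x))"
        using AE_scaled_sibuya_nonneg[of a "r n"] by eventually_elim simp
    qed (auto simp: scaled_sibuya_def)
    moreover have "(LINT x|\<mu>. ?g x) = (LINT x|\<mu>. exp (- (s * x)))"
    proof (intro integral_cong_AE)
      show "AE x in \<mu>. ?g x = exp (- (s * x))"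
        using nonneg by eventually_elim simp
    qed auto
    ultimately have "(\<lambda>n. LINT x|scaled_sibuya a (r n). exp (- (s * x))) \<longlonglongrightarrow> (LINT x|\<mu>. exp (- (s * x)))"
      by simp
    moreover have "(\<lambda>n. LINT x|scaled_sibuya a (r n). exp (- (s * x))) \<longlonglongrightarrow> exp (- (s powr a))"
      using LIMSEQ_subseq_LIMSEQ[OF scaled_sibuya_laplace_limit[OF a that] r]
      by (simp add: scaled_sibuya_laplace[OF a that] o_def)
    ultimately show ?thesis by (rule LIMSEQ_unique)
  qed
  have "\<mu>.prob {0} \<le> exp (- (s powr a))" if "s > 0" for s
  proof -
    have "\<mu>.prob {0} = (LINT x|\<mu>. indicator {0} x)" by simp
    also have "\<dots> \<le> (LINT x|\<mu>. exp (- (s * x)))"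
      using nonneg that
      by (intro integral_mono_AE \<mu>.integrable_const_bound[where B = 1])
        (auto elim!: eventually_mono split: split_indicator)
    finally show ?thesis using lap[OF that] by simp
  qed
  then have ev: "\<forall>\<^sub>F s in at_top. \<mu>.prob {0} \<le> exp (- (s powr a))"
    by (auto intro!: eventually_mono[OF eventually_gt_at_top[of 0]])
  have "((\<lambda>s. exp (- (s powr a))) \<longlongrightarrow> 0) at_top"
    using a by real_asymp
  then have "\<mu>.prob {0} \<le> 0"
    using ev by (rule tendsto_lowerbound) simp
  then have "AE x in \<mu>. x \<notin> {0}"
    by (intro AE_not_in) (auto simp: null_sets_def \<mu>.emeasure_eq_measure measure_le_0_iff)
  with nonneg have "AE x in \<mu>. 0 < x" by eventually_elim auto
  moreover have "(LINT x|\<mu>. exp (- (s * x))) = exp (- (s powr a))" if "s \<ge> 0" for s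
    using lap[of s] that \<mu>.prob_space by (cases "s = 0") auto
  ultimately show ?thesis
    using \<mu>.prob_space_axioms unfolding stable_law_def by auto
qed

lemma stable_law_exists:
  assumes "0 < a" "a \<le> 1"
  shows "\<exists>\<mu>. stable_law a \<mu>"
proof (cases "a = 1")
  case True
  have "stable_law 1 (return borel 1)"
    by (auto simp: stable_law_def prob_space_return AE_return integral_return)
  then show ?thesis using True by blast
next
  case False
  then show ?thesis using stable_law_exists_less_1 assms by simp
qed

section \<open>Negative moments and the Mittag-Leffler function\<close>

text \<open>Gamma's integral after the substitution \<open>y = A t\<^sup>a\<close>. Negative exponents \<open>a\<close> are included:
  they occur when a Gaussian is integrated over its time variable.\<close>

lemma nn_integral_gamma_powr:
  fixes a p A :: real
  assumes a: "a \<noteq> 0" and p: "0 < p" and A: "0 < A"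
  shows "(\<integral>\<^sup>+t. ennreal (indicator {0<..} t * (t powr (a * p - 1) * exp (- (A * t powr a)))) \<partial>lborel)
     = ennreal (Gamma p * A powr (- p) / \<bar>a\<bar>)"
proof -
  let ?S = "{0<..} :: real set"
  let ?f = "\<lambda>y. y powr (p - 1) / exp y"
  let ?g = "\<lambda>t. A * t powr a"
  let ?g' = "\<lambda>t. A * (a * t powr (a - 1))"
  have "(?f has_integral Gamma p) {0..}" using Gamma_integral_real[OF p] .
  then have fI: "(?f has_integral Gamma p) ?S"
    by (rule has_integral_spike_set_eq[THEN iffD1, rotated 2])
      (auto intro!: empty_imp_negligible negligible_subset[of "{0 :: real}"])
  then have "?f absolutely_integrable_on ?S"
    by (intro nonnegative_absolutely_integrable_1) (auto simp: has_integral_integrable)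
  moreover have img: "?g ` ?S = ?S"
  proof (intro equalityI subsetI)
    fix y :: real assume "y \<in> ?S"
    then have "y = ?g ((y / A) powr (1 / a))" "(y / A) powr (1 / a) \<in> ?S"
      using a A by (auto simp: powr_powr)
    then show "y \<in> ?g ` ?S" by blast
  qed (use A in auto)
  moreover have inj: "inj_on ?g ?S"
  proof (rule inj_onI)
    fix x y :: real assume xy: "x \<in> ?S" "y \<in> ?S" "?g x = ?g y"
    then have "(x powr a) powr (1 / a) = (y powr a) powr (1 / a)" using A by simp
    then show "x = y" using xy a by (simp add: powr_powr)
  qed
  moreover have "(?g has_field_derivative ?g' t) (at t within ?S)" if "t \<in> ?S" for t
    using that by (auto intro!: derivative_eq_intros)
  ultimately have "(\<lambda>t. \<bar>?g' t\<bar> * ?f (?g t)) absolutely_integrable_on ?S \<and>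
      integral ?S (\<lambda>t. \<bar>?g' t\<bar> * ?f (?g t)) = Gamma p"
    using has_absolute_integral_change_of_variables_1'[of ?S ?g ?g' ?f "Gamma p"] fI
    by (auto simp: integral_unique)
  then have "((\<lambda>t. \<bar>?g' t\<bar> * ?f (?g t)) has_integral Gamma p) ?S"
    using has_integral_integrable_integral set_lebesgue_integral_eq_integral(1) by blast
  then have "((\<lambda>t. A powr (- p) / \<bar>a\<bar> * (\<bar>?g' t\<bar> * ?f (?g t))) has_integral A powr (- p) / \<bar>a\<bar> * Gamma p) ?S"
    by (rule has_integral_mult_right)
  moreover have "A powr (- p) / \<bar>a\<bar> * (\<bar>?g' t\<bar> * ?f (?g t)) = t powr (a * p - 1) * exp (- (A * t powr a))"
    if "t \<in> ?S" for t
  proof -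
    have "A powr (- p) / \<bar>a\<bar> * (\<bar>?g' t\<bar> * ?f (?g t))
        = (A powr (- p) * A * A powr (p - 1)) * (t powr (a - 1) * (t powr a) powr (p - 1)) * exp (- (A * t powr a))"
      using a A that by (simp add: abs_mult powr_mult exp_minus field_simps)
    also have "A powr (- p) * A * A powr (p - 1) = 1"
      using A by (simp add: powr_minus powr_diff field_simps)
    also have "t powr (a - 1) * (t powr a) powr (p - 1) = t powr (a * p - 1)"
      using that by (simp add: powr_powr powr_add[symmetric] algebra_simps)
    finally show ?thesis by simp
  qed
  ultimately have "((\<lambda>t. t powr (a * p - 1) * exp (- (A * t powr a))) has_integral A powr (- p) / \<bar>a\<bar> * Gamma p) ?S"
    by (metis (no_types, lifting) has_integral_cong)
  from nn_integral_has_integral_lebesgue[OF _ this]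
  show ?thesis by (simp add: mult_ac)
qed

lemma stable_lawD:
  assumes "stable_law a \<mu>"
  shows "prob_space \<mu>" "sets \<mu> = sets borel" "AE x in \<mu>. 0 < x"
    and "0 \<le> s \<Longrightarrow> (LINT x|\<mu>. exp (- (s * x))) = exp (- (s powr a))"
  using assms by (auto simp: stable_law_def)

lemma nn_integral_laplace_stable:
  assumes "stable_law a \<mu>" "0 \<le> s"
  shows "(\<integral>\<^sup>+x. ennreal (exp (- (s * x))) \<partial>\<mu>) = ennreal (exp (- (s powr a)))"
proof -
  interpret prob_space \<mu> using stable_lawD[OF assms(1)] by simp
  note [measurable_cong] = stable_lawD(2)[OF assms(1)]
  have "integrable \<mu> (\<lambda>x. exp (- (s * x)))"
    using stable_lawD(3)[OF assms(1)] assms(2)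
    by (intro integrable_const_bound[where B = 1]) (auto elim!: eventually_mono)
  then show ?thesis
    using stable_lawD(4)[OF assms] by (subst nn_integral_eq_integral) auto
qed

text \<open>Integrate \<open>Gamma q * x\<^sup>-\<^sup>q = \<integral> s\<^sup>q\<^sup>-\<^sup>1 exp (- s x) ds\<close> against the law and use its Laplace
  transform; the remaining integral over \<open>s\<close> is again of Gamma type.\<close>

lemma stable_negative_moment:
  assumes st: "stable_law a \<mu>" and a: "0 < a" and q: "0 \<le> q"
  shows "(\<integral>\<^sup>+x. ennreal (x powr (- q)) \<partial>\<mu>) = ennreal (Gamma (1 + q / a) / Gamma (1 + q))"
proof (cases "q = 0")
  case True
  interpret prob_space \<mu> using stable_lawD[OF st] by simp
  note [measurable_cong] = stable_lawD(2)[OF st]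
  have "(\<integral>\<^sup>+x. ennreal (x powr (- q)) \<partial>\<mu>) = (\<integral>\<^sup>+x. 1 \<partial>\<mu>)"
    using stable_lawD(3)[OF st] True by (intro nn_integral_cong_AE) (auto elim!: eventually_mono)
  then show ?thesis using True by (simp add: emeasure_space_1)
next
  case False
  then have q: "q > 0" using q by simp
  interpret prob_space \<mu> using stable_lawD[OF st] by simp
  note [measurable_cong] = stable_lawD(2)[OF st]
  interpret pair_sigma_finite lborel \<mu> ..
  have "ennreal (Gamma q) * (\<integral>\<^sup>+x. ennreal (x powr (- q)) \<partial>\<mu>)
      = (\<integral>\<^sup>+x. ennreal (Gamma q * x powr (- q)) \<partial>\<mu>)"
    using q by (subst nn_integral_cmult[symmetric]) (auto simp: ennreal_mult)
  also have "\<dots> = (\<integral>\<^sup>+x. (\<integral>\<^sup>+s. ennreal (indicator {0<..} s * (s powr (1 * q - 1) * exp (- (x * s powr 1)))) \<partial>lborel) \<partial>\<mu>)"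
    using stable_lawD(3)[OF st]
    by (intro nn_integral_cong_AE, eventually_elim) (simp only: nn_integral_gamma_powr q, simp)
  also have "\<dots> = (\<integral>\<^sup>+s. (\<integral>\<^sup>+x. ennreal (indicator {0<..} s * (s powr (1 * q - 1) * exp (- (x * s powr 1)))) \<partial>\<mu>) \<partial>lborel)"
    by (rule Fubini') measurable
  also have "\<dots> = (\<integral>\<^sup>+s. ennreal (indicator {0<..} s * (s powr (a * (q / a) - 1) * exp (- (1 * s powr a)))) \<partial>lborel)"
  proof (intro nn_integral_cong)
    fix s :: real
    show "(\<integral>\<^sup>+x. ennreal (indicator {0<..} s * (s powr (1 * q - 1) * exp (- (x * s powr 1)))) \<partial>\<mu>)
       = ennreal (indicator {0<..} s * (s powr (a * (q / a) - 1) * exp (- (1 * s powr a))))"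
    proof (cases "s > 0")
      case True
      have "(\<integral>\<^sup>+x. ennreal (indicator {0<..} s * (s powr (1 * q - 1) * exp (- (x * s powr 1)))) \<partial>\<mu>)
          = ennreal (s powr (q - 1)) * (\<integral>\<^sup>+x. ennreal (exp (- (s * x))) \<partial>\<mu>)"
        using True by (subst nn_integral_cmult[symmetric]) (auto simp: ennreal_mult mult.commute)
      then show ?thesis
        using True a by (simp add: nn_integral_laplace_stable[OF st] ennreal_mult)
    qed simp
  qed
  also have "\<dots> = ennreal (Gamma (q / a) / a)"
    using a q by (subst nn_integral_gamma_powr) auto
  finally have eq: "ennreal (Gamma q) * (\<integral>\<^sup>+x. ennreal (x powr (- q)) \<partial>\<mu>) = ennreal (Gamma (q / a) / a)" .
  have pos: "Gamma q > 0" "Gamma (q / a) > 0" using q a by auto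
  have "ennreal (1 / Gamma q) * (ennreal (Gamma q) * (\<integral>\<^sup>+x. ennreal (x powr (- q)) \<partial>\<mu>))
      = (\<integral>\<^sup>+x. ennreal (x powr (- q)) \<partial>\<mu>)"
    using pos by (simp add: mult.assoc[symmetric] ennreal_mult[symmetric])
  then have "(\<integral>\<^sup>+x. ennreal (x powr (- q)) \<partial>\<mu>) = ennreal (1 / Gamma q * (Gamma (q / a) / a))"
    unfolding eq using pos a by (subst (asm) ennreal_mult[symmetric]) auto
  also have "1 / Gamma q * (Gamma (q / a) / a) = Gamma (1 + q / a) / Gamma (1 + q)"
  proof -
    have "q \<notin> \<int>\<^sub>\<le>\<^sub>0" "q / a \<notin> \<int>\<^sub>\<le>\<^sub>0"
      using q a nonpos_Ints_nonpos[of q] nonpos_Ints_nonpos[of "q / a"] by (auto simp: field_simps)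
    then have "Gamma (1 + q) = q * Gamma q" "Gamma (1 + q / a) = (q / a) * Gamma (q / a)"
      using Gamma_plus1[of q] Gamma_plus1[of "q / a"] by (simp_all add: add.commute)
    then show ?thesis using q a pos by (simp only:) (simp add: divide_simps)
  qed
  finally show ?thesis .
qed

text \<open>Gamma grows faster than any exponential: restricting Gamma's integral to \<open>t \<ge> c\<close> gives
  \<open>Gamma (1 + y) \<ge> c\<^sup>y exp (- c)\<close> for every \<open>c > 0\<close>.\<close>

lemma summable_Mittag_Leffler_norm:
  assumes a: "0 < a"
  shows "summable (\<lambda>k. \<bar>x\<bar> ^ k / Gamma (1 + real k * a))"
proof -
  define c where "c = (2 * \<bar>x\<bar> + 1) powr (1 / a)"
  have c: "c > 0" "c powr a = 2 * \<bar>x\<bar> + 1" using a by (auto simp: c_def powr_powr)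
  have G: "c powr y * exp (- c) \<le> Gamma (1 + y)" if "y \<ge> 0" for y
  proof -
    have "ennreal (c powr y * exp (- c)) = ennreal (c powr y) * (\<integral>\<^sup>+t. ennreal (indicator {c..} t * exp (- t)) \<partial>lborel)"
    proof -
      have "(\<integral>\<^sup>+t. ennreal (exp (- t)) * indicator {c..} t \<partial>lborel) = ennreal (0 - (- exp (- c)))"
        by (rule nn_integral_FTC_atLeast)
          (auto intro!: derivative_eq_intros, real_asymp)
      also have "(\<integral>\<^sup>+t. ennreal (exp (- t)) * indicator {c..} t \<partial>lborel)
          = (\<integral>\<^sup>+t. ennreal (indicator {c..} t * exp (- t)) \<partial>lborel)"
        by (intro nn_integral_cong) (auto split: split_indicator)
      finally show ?thesis
        by (simp add: ennreal_mult)
    qed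
    also have "\<dots> = (\<integral>\<^sup>+t. ennreal (c powr y * (indicator {c..} t * exp (- t))) \<partial>lborel)"
      by (subst nn_integral_cmult[symmetric]) (auto simp: ennreal_mult)
    also have "\<dots> \<le> (\<integral>\<^sup>+t. ennreal (indicator {0..} t * t powr ((1 + y) - 1) / exp t) \<partial>lborel)"
      using c that
      by (intro nn_integral_mono ennreal_leI)
        (auto simp: exp_minus field_simps intro!: powr_mono2 split: split_indicator)
    also have "\<dots> = ennreal (Gamma (1 + y))"
      using that by (intro Gamma_conv_nn_integral_real[symmetric]) auto
    finally show ?thesis using that by (subst (asm) ennreal_le_iff) (auto intro!: less_imp_le Gamma_real_pos)
  qed
  have Gpos: "Gamma (1 + real k * a) > 0" for k
    using a by (intro Gamma_real_pos add_pos_nonneg) auto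
  show ?thesis
  proof (rule summable_comparison_test')
    show "summable (\<lambda>k. exp c * (1 / 2) ^ k)"
      by (intro summable_mult summable_geometric) auto
    fix k :: nat
    have ck: "c powr (real k * a) = (2 * \<bar>x\<bar> + 1) ^ k"
      using c by (simp add: powr_powr[symmetric] mult.commute[of _ a] powr_realpow)
    have "\<bar>x\<bar> ^ k / Gamma (1 + real k * a) \<le> \<bar>x\<bar> ^ k / (c powr (real k * a) * exp (- c))"
      using G[of "real k * a"] a c by (intro divide_left_mono mult_pos_pos) (auto intro!: Gamma_real_pos add_pos_nonneg)
    also have "\<dots> = exp c * (\<bar>x\<bar> / (2 * \<bar>x\<bar> + 1)) ^ k"
      unfolding ck by (simp add: exp_minus power_divide field_simps)
    also have "\<dots> \<le> exp c * (1 / 2) ^ k"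
      by (intro mult_left_mono power_mono) (auto simp: field_simps)
    finally show "norm (\<bar>x\<bar> ^ k / Gamma (1 + real k * a)) \<le> exp c * (1 / 2) ^ k"
      using Gpos[of k] by simp
  qed
qed

text \<open>If \<open>S\<close> is stable of index \<open>a\<close>, then \<open>S\<^sup>-\<^sup>a\<close> has the moments \<open>k! / Gamma (1 + k a)\<close>, so the
  factorials cancel in the exponential series.\<close>

lemma Mittag_Leffler_stable:
  assumes st: "stable_law a \<mu>" and a: "0 < a" and l: "0 \<le> l"
  shows "(LINT x|\<mu>. exp (- (l * x powr (- a)))) = Mittag_Leffler a (- l)"
proof -
  interpret prob_space \<mu> using stable_lawD[OF st] by simp
  note [measurable_cong] = stable_lawD(2)[OF st]
  let ?f = "\<lambda>k x. (- l) ^ k / fact k * x powr (- (real k * a))"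
  have nn: "(\<integral>\<^sup>+x. ennreal (x powr (- (real k * a))) \<partial>\<mu>) = ennreal (fact k / Gamma (1 + real k * a))" for k
    using stable_negative_moment[OF st a, of "real k * a"] a by (simp add: Gamma_fact add.commute)
  have Gpos: "Gamma (1 + real k * a) > 0" for k
    using a by (intro Gamma_real_pos add_pos_nonneg) auto
  have int: "integrable \<mu> (\<lambda>x. x powr (- (real k * a)))" for k
    by (rule integrableI_nonneg) (auto simp: nn)
  have ev: "(LINT x|\<mu>. x powr (- (real k * a))) = fact k / Gamma (1 + real k * a)" for k
    using Gpos[of k] by (subst integral_eq_nn_integral) (auto simp: nn)
  have expf: "?f k x = (- (l * x powr (- a))) ^ k / fact k" if "x > 0" for k x
  proof -
    have "(x powr (- a)) ^ k = x powr (- (real k * a))"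
      using that by (simp add: powr_realpow[symmetric] powr_powr mult.commute)
    moreover have "(- (l * x powr (- a))) ^ k = (- l) ^ k * (x powr (- a)) ^ k"
      by (simp add: power_mult_distrib[symmetric])
    ultimately show ?thesis by simp
  qed
  have "(\<lambda>k. integral\<^sup>L \<mu> (?f k)) sums (LINT x|\<mu>. (\<Sum>k. ?f k x))"
  proof (rule sums_integral)
    show "AE x in \<mu>. summable (\<lambda>k. norm (?f k x))"
      using stable_lawD(3)[OF st]
    proof eventually_elim
      case (elim x)
      have "norm (?f k x) = norm ((- (l * x powr (- a))) ^ k /\<^sub>R fact k)" for k
        unfolding expf[OF elim] by (simp only: divide_inverse real_scaleR_def mult.commute)
      then show ?case
        using summable_norm_exp[of "- (l * x powr (- a))"] by simp
    qed
    have "(LINT x|\<mu>. norm (?f k x)) = \<bar>l\<bar> ^ k / Gamma (1 + real k * a)" for k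
      using ev[of k] by (simp add: abs_mult power_abs)
    then show "summable (\<lambda>k. LINT x|\<mu>. norm (?f k x))"
      using summable_Mittag_Leffler_norm[OF a, of l] by simp
  qed (use int in auto)
  moreover have "(LINT x|\<mu>. (\<Sum>k. ?f k x)) = (LINT x|\<mu>. exp (- (l * x powr (- a))))"
  proof (rule integral_cong_AE)
    show "AE x in \<mu>. (\<Sum>k. ?f k x) = exp (- (l * x powr (- a)))"
      using stable_lawD(3)[OF st]
    proof eventually_elim
      case (elim x)
      show ?case
        unfolding expf[OF elim] exp_def by (simp only: divide_inverse real_scaleR_def mult.commute)
    qed
  qed measurable
  moreover have "integral\<^sup>L \<mu> (?f k) = (- l) ^ k / Gamma (1 + real k * a)" for k
    using ev[of k] by simp
  ultimately show ?thesis
    by (simp add: Mittag_Leffler_def sums_iff)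
qed

section \<open>The Gaussian heat kernel\<close>

lemma std_normal_density_integral: "(LINT x|density lborel std_normal_density. iexp (t * x)) = (LINT x|lborel. std_normal_density x *\<^sub>R iexp (t * x))"
proof (rule integral_density)
  show "AE x in lborel. 0 \<le> std_normal_density x" by (simp add: normal_density_nonneg)
  show "(\<lambda>x. iexp (t * x)) \<in> borel_measurable lborel" by measurable
qed measurable
lemma std_normal_density_fourier: "(LINT x|lborel. std_normal_density x *\<^sub>R iexp (t * x)) = complex_of_real (exp (- (t\<^sup>2 / 2)))"
proof -
  have "(LINT x|lborel. std_normal_density x *\<^sub>R iexp (t * x)) = char std_normal_distribution t"
    unfolding char_def std_normal_density_integral ..
  then show ?thesis unfolding fun_cong[OF char_std_normal_distribution] by simp
qed

lemma gaussian_fourier_1: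
  fixes s w :: real
  assumes s: "0 < s"
  shows "integrable lborel (\<lambda>x. complex_of_real (exp (- (s * x\<^sup>2))) * exp (- (\<i> * complex_of_real (x * w))))"
    and "(LINT x|lborel. complex_of_real (exp (- (s * x\<^sup>2))) * exp (- (\<i> * complex_of_real (x * w))))
      = complex_of_real (sqrt (pi / s) * exp (- (w\<^sup>2 / (4 * s))))"
proof -
  define c where "c = sqrt (2 * s)"
  have c: "c > 0" "c\<^sup>2 = 2 * s" unfolding c_def using s
    by (intro real_sqrt_gt_zero, simp, intro real_sqrt_pow2, simp)
  obtain t where t: "\<And>x. t * (c * x) = - (x * w)" "t\<^sup>2 / 2 = w\<^sup>2 / (4 * s)"
  proof
    show "- w / c * (c * x) = - (x * w)" for x using c by simp
    show "(- w / c)\<^sup>2 / 2 = w\<^sup>2 / (4 * s)"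
      unfolding power_divide c(2) by simp
  qed
  let ?F = "\<lambda>x. std_normal_density x *\<^sub>R iexp (t * x)"
  let ?G = "\<lambda>x. complex_of_real (exp (- (s * x\<^sup>2))) * exp (- (\<i> * complex_of_real (x * w)))"
  have nd: "integrable lborel std_normal_density"
    by (rule integrable_normal_density) simp
  have iF: "integrable lborel ?F"
    by (rule Bochner_Integration.integrable_bound[OF nd]) auto
  have eq: "?G x = sqrt (2 * pi) *\<^sub>R ?F (0 + c * x)" for x
  proof -
    have "(c * x)\<^sup>2 / 2 = s * x\<^sup>2" using c by (simp add: power_mult_distrib)
    then have d: "sqrt (2 * pi) * std_normal_density (c * x) = exp (- (s * x\<^sup>2))"
      by (simp add: std_normal_density_def)
    show ?thesis
      unfolding scaleR_scaleR add_0 d t(1) by (simp add: scaleR_conv_of_real)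
  qed
  have i2: "integrable lborel (\<lambda>x. ?F (0 + c * x))"
    using c iF by (intro lborel_integrable_real_affine) auto
  show "integrable lborel ?G"
    unfolding eq by (intro integrable_scaleR_right i2)
  have "(LINT x|lborel. ?F (0 + c * x)) = (LINT x|lborel. ?F x) /\<^sub>R c"
    using lborel_integral_real_affine[of c ?F 0] c by simp
  then have "(LINT x|lborel. sqrt (2 * pi) *\<^sub>R ?F (0 + c * x)) = sqrt (2 * pi) *\<^sub>R ((LINT x|lborel. ?F x) /\<^sub>R c)"
    by (simp only: integral_scaleR_right)
  also have "\<dots> = complex_of_real (sqrt (2 * pi) / c * exp (- (t\<^sup>2 / 2)))"
    unfolding std_normal_density_fourier
    by (simp only: scaleR_conv_of_real of_real_mult[symmetric] divide_inverse mult.assoc)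
  also have "sqrt (2 * pi) / c = sqrt (pi / s)"
    using s by (simp add: c_def real_sqrt_mult real_sqrt_divide)
  finally show "(LINT x|lborel. ?G x) = complex_of_real (sqrt (pi / s) * exp (- (w\<^sup>2 / (4 * s))))"
    unfolding eq t(2) .
qed

text \<open>The integrand is a product over the coordinates, which reduces the claim to dimension one.\<close>

lemma gaussian_fourier:
  fixes w :: "'a :: euclidean_space"
  assumes s: "0 < s"
  shows "integrable lborel (\<lambda>x. complex_of_real (exp (- (s * (norm x)\<^sup>2))) * exp (- (\<i> * complex_of_real (x \<bullet> w))))"
    and "(LINT x|lborel. complex_of_real (exp (- (s * (norm x)\<^sup>2))) * exp (- (\<i> * complex_of_real (x \<bullet> w))))
      = complex_of_real ((pi / s) powr (real DIM('a) / 2) * exp (- ((norm w)\<^sup>2 / (4 * s))))"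
proof -
  let ?F = "\<lambda>x. complex_of_real (exp (- (s * (norm x)\<^sup>2))) * exp (- (\<i> * complex_of_real (x \<bullet> w)))"
  let ?T = "\<lambda>f. \<Sum>b\<in>Basis. f b *\<^sub>R b :: 'a"
  let ?f = "\<lambda>b x. complex_of_real (exp (- (s * x\<^sup>2))) * exp (- (\<i> * complex_of_real (x * (w \<bullet> b))))"
  interpret product_sigma_finite "\<lambda>_::'a. lborel :: real measure" by standard
  have prod: "?F (?T f) = (\<Prod>b\<in>Basis. ?f b (f b))" for f
  proof -
    have n: "(norm (?T f))\<^sup>2 = (\<Sum>b\<in>Basis. (f b)\<^sup>2)"
      unfolding power2_norm_eq_inner euclidean_inner[of "?T f" "?T f"] by (simp add: power2_eq_square)
    have i: "?T f \<bullet> w = (\<Sum>b\<in>Basis. f b * (w \<bullet> b))"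
      by (subst inner_sum_left) (simp add: inner_commute)
    show ?thesis
      unfolding n i of_real_sum sum_distrib_left sum_negf[symmetric] exp_sum[OF finite_Basis] of_real_prod
      by (simp only: prod.distrib)
  qed
  have nw: "(norm w)\<^sup>2 = (\<Sum>b\<in>Basis. (w \<bullet> b)\<^sup>2)"
    unfolding power2_norm_eq_inner euclidean_inner[of w w] by (simp add: power2_eq_square)
  have meas: "?T \<in> measurable (\<Pi>\<^sub>M b\<in>Basis. lborel) borel" by measurable
  have mF: "?F \<in> borel_measurable borel" by measurable
  show "integrable lborel ?F"
    unfolding lborel_eq[where 'a='a]
    by (subst integrable_distr_eq[OF meas mF], unfold prod)
      (intro product_integrable_prod gaussian_fourier_1[OF s] finite_Basis)
  have "(LINT x|lborel. ?F x) = (LINT f|(\<Pi>\<^sub>M b\<in>Basis. lborel). ?F (?T f))"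
    unfolding lborel_eq[where 'a='a] by (rule integral_distr[OF meas mF])
  also have "\<dots> = (\<Prod>b\<in>(Basis :: 'a set). LINT x|lborel. ?f b x)"
    unfolding prod by (intro product_integral_prod gaussian_fourier_1[OF s] finite_Basis)
  also have "\<dots> = (\<Prod>b\<in>(Basis :: 'a set). complex_of_real (sqrt (pi / s) * exp (- ((w \<bullet> b)\<^sup>2 / (4 * s)))))"
    by (simp only: gaussian_fourier_1[OF s])
  also have "\<dots> = complex_of_real (sqrt (pi / s) ^ DIM('a) * exp (- ((norm w)\<^sup>2 / (4 * s))))"
    unfolding of_real_prod[symmetric]
    unfolding nw sum_divide_distrib sum_negf[symmetric] exp_sum[OF finite_Basis]
    by (simp only: prod.distrib prod_constant)
  also have "sqrt (pi / s) ^ DIM('a) = (pi / s) powr (real DIM('a) / 2)"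
  proof -
    have "sqrt y ^ n = y powr (real n / 2)" if "0 < y" for y :: real and n :: nat
    proof -
      have "sqrt y ^ n = sqrt y powr real n"
        using that by (intro powr_realpow[symmetric]) simp
      also have "\<dots> = (y powr (1 / 2)) powr real n"
        using that by (simp add: powr_half_sqrt)
      finally show ?thesis by (simp only: powr_powr) simp
    qed
    then show ?thesis using s by simp
  qed
  finally show "(LINT x|lborel. ?F x)
      = complex_of_real ((pi / s) powr (real DIM('a) / 2) * exp (- ((norm w)\<^sup>2 / (4 * s))))" .
qed

lemma gaussian_integral:
  assumes s: "0 < s"
  shows "integrable lborel (\<lambda>x::'a::euclidean_space. exp (- (s * (norm x)\<^sup>2)))"
    and "(LINT x|lborel. exp (- (s * (norm (x :: 'a :: euclidean_space))\<^sup>2))) = (pi / s) powr (real DIM('a) / 2)"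
proof -
  have i: "integrable lborel (\<lambda>x::'a. complex_of_real (exp (- (s * (norm x)\<^sup>2))))"
    using gaussian_fourier(1)[OF s, of "0 :: 'a"] by simp
  then show "integrable lborel (\<lambda>x::'a. exp (- (s * (norm x)\<^sup>2)))"
    by (simp only: complex_of_real_integrable_eq)
  have "complex_of_real (LINT x|lborel. exp (- (s * (norm (x :: 'a))\<^sup>2))) = complex_of_real ((pi / s) powr (real DIM('a) / 2))"
    using gaussian_fourier(2)[OF s, of "0 :: 'a"] by (simp flip: integral_complex_of_real)
  then show "(LINT x|lborel. exp (- (s * (norm (x :: 'a))\<^sup>2))) = (pi / s) powr (real DIM('a) / 2)"
    by (simp only: of_real_eq_iff)
qed

lemma power_div_fact_le_exp:
  fixes x :: real
  assumes "0 \<le> x"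
  shows "x ^ n / fact n \<le> exp x"
proof -
  have "(\<lambda>k. x ^ k / fact k) sums exp x"
    using exp_converges[of x] by (simp add: divide_inverse mult.commute)
  then have sm: "summable (\<lambda>k. x ^ k / fact k)" and eq: "(\<Sum>k. x ^ k / fact k) = exp x"
    by (simp_all add: sums_iff)
  have "(\<Sum>k\<in>{n}. x ^ k / fact k) \<le> (\<Sum>k. x ^ k / fact k)"
    by (rule sum_le_suminf[OF sm]) (use assms in auto)
  then show ?thesis using eq by simp
qed

text \<open>The value \<open>0\<close> for \<open>u \<le> 0\<close> makes the kernel nonnegative, and bounded away from \<open>x = 0\<close>, for
  all real \<open>u\<close>, so that bounds need no case distinction on null sets.\<close>

definition heat :: "real ^ 'n \<Rightarrow> real \<Rightarrow> real" where
  "heat x u = (if 0 < u then (4 * pi * u) powr (- real CARD('n) / 2) * exp (- ((norm x)\<^sup>2 / (4 * u))) else 0)"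

lemma heat_nonneg [simp]: "0 \<le> heat x u"
  by (simp add: heat_def)

lemma borel_measurable_heat [measurable]:
  "(\<lambda>p. heat (fst p) (snd p)) \<in> borel_measurable (borel \<Otimes>\<^sub>M borel)"
  unfolding heat_def by measurable

lemma borel_measurable_heat' [measurable (raw)]:
  assumes [measurable]: "f \<in> measurable M borel" "g \<in> borel_measurable M"
  shows "(\<lambda>w. heat (f w) (g w)) \<in> borel_measurable M"
  using measurable_compose[OF _ borel_measurable_heat, of "\<lambda>w. (f w, g w)" M] by simp

lemma heat_fourier:
  fixes w :: "real ^ 'n"
  assumes u: "0 < u"
  shows "integrable lborel (\<lambda>x. complex_of_real (heat x u) * exp (- (\<i> * complex_of_real (x \<bullet> w))))"
    and "(LINT x|lborel. complex_of_real (heat x u) * exp (- (\<i> * complex_of_real (x \<bullet> w))))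
      = complex_of_real (exp (- ((norm w)\<^sup>2 * u)))"
proof -
  let ?k = "(4 * pi * u) powr (- real CARD('n) / 2)"
  let ?G = "\<lambda>x :: real ^ 'n. complex_of_real (exp (- (1 / (4 * u) * (norm x)\<^sup>2))) * exp (- (\<i> * complex_of_real (x \<bullet> w)))"
  have eq: "complex_of_real (heat x u) * exp (- (\<i> * complex_of_real (x \<bullet> w))) = complex_of_real ?k * ?G x" for x
    using u by (simp add: heat_def)
  have s: "0 < 1 / (4 * u)" using u by simp
  show "integrable lborel (\<lambda>x. complex_of_real (heat x u) * exp (- (\<i> * complex_of_real (x \<bullet> w))))"
    unfolding eq by (intro integrable_mult_right gaussian_fourier(1)[OF s])
  have "(LINT x|lborel. complex_of_real ?k * ?G x)
      = complex_of_real (?k * ((pi / (1 / (4 * u))) powr (real CARD('n) / 2) * exp (- ((norm w)\<^sup>2 / (4 * (1 / (4 * u)))))))"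
    unfolding integral_mult_right_zero gaussian_fourier(2)[OF s] by simp
  also have "?k * ((pi / (1 / (4 * u))) powr (real CARD('n) / 2) * exp (- ((norm w)\<^sup>2 / (4 * (1 / (4 * u))))))
      = exp (- ((norm w)\<^sup>2 * u))"
    using u by (simp add: powr_minus mult_ac)
  finally show "(LINT x|lborel. complex_of_real (heat x u) * exp (- (\<i> * complex_of_real (x \<bullet> w))))
      = complex_of_real (exp (- ((norm w)\<^sup>2 * u)))"
    unfolding eq .
qed

lemma heat_integral:
  assumes u: "0 < u"
  shows "integrable lborel (\<lambda>x :: real ^ 'n. heat x u)" "(LINT x|lborel. heat (x :: real ^ 'n) u) = 1"
proof -
  have i: "integrable lborel (\<lambda>x::real ^ 'n. complex_of_real (heat x u))"
    using heat_fourier(1)[OF u, of "0 :: real ^ 'n"] by simp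
  then show "integrable lborel (\<lambda>x :: real ^ 'n. heat x u)"
    by (simp only: complex_of_real_integrable_eq)
  have "complex_of_real (LINT x|lborel. heat (x :: real ^ 'n) u) = complex_of_real 1"
    using heat_fourier(2)[OF u, of "0 :: real ^ 'n"] by (simp flip: integral_complex_of_real)
  then show "(LINT x|lborel. heat (x :: real ^ 'n) u) = 1"
    by (simp only: of_real_eq_iff)
qed

text \<open>With \<open>y = 1 / (4 u)\<close> the kernel is a constant times \<open>y\<^sup>N\<^sup>/\<^sup>2 exp (- |x|\<^sup>2 y)\<close>, and the
  exponential beats the power. The bound is uniform in \<open>u\<close>, which is what makes mixtures of heat
  kernels continuous off the origin.\<close>

lemma heat_bounded:
  assumes r: "0 < r"
  shows "\<exists>B. \<forall>(x :: real ^ 'n) u. r \<le> norm x \<longrightarrow> heat x u \<le> B"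
proof (intro exI allI impI)
  fix x :: "real ^ 'n" and u :: real
  assume x: "r \<le> norm x"
  let ?N = "CARD('n)"
  let ?B = "pi powr (- real ?N / 2) * (1 + fact ?N / (r\<^sup>2) ^ ?N)"
  show "heat x u \<le> ?B"
  proof (cases "u > 0")
    case False
    then show ?thesis using r by (simp add: heat_def)
  next
    case u: True
    define y where "y = 1 / (4 * u)"
    have y: "y > 0" "4 * u = 1 / y" using u by (auto simp: y_def)
    have "heat x u = pi powr (- real ?N / 2) * (y powr (real ?N / 2) * exp (- ((norm x)\<^sup>2 * y)))"
    proof -
      have "4 * pi * u = pi / y" using u by (simp add: y_def)
      then have "(4 * pi * u) powr (- real ?N / 2) = pi powr (- real ?N / 2) * y powr (real ?N / 2)"
      proof -
        have "(pi / y) powr (- real ?N / 2) = pi powr (- real ?N / 2) / y powr (- (real ?N / 2))"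
          using y(1) by (subst powr_divide) auto
        also have "\<dots> = pi powr (- real ?N / 2) * y powr (real ?N / 2)"
          by (simp only: powr_minus divide_inverse inverse_inverse_eq)
        finally show ?thesis using \<open>4 * pi * u = pi / y\<close> by simp
      qed
      moreover have "(norm x)\<^sup>2 / (4 * u) = (norm x)\<^sup>2 * y" by (simp add: y_def)
      ultimately show ?thesis using u by (simp add: heat_def mult.assoc)
    qed
    also have "y powr (real ?N / 2) * exp (- ((norm x)\<^sup>2 * y)) \<le> y powr (real ?N / 2) * exp (- (r\<^sup>2 * y))"
      using x r y by (intro mult_left_mono) (auto intro!: power_mono)
    also have "y powr (real ?N / 2) * exp (- (r\<^sup>2 * y)) \<le> 1 + fact ?N / (r\<^sup>2) ^ ?N"
    proof (cases "y \<le> 1")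
      case True
      have "y powr (real ?N / 2) * exp (- (r\<^sup>2 * y)) \<le> 1 * 1"
        using True y by (intro mult_mono powr_le1) auto
      also have "\<dots> \<le> 1 + fact ?N / (r\<^sup>2) ^ ?N" using r by simp
      finally show ?thesis .
    next
      case False
      have "y powr (real ?N / 2) \<le> y powr (real ?N)"
        using False by (intro powr_mono) auto
      also have "\<dots> = y ^ ?N" using y by (simp add: powr_realpow)
      also have "\<dots> = fact ?N / (r\<^sup>2) ^ ?N * ((r\<^sup>2 * y) ^ ?N / fact ?N)"
        using r by (simp add: power_mult_distrib)
      also have "\<dots> \<le> fact ?N / (r\<^sup>2) ^ ?N * exp (r\<^sup>2 * y)"
        using y by (intro mult_left_mono power_div_fact_le_exp) auto
      finally have "y powr (real ?N / 2) * exp (- (r\<^sup>2 * y)) \<le> fact ?N / (r\<^sup>2) ^ ?N * exp (r\<^sup>2 * y) * exp (- (r\<^sup>2 * y))"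
        by (intro mult_right_mono) auto
      also have "\<dots> = fact ?N / (r\<^sup>2) ^ ?N" by (simp add: exp_minus)
      finally show ?thesis by simp
    qed
    finally show ?thesis by simp
  qed
qed

definition heat_profile :: "real \<Rightarrow> real \<Rightarrow> real" where
  "heat_profile N u = (if 0 < u then (4 * pi * u) powr (- N / 2) * exp (- (1 / (4 * u))) else 0)"

lemma heat_scale:
  fixes x :: "real ^ 'n"
  assumes "x \<noteq> 0"
  shows "heat x u = norm x powr (- real CARD('n)) * heat_profile (real CARD('n)) (u / (norm x)\<^sup>2)"
proof (cases "u > 0")
  case True
  have "(4 * pi * u) powr (- real CARD('n) / 2) = ((norm x)\<^sup>2 * (4 * pi * (u / (norm x)\<^sup>2))) powr (- real CARD('n) / 2)"
    using assms by simp
  also have "\<dots> = ((norm x)\<^sup>2) powr (- real CARD('n) / 2) * (4 * pi * (u / (norm x)\<^sup>2)) powr (- real CARD('n) / 2)"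
    by (rule powr_mult)
  also have "((norm x)\<^sup>2) powr (- real CARD('n) / 2) = norm x powr (- real CARD('n))"
  proof -
    have "(norm x)\<^sup>2 = norm x powr 2" using assms by simp
    then show ?thesis by (simp only: powr_powr) simp
  qed
  finally show ?thesis using True assms by (simp add: heat_def heat_profile_def)
next
  case False
  then have "\<not> 0 < u / (norm x)\<^sup>2" using assms by (simp add: zero_less_divide_iff)
  with False show ?thesis by (simp add: heat_def heat_profile_def)
qed

section \<open>Gaussian wave packets as Schwartz functions\<close>

text \<open>Polynomial functions on \<open>\<real>\<^sup>N\<close>, generated inductively. Their products with a fixed Gaussian
  wave are closed under partial derivatives, which is how the wave is shown to be a Schwartz
  function.\<close>

inductive cpoly :: "(real ^ 'n \<Rightarrow> complex) \<Rightarrow> bool" where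
  cpoly_const: "cpoly (\<lambda>x. c)"
| cpoly_coord: "cpoly (\<lambda>x. complex_of_real (x $ i))"
| cpoly_add: "cpoly p \<Longrightarrow> cpoly q \<Longrightarrow> cpoly (\<lambda>x. p x + q x)"
| cpoly_mult: "cpoly p \<Longrightarrow> cpoly q \<Longrightarrow> cpoly (\<lambda>x. p x * q x)"

lemma cpoly_partial_derivative:
  fixes p :: "real ^ 'n \<Rightarrow> complex"
  assumes "cpoly p"
  shows "\<exists>q. cpoly q \<and> (\<forall>x. ((\<lambda>s. p (x + s *\<^sub>R axis i 1)) has_vector_derivative q x) (at 0))"
  using assms
proof induction
  case (cpoly_const c)
  show ?case by (intro exI[of _ "\<lambda>x. 0"] conjI cpoly.cpoly_const) auto
next
  case (cpoly_coord j)
  let ?c = "if j = i then 1 else 0 :: complex"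
  have eq: "(\<lambda>s. complex_of_real ((x + s *\<^sub>R axis i 1) $ j)) = (\<lambda>s. complex_of_real (x $ j) + s *\<^sub>R ?c)"
    for x :: "real ^ 'n"
    by (cases "j = i") (simp_all add: axis_def scaleR_conv_of_real[where 'a = complex])
  have "((\<lambda>s. complex_of_real ((x + s *\<^sub>R axis i 1) $ j)) has_vector_derivative ?c) (at 0)" for x :: "real ^ 'n"
    unfolding eq by (auto intro!: derivative_eq_intros)
  then show ?case
    by (intro exI[of _ "\<lambda>x. ?c"] conjI cpoly.cpoly_const allI)
next
  case (cpoly_add p q)
  then obtain p' q' where
    "cpoly p'" "\<forall>x. ((\<lambda>s. p (x + s *\<^sub>R axis i 1)) has_vector_derivative p' x) (at 0)"
    "cpoly q'" "\<forall>x. ((\<lambda>s. q (x + s *\<^sub>R axis i 1)) has_vector_derivative q' x) (at 0)" by blast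
  then show ?case
    by (intro exI[of _ "\<lambda>x. p' x + q' x"] conjI cpoly.cpoly_add) (auto intro: has_vector_derivative_add)
next
  case (cpoly_mult p q)
  then obtain p' q' where *:
    "cpoly p'" "\<forall>x. ((\<lambda>s. p (x + s *\<^sub>R axis i 1)) has_vector_derivative p' x) (at 0)"
    "cpoly q'" "\<forall>x. ((\<lambda>s. q (x + s *\<^sub>R axis i 1)) has_vector_derivative q' x) (at 0)" by blast
  have "((\<lambda>s. p (x + s *\<^sub>R axis i 1) * q (x + s *\<^sub>R axis i 1)) has_vector_derivative
      (p x * q' x + p' x * q x)) (at 0)" for x
    using has_vector_derivative_mult[OF *(2)[rule_format, of x] *(4)[rule_format, of x]] by simp
  moreover have "cpoly (\<lambda>x. p x * q' x + p' x * q x)"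
    using * cpoly_mult by (intro cpoly.cpoly_add cpoly.cpoly_mult)
  ultimately show ?case by blast
qed

lemma cpoly_differentiable: "cpoly p \<Longrightarrow> p differentiable at x"
proof (induction rule: cpoly.induct)
  case (cpoly_coord i)
  have "((\<lambda>x. complex_of_real (x $ i)) has_derivative (\<lambda>h. complex_of_real (h $ i))) (at x)"
    by (intro has_derivative_of_real bounded_linear_imp_has_derivative bounded_linear_vec_nth)
  then show ?case by (rule differentiableI)
qed auto

lemma cpoly_growth:
  fixes p :: "real ^ 'n \<Rightarrow> complex"
  shows "cpoly p \<Longrightarrow> \<exists>B m. 0 \<le> B \<and> (\<forall>x. norm (p x) \<le> B * (1 + norm x) ^ m)"
proof (induction rule: cpoly.induct)
  case (cpoly_const c)
  show ?case by (rule exI[of _ "norm c"], rule exI[of _ 0]) auto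
next
  case (cpoly_coord i)
  have "norm (complex_of_real (x $ i)) \<le> 1 * (1 + norm x) ^ 1" for x :: "real ^ 'n"
    using component_le_norm_cart[of x i] by simp
  then show ?case by (intro exI[of _ 1]) auto
next
  case (cpoly_add p q)
  then obtain B m C k where *: "0 \<le> B" "\<forall>x. norm (p x) \<le> B * (1 + norm x) ^ m"
    "0 \<le> C" "\<forall>x. norm (q x) \<le> C * (1 + norm x) ^ k" by blast
  have "norm (p x + q x) \<le> (B + C) * (1 + norm x) ^ (m + k)" for x
  proof -
    have "norm (p x + q x) \<le> B * (1 + norm x) ^ m + C * (1 + norm x) ^ k"
      using * norm_triangle_le add_mono by blast
    also have "\<dots> \<le> B * (1 + norm x) ^ (m + k) + C * (1 + norm x) ^ (m + k)"
      using * by (intro add_mono mult_left_mono power_increasing) auto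
    finally show ?thesis by (simp add: algebra_simps)
  qed
  then show ?case using * by (intro exI[of _ "B + C"] exI[of _ "m + k"]) auto
next
  case (cpoly_mult p q)
  then obtain B m C k where *: "0 \<le> B" "\<forall>x. norm (p x) \<le> B * (1 + norm x) ^ m"
    "0 \<le> C" "\<forall>x. norm (q x) \<le> C * (1 + norm x) ^ k" by blast
  have "norm (p x * q x) \<le> (B * C) * (1 + norm x) ^ (m + k)" for x
  proof -
    have "norm (p x * q x) \<le> (B * (1 + norm x) ^ m) * (C * (1 + norm x) ^ k)"
      unfolding norm_mult using * by (intro mult_mono) auto
    then show ?thesis by (simp add: algebra_simps power_add)
  qed
  then show ?case using * by (intro exI[of _ "B * C"] exI[of _ "m + k"]) auto
qed

text \<open>A modulated Gaussian. Its Fourier transform is a Gaussian centred at \<open>a\<close>, so these functions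
  test a distribution by its Gaussian averages around any point.\<close>

definition gauss_wave :: "real ^ 'n \<Rightarrow> real \<Rightarrow> real ^ 'n \<Rightarrow> complex" where
  "gauss_wave a e x = complex_of_real (exp (- (e * (norm x)\<^sup>2))) * exp (\<i> * complex_of_real (x \<bullet> a))"

lemma norm_gauss_wave: "norm (gauss_wave a e x) = exp (- (e * (norm x)\<^sup>2))"
  by (simp add: gauss_wave_def norm_mult)

lemma gauss_wave_has_derivative:
  "(gauss_wave a e has_derivative
     (\<lambda>h. gauss_wave a e x * (\<i> * complex_of_real (h \<bullet> a) - complex_of_real (2 * e * (x \<bullet> h))))) (at x)"
proof -
  have eq: "gauss_wave a e = (\<lambda>x. exp (\<i> * complex_of_real (x \<bullet> a) - complex_of_real (e * (x \<bullet> x))))"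
    by (auto simp: gauss_wave_def fun_eq_iff power2_norm_eq_inner exp_diff exp_minus exp_of_real[symmetric] field_simps)
  have "((\<lambda>x. x \<bullet> x) has_derivative (\<lambda>h. 2 * (x \<bullet> h))) (at x)"
    by (rule has_derivative_eq_rhs[OF has_derivative_inner[OF has_derivative_ident has_derivative_ident]])
      (auto simp: inner_commute)
  then have "((\<lambda>x. e * (x \<bullet> x)) has_derivative (\<lambda>h. e * (2 * (x \<bullet> h)))) (at x)"
    by (rule has_derivative_mult_right)
  then have 1: "((\<lambda>x. complex_of_real (e * (x \<bullet> x))) has_derivative (\<lambda>h. complex_of_real (e * (2 * (x \<bullet> h))))) (at x)"
    by (rule has_derivative_of_real)
  have "((\<lambda>x. x \<bullet> a) has_derivative (\<lambda>h. h \<bullet> a)) (at x)"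
    by (rule has_derivative_inner_left[OF has_derivative_ident])
  then have "((\<lambda>x. \<i> * complex_of_real (x \<bullet> a)) has_derivative (\<lambda>h. \<i> * complex_of_real (h \<bullet> a))) (at x)"
    by (intro has_derivative_mult_right has_derivative_of_real)
  from has_derivative_compose[OF has_derivative_diff[OF this 1] DERIV_exp[unfolded has_field_derivative_def]]
  show ?thesis
    unfolding eq by (simp add: mult.commute mult.left_commute)
qed

lemma foldr_partial_deriv_gauss_wave:
  fixes a :: "real ^ 'n"
  shows "\<exists>p. cpoly p \<and> foldr partial_deriv is (gauss_wave a e) = (\<lambda>x. p x * gauss_wave a e x)"
proof (induction "is")
  case Nil
  show ?case by (intro exI[of _ "\<lambda>x. 1"]) (auto intro: cpoly_const)
next
  case (Cons i "is")
  then obtain p where p: "cpoly p" "foldr partial_deriv is (gauss_wave a e) = (\<lambda>x. p x * gauss_wave a e x)"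
    by blast
  obtain q where q: "cpoly q" "\<And>x. ((\<lambda>s. p (x + s *\<^sub>R axis i 1)) has_vector_derivative q x) (at 0)"
    using cpoly_partial_derivative[OF p(1), of i] by blast
  define r where "r = (\<lambda>x :: real ^ 'n. \<i> * complex_of_real (a $ i) + (- 2 * complex_of_real e) * complex_of_real (x $ i))"
  have r: "cpoly r" unfolding r_def by (intro cpoly.intros)
  have g: "((\<lambda>s. gauss_wave a e (x + s *\<^sub>R axis i 1)) has_vector_derivative gauss_wave a e x * r x) (at 0)" for x
  proof -
    have "((\<lambda>s. x + s *\<^sub>R axis i 1) has_derivative (\<lambda>s. s *\<^sub>R axis i 1)) (at 0)"
      by (auto intro!: derivative_eq_intros)
    from diff_chain_at[OF this gauss_wave_has_derivative]
    have "((\<lambda>s. gauss_wave a e (x + s *\<^sub>R axis i 1)) has_derivative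
        (\<lambda>s. gauss_wave a e x * (\<i> * complex_of_real ((s *\<^sub>R axis i 1) \<bullet> a) - complex_of_real (2 * e * (x \<bullet> (s *\<^sub>R axis i 1)))))) (at 0)"
      by (simp add: o_def)
    moreover have "gauss_wave a e x * (\<i> * complex_of_real ((s *\<^sub>R axis i 1) \<bullet> a) - complex_of_real (2 * e * (x \<bullet> (s *\<^sub>R axis i 1))))
        = s *\<^sub>R (gauss_wave a e x * r x)" for s
      by (simp add: r_def inner_axis inner_axis' scaleR_conv_of_real[where 'a = complex] algebra_simps)
    ultimately show ?thesis
      by (simp only: has_vector_derivative_def)
  qed
  have "partial_deriv i (\<lambda>x. p x * gauss_wave a e x) = (\<lambda>x. (q x + p x * r x) * gauss_wave a e x)"
  proof
    fix x
    have "((\<lambda>s. p (x + s *\<^sub>R axis i 1) * gauss_wave a e (x + s *\<^sub>R axis i 1)) has_vector_derivative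
      (p x * (gauss_wave a e x * r x) + q x * gauss_wave a e x)) (at 0)"
      using has_vector_derivative_mult[OF q(2)[of x] g[of x]] by simp
    then show "partial_deriv i (\<lambda>x. p x * gauss_wave a e x) x = (q x + p x * r x) * gauss_wave a e x"
      unfolding partial_deriv_def by (subst vector_derivative_at) (auto simp: algebra_simps)
  qed
  moreover have "cpoly (\<lambda>x. q x + p x * r x)"
    using p q r by (intro cpoly.intros)
  ultimately show ?case using p(2) by auto
qed

text \<open>Polynomial growth is absorbed by one term of the exponential series, since \<open>(1 + r)\<^sup>m \<le> (2
  (1 + r\<^sup>2))\<^sup>m\<close>.\<close>

lemma power_le_gaussian:
  fixes e :: real
  assumes e: "0 < e"
  shows "\<exists>C. 0 \<le> C \<and> (\<forall>r\<ge>0. (1 + r) ^ m \<le> C * exp (e * r\<^sup>2))"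
proof (intro exI conjI allI impI)
  let ?C = "(2 / e) ^ m * fact m * exp e"
  show "0 \<le> ?C" using e by simp
  fix r :: real assume r: "0 \<le> r"
  have "1 * (1 + r) \<le> (1 + r) * (1 + r)" using r by (intro mult_right_mono) auto
  also have "\<dots> \<le> 2 * (1 + r\<^sup>2)"
    using zero_le_power2[of "1 - r"] by (simp add: power2_eq_square algebra_simps)
  finally have "(1 + r) ^ m \<le> (2 * (1 + r\<^sup>2)) ^ m"
    using r by (intro power_mono) auto
  also have "\<dots> = (2 / e * (e * (1 + r\<^sup>2))) ^ m"
    using e by simp
  also have "\<dots> = (2 / e) ^ m * fact m * ((e * (1 + r\<^sup>2)) ^ m / fact m)"
    by (simp only: power_mult_distrib) simp
  also have "\<dots> \<le> (2 / e) ^ m * fact m * exp (e * (1 + r\<^sup>2))"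
    using e by (intro mult_left_mono power_div_fact_le_exp) auto
  also have "\<dots> = ?C * exp (e * r\<^sup>2)"
    by (simp add: exp_add distrib_left)
  finally show "(1 + r) ^ m \<le> ?C * exp (e * r\<^sup>2)" .
qed

lemma schwartz_gauss_wave:
  assumes e: "0 < e"
  shows "schwartz (gauss_wave a e)"
  unfolding schwartz_def
proof (intro allI conjI)
  fix "is" :: "'a list"
  obtain p where p: "cpoly p" "foldr partial_deriv is (gauss_wave a e) = (\<lambda>x. p x * gauss_wave a e x)"
    using foldr_partial_deriv_gauss_wave by blast
  show "foldr partial_deriv is (gauss_wave a e) differentiable at x" for x
    unfolding p(2)
    by (intro differentiable_mult cpoly_differentiable[OF p(1)] differentiableI[OF gauss_wave_has_derivative])
  fix k
  obtain B m where B: "0 \<le> B" "\<And>x. norm (p x) \<le> B * (1 + norm x) ^ m"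
    using cpoly_growth[OF p(1)] by blast
  obtain C where C: "0 \<le> C" "\<And>r. 0 \<le> r \<Longrightarrow> (1 + r) ^ (k + m) \<le> C * exp (e * r\<^sup>2)"
    using power_le_gaussian[OF e] by blast
  have "(1 + norm x) ^ k * norm (p x * gauss_wave a e x) \<le> B * C" for x
  proof -
    have "(1 + norm x) ^ k * norm (p x * gauss_wave a e x)
        \<le> (1 + norm x) ^ k * ((B * (1 + norm x) ^ m) * exp (- (e * (norm x)\<^sup>2)))"
      unfolding norm_mult norm_gauss_wave by (intro mult_left_mono mult_right_mono B) auto
    also have "\<dots> = B * (1 + norm x) ^ (k + m) * exp (- (e * (norm x)\<^sup>2))"
      by (simp add: power_add mult_ac)
    also have "\<dots> \<le> B * (C * exp (e * (norm x)\<^sup>2)) * exp (- (e * (norm x)\<^sup>2))"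
      using B by (intro mult_left_mono mult_right_mono C) auto
    also have "\<dots> = B * C" by (simp add: exp_minus)
    finally show ?thesis .
  qed
  then show "\<exists>B. \<forall>x. (1 + norm x) ^ k * norm (foldr partial_deriv is (gauss_wave a e) x) \<le> B"
    unfolding p(2) by blast
qed

text \<open>The majorant \<open>(1 + |x|\<^sup>2)\<^sup>-\<^sup>N\<close> is a mixture of Gaussians by Gamma's integral, and the
  integral of each Gaussian is explicit.\<close>

lemma integrable_inverse_power_norm:
  "integrable lborel (\<lambda>x :: real ^ 'n. 1 / (1 + norm x) ^ (2 * CARD('n)))"
proof (rule Bochner_Integration.integrable_bound)
  let ?n = "real CARD('n)"
  let ?h = "\<lambda>x :: real ^ 'n. (1 + (norm x)\<^sup>2) powr (- ?n)"
  have pos: "1 + (norm x)\<^sup>2 > 0" for x :: "real ^ 'n"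
    by (intro add_pos_nonneg) auto
  have "(\<integral>\<^sup>+x. ennreal (Gamma ?n * ?h x) \<partial>lborel)
      = (\<integral>\<^sup>+x. (\<integral>\<^sup>+s. ennreal (indicator {0<..} s * (s powr (1 * ?n - 1) * exp (- ((1 + (norm (x :: real ^ 'n))\<^sup>2) * s powr 1)))) \<partial>lborel) \<partial>lborel)"
    by (subst nn_integral_gamma_powr) (use pos in auto)
  also have "\<dots> = (\<integral>\<^sup>+s. (\<integral>\<^sup>+x. ennreal (indicator {0<..} s * (s powr (1 * ?n - 1) * exp (- ((1 + (norm (x :: real ^ 'n))\<^sup>2) * s powr 1)))) \<partial>lborel) \<partial>lborel)"
    by (rule lborel_pair.Fubini') measurable
  also have "\<dots> = (\<integral>\<^sup>+s. ennreal (pi powr (?n / 2)) * ennreal (indicator {0<..} s * (s powr (1 * (?n / 2) - 1) * exp (- (1 * s powr 1)))) \<partial>lborel)"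
  proof (intro nn_integral_cong)
    fix s :: real
    show "(\<integral>\<^sup>+x. ennreal (indicator {0<..} s * (s powr (1 * ?n - 1) * exp (- ((1 + (norm (x :: real ^ 'n))\<^sup>2) * s powr 1)))) \<partial>lborel)
      = ennreal (pi powr (?n / 2)) * ennreal (indicator {0<..} s * (s powr (1 * (?n / 2) - 1) * exp (- (1 * s powr 1))))"
    proof (cases "s > 0")
      case True
      have "(\<integral>\<^sup>+x. ennreal (indicator {0<..} s * (s powr (1 * ?n - 1) * exp (- ((1 + (norm (x :: real ^ 'n))\<^sup>2) * s powr 1)))) \<partial>lborel)
         = (\<integral>\<^sup>+x. ennreal (s powr (?n - 1) * exp (- s)) * ennreal (exp (- (s * (norm (x :: real ^ 'n))\<^sup>2))) \<partial>lborel)"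
        using True by (intro nn_integral_cong)
          (simp add: ennreal_mult[symmetric] exp_add[symmetric] algebra_simps)
      also have "\<dots> = ennreal (s powr (?n - 1) * exp (- s)) * ennreal ((pi / s) powr (?n / 2))"
        using gaussian_integral[OF True, where 'a = "real ^ 'n"]
        by (simp add: nn_integral_cmult nn_integral_eq_integral)
      also have "\<dots> = ennreal (pi powr (?n / 2)) * ennreal (s powr (?n / 2 - 1) * exp (- s))"
      proof -
        have "s powr (?n - 1) = s powr (?n / 2 - 1) * s powr (?n / 2)"
          by (simp add: powr_add[symmetric])
        then have "s powr (?n - 1) * (pi / s) powr (?n / 2) = pi powr (?n / 2) * s powr (?n / 2 - 1)"
          using True by (simp add: powr_divide)
        then have "(s powr (?n - 1) * exp (- s)) * (pi / s) powr (?n / 2) = pi powr (?n / 2) * (s powr (?n / 2 - 1) * exp (- s))"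
          by (simp add: mult_ac)
        then show ?thesis
          by (simp only: ennreal_mult[symmetric] powr_ge_zero mult_nonneg_nonneg exp_ge_zero)
      qed
      finally show ?thesis using True by simp
    qed simp
  qed
  also have "\<dots> < \<infinity>"
    by (subst nn_integral_cmult, measurable, subst nn_integral_gamma_powr) (auto simp: ennreal_mult_less_top)
  finally have "integrable lborel (\<lambda>x. Gamma ?n * ?h x)"
    by (intro integrableI_nonneg) (auto intro!: AE_I2 mult_nonneg_nonneg less_imp_le[OF Gamma_real_pos])
  moreover have "Gamma ?n > 0" by (rule Gamma_real_pos) simp
  ultimately show "integrable lborel ?h" by simp
  show "AE x :: real ^ 'n in lborel. norm (1 / (1 + norm x) ^ (2 * CARD('n))) \<le> norm (?h x)"
  proof (rule AE_I2)
    fix x :: "real ^ 'n"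
    have "1 + (norm x)\<^sup>2 \<le> (1 + norm x)\<^sup>2" by (simp add: power2_eq_square algebra_simps)
    then have "(1 + (norm x)\<^sup>2) ^ CARD('n) \<le> ((1 + norm x)\<^sup>2) ^ CARD('n)"
      using pos by (intro power_mono) auto
    then have "1 / (1 + norm x) ^ (2 * CARD('n)) \<le> 1 / (1 + (norm x)\<^sup>2) ^ CARD('n)"
      using pos[of x] unfolding power_mult
      by (intro divide_left_mono mult_pos_pos zero_less_power) (auto intro: add_pos_nonneg)
    also have "\<dots> = ?h x" using pos[of x] by (simp add: powr_minus powr_realpow divide_inverse)
    finally show "norm (1 / (1 + norm x) ^ (2 * CARD('n))) \<le> norm (?h x)" by simp
  qed
qed measurable

lemma schwartz_imp_integrable:
  fixes \<phi> :: "real ^ 'n \<Rightarrow> complex"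
  assumes "schwartz \<phi>"
  shows "integrable lborel \<phi>" "\<phi> \<in> borel_measurable borel"
proof -
  from assms have diff: "\<phi> differentiable at x" for x
    unfolding schwartz_def by (metis foldr.simps(1) id_apply)
  from assms obtain B where B: "\<And>x. (1 + norm x) ^ (2 * CARD('n)) * norm (\<phi> x) \<le> B"
    using assms[unfolded schwartz_def, THEN spec, of "[]"] by fastforce
  have "continuous_on UNIV \<phi>"
    using diff by (intro continuous_at_imp_continuous_on) (auto intro: differentiable_imp_continuous_within)
  then show m: "\<phi> \<in> borel_measurable borel" by (rule borel_measurable_continuous_onI)
  have pos: "1 + norm x > 0" for x :: "real ^ 'n" by (intro add_pos_nonneg) auto
  show "integrable lborel \<phi>"
  proof (rule Bochner_Integration.integrable_bound)
    show "integrable lborel (\<lambda>x :: real ^ 'n. B * (1 / (1 + norm x) ^ (2 * CARD('n))))"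
      by (intro integrable_mult_right integrable_inverse_power_norm)
    have "norm (\<phi> x) \<le> norm (B * (1 / (1 + norm x) ^ (2 * CARD('n))))" for x
    proof -
      have "norm (\<phi> x) \<le> B * (1 / (1 + norm x) ^ (2 * CARD('n)))"
        using B[of x] pos[of x] by (simp add: field_simps)
      also have "\<dots> \<le> norm (B * (1 / (1 + norm x) ^ (2 * CARD('n))))"
        by (simp only: real_norm_def abs_ge_self)
      finally show ?thesis .
    qed
    then show "AE x in lborel. norm (\<phi> x) \<le> norm (B * (1 / (1 + norm x) ^ (2 * CARD('n))))" by simp
  qed (use m in simp)
qed

section \<open>Tempered Fourier transforms of mixtures of heat kernels\<close>

lemma integrable_lebesgue_iff_lborel:
  fixes f :: "'a :: euclidean_space \<Rightarrow> 'b :: {banach, second_countable_topology}"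
  assumes "f \<in> borel_measurable borel"
  shows "integrable lebesgue f \<longleftrightarrow> integrable lborel f"
    and "(LINT x|lebesgue. f x) = (LINT x|lborel. f x)"
  using assms by (auto intro!: integrable_completion integral_completion)

lemma integrable_product:
  fixes f :: "'a \<Rightarrow> complex" and g :: "'b \<Rightarrow> complex"
  assumes M: "sigma_finite_measure M1" "sigma_finite_measure M2"
    and f: "integrable M1 f" and g: "integrable M2 g"
  shows "integrable (M1 \<Otimes>\<^sub>M M2) (\<lambda>(x, y). f x * g y)"
proof -
  interpret pair_sigma_finite M1 M2 using M by (rule pair_sigma_finite.intro)
  note [measurable] = borel_measurable_integrable[OF f] borel_measurable_integrable[OF g]
  show ?thesis
  proof (rule Fubini_integrable)
    show "integrable M1 (\<lambda>x. LINT y|M2. norm (case (x, y) of (x, y) \<Rightarrow> f x * g y))"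
      using f by (simp add: norm_mult)
    show "AE x in M1. integrable M2 (\<lambda>y. case (x, y) of (x, y) \<Rightarrow> f x * g y)"
      using g by simp
  qed measurable
qed

lemma fourier_eq_lborel:
  assumes "\<phi> \<in> borel_measurable borel"
  shows "fourier \<phi> x = (LINT \<xi>|lborel. \<phi> \<xi> * exp (- (\<i> * complex_of_real (\<xi> \<bullet> x))))"
  unfolding fourier_def using assms by (subst integrable_lebesgue_iff_lborel) auto

lemma norm_exp_ii [simp]: "norm (exp (- (\<i> * complex_of_real r))) = 1"
  by (simp add: norm_exp_eq_Re)

lemma norm_fourier_le:
  fixes \<phi> :: "real ^ 'n \<Rightarrow> complex"
  assumes \<phi>: "integrable lborel \<phi>" "\<phi> \<in> borel_measurable borel"
  shows "norm (fourier \<phi> x) \<le> (LINT \<xi>|lborel. norm (\<phi> \<xi>))"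
  unfolding fourier_eq_lborel[OF \<phi>(2)]
  by (rule order_trans[OF integral_norm_bound]) (simp add: norm_mult)

lemma borel_measurable_fourier [measurable]:
  fixes \<phi> :: "real ^ 'n \<Rightarrow> complex"
  assumes [measurable]: "\<phi> \<in> borel_measurable borel"
  shows "fourier \<phi> \<in> borel_measurable borel"
proof -
  have "fourier \<phi> = (\<lambda>x. LINT \<xi>|lborel. \<phi> \<xi> * exp (- (\<i> * complex_of_real (\<xi> \<bullet> x))))"
    by (simp add: fourier_eq_lborel fun_eq_iff)
  then show ?thesis by simp
qed

text \<open>Fubini's theorem and the Gaussian Fourier transform: the heat kernel as a tempered
  distribution.\<close>

lemma heat_fourier_duality:
  fixes \<phi> :: "real ^ 'n \<Rightarrow> complex"
  assumes u: "0 < u" and \<phi>: "integrable lborel \<phi>" "\<phi> \<in> borel_measurable borel"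
  shows "(LINT x|lborel. complex_of_real (heat x u) * fourier \<phi> x)
       = (LINT \<xi>|lborel. complex_of_real (exp (- ((norm \<xi>)\<^sup>2 * u))) * \<phi> \<xi>)"
proof -
  note [measurable] = \<phi>(2)
  let ?f = "\<lambda>x \<xi>. complex_of_real (heat x u) * \<phi> \<xi> * exp (- (\<i> * complex_of_real (\<xi> \<bullet> x)))"
  have "integrable lborel (\<lambda>x :: real ^ 'n. complex_of_real (heat x u))"
    using heat_fourier(1)[OF u, of 0] by simp
  from integrable_product[OF _ _ this \<phi>(1)]
  have *: "integrable (lborel \<Otimes>\<^sub>M lborel) (\<lambda>(x :: real ^ 'n, \<xi>). complex_of_real (heat x u) * \<phi> \<xi>)"
    by (simp add: lborel.sigma_finite_measure_axioms)
  have int: "integrable (lborel \<Otimes>\<^sub>M lborel) (\<lambda>(x, \<xi>). ?f x \<xi>)"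
    by (rule Bochner_Integration.integrable_bound[OF *]) (auto simp: norm_mult)
  have "(LINT x|lborel. complex_of_real (heat x u) * fourier \<phi> x) = (LINT x|lborel. LINT \<xi>|lborel. ?f x \<xi>)"
    by (simp add: fourier_eq_lborel[OF \<phi>(2)] mult.assoc)
  also have "\<dots> = (LINT \<xi>|lborel. LINT x|lborel. ?f x \<xi>)"
    using lborel_pair.Fubini_integral[OF int] by simp
  also have "\<dots> = (LINT \<xi>|lborel. \<phi> \<xi> * (LINT x|lborel. complex_of_real (heat x u) * exp (- (\<i> * complex_of_real (x \<bullet> \<xi>)))))"
    by (simp add: mult_ac inner_commute flip: integral_mult_right_zero)
  also have "\<dots> = (LINT \<xi>|lborel. complex_of_real (exp (- ((norm \<xi>)\<^sup>2 * u))) * \<phi> \<xi>)"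
    by (simp only: heat_fourier(2)[OF u] mult.commute)
  finally show ?thesis .
qed

lemma integrable_mult_heat:
  fixes x :: "real ^ 'n"
  assumes w: "integrable \<Omega> w" and [measurable]: "u \<in> borel_measurable \<Omega>" and x: "x \<noteq> 0"
  shows "integrable \<Omega> (\<lambda>p. w p * heat x (u p))"
proof -
  note [measurable] = borel_measurable_integrable[OF w]
  obtain B where B: "\<And>(y :: real ^ 'n) v. norm x \<le> norm y \<Longrightarrow> heat y v \<le> B"
    using heat_bounded[of "norm x", where 'n = 'n] x by auto
  show ?thesis
  proof (rule Bochner_Integration.integrable_bound[OF integrable_mult_left[OF w, of B]])
    show "AE p in \<Omega>. norm (w p * heat x (u p)) \<le> norm (w p * B)"
    proof (rule AE_I2)
      fix p
      have "\<bar>heat x (u p)\<bar> \<le> \<bar>B\<bar>" using B[of x "u p"] heat_nonneg[of x "u p"] by linarith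
      then show "norm (w p * heat x (u p)) \<le> norm (w p * B)"
        by (simp add: abs_mult mult_left_mono)
    qed
  qed measurable
qed

text \<open>Dominated convergence, with the uniform bound of the heat kernel on \<open>|x| > r\<close>.\<close>

lemma continuous_on_heat_mixture:
  assumes w: "integrable \<Omega> w" and [measurable]: "u \<in> borel_measurable \<Omega>"
  shows "continuous_on (- {0}) (\<lambda>x :: real ^ 'n. LINT p|\<Omega>. w p * heat x (u p))"
proof -
  note [measurable] = borel_measurable_integrable[OF w]
  let ?h = "\<lambda>x :: real ^ 'n. LINT p|\<Omega>. w p * heat x (u p)"
  let ?S = "\<lambda>r. {x :: real ^ 'n. r < norm x}"
  have S: "continuous_on (?S r) ?h" if r: "r > 0" for r
    unfolding continuous_on_sequentially
  proof (intro allI impI ballI, elim conjE)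
    fix X and a :: "real ^ 'n"
    assume a: "a \<in> ?S r" and X: "\<forall>n. X n \<in> ?S r" "X \<longlonglongrightarrow> a"
    obtain B where B: "\<And>(y :: real ^ 'n) v. r \<le> norm y \<Longrightarrow> heat y v \<le> B"
      using heat_bounded[OF r, where 'n = 'n] by auto
    show "(?h \<circ> X) \<longlonglongrightarrow> ?h a"
      unfolding o_def
    proof (rule integral_dominated_convergence[where w = "\<lambda>p. \<bar>w p\<bar> * B"])
      show "integrable \<Omega> (\<lambda>p. \<bar>w p\<bar> * B)" using w by simp
      show "AE p in \<Omega>. (\<lambda>n. w p * heat (X n) (u p)) \<longlonglongrightarrow> w p * heat a (u p)"
      proof (intro AE_I2 tendsto_mult tendsto_const)
        fix p
        have "(\<lambda>n. heat (X n) v) \<longlonglongrightarrow> heat a v" for v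
          unfolding heat_def using X(2) by (cases "0 < v") (auto intro!: tendsto_intros)
        then show "(\<lambda>n. heat (X n) (u p)) \<longlonglongrightarrow> heat a (u p)" .
      qed
      show "AE p in \<Omega>. norm (w p * heat (X n) (u p)) \<le> \<bar>w p\<bar> * B" for n
      proof (rule AE_I2)
        fix p
        have "heat (X n) (u p) \<le> B" using X(1) by (intro B) (auto intro: less_imp_le)
        then show "norm (w p * heat (X n) (u p)) \<le> \<bar>w p\<bar> * B"
          by (simp add: abs_mult mult_left_mono)
      qed
    qed measurable
  qed
  have "continuous_on (\<Union>r\<in>{0<..}. ?S r) ?h"
    using S by (intro continuous_on_open_UN) (auto intro: open_Collect_less continuous_intros)
  moreover have "(\<Union>r\<in>{0<..}. ?S r) = - {0}"
  proof -
    have "\<exists>r>0. r < norm x" if "x \<noteq> 0" for x :: "real ^ 'n"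
      using that dense[of 0 "norm x"] by auto
    then show ?thesis by auto
  qed
  ultimately show ?thesis by simp
qed

text \<open>The Fourier transform commutes with averaging over the time parameter. Both sides are double
  integrals that converge absolutely.\<close>

lemma tempered_fourier_heat_mixture:
  assumes \<Omega>: "sigma_finite_measure \<Omega>" and w: "integrable \<Omega> w"
    and u[measurable]: "u \<in> borel_measurable \<Omega>" and pos: "AE p in \<Omega>. 0 < u p"
  shows "has_tempered_fourier (\<lambda>x :: real ^ 'n. LINT p|\<Omega>. w p * heat x (u p))
           (\<lambda>\<xi>. LINT p|\<Omega>. w p * exp (- ((norm \<xi>)\<^sup>2 * u p)))"
  unfolding has_tempered_fourier_def
proof (intro conjI exI[of _ 0] allI impI)
  note [measurable] = borel_measurable_integrable[OF w]
  interpret \<Omega>: sigma_finite_measure \<Omega> by fact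
  interpret pair_sigma_finite \<Omega> "lborel :: (real ^ 'n) measure" ..
  let ?h = "\<lambda>x :: real ^ 'n. LINT p|\<Omega>. w p * heat x (u p)"
  let ?m = "\<lambda>\<xi> :: real ^ 'n. LINT p|\<Omega>. w p * exp (- ((norm \<xi>)\<^sup>2 * u p))"
  have [measurable]: "?h \<in> borel_measurable borel"
    by (simp only: measurable_lborel1[symmetric]) measurable
  have [measurable]: "?m \<in> borel_measurable borel"
    by (simp only: measurable_lborel1[symmetric]) measurable
  have int: "integrable (\<Omega> \<Otimes>\<^sub>M lborel) (\<lambda>(p, x :: real ^ 'n). w p * heat x (u p))"
  proof (rule Fubini_integrable)
    have "integrable \<Omega> (\<lambda>p. \<bar>w p\<bar>)" using w by simp
    moreover have "AE p in \<Omega>. (LINT x :: real ^ 'n|lborel. norm (case (p, x) of (p, x) \<Rightarrow> w p * heat x (u p))) = \<bar>w p\<bar>"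
      using pos by eventually_elim (simp add: abs_mult heat_integral)
    ultimately show "integrable \<Omega> (\<lambda>p. LINT x :: real ^ 'n|lborel. norm (case (p, x) of (p, x) \<Rightarrow> w p * heat x (u p)))"
      by (subst integrable_cong_AE) auto
    show "AE p in \<Omega>. integrable lborel (\<lambda>x :: real ^ 'n. case (p, x) of (p, x) \<Rightarrow> w p * heat x (u p))"
      using pos by eventually_elim (simp add: heat_integral)
  qed measurable
  have "integrable lborel ?h"
    using integrable_snd[OF int] by simp
  then show "integrable lebesgue (\<lambda>x. ?h x / (1 + norm x) ^ 0)"
    by (simp add: integrable_lebesgue_iff_lborel)
  fix \<phi> :: "real ^ 'n \<Rightarrow> complex"
  assume "schwartz \<phi>"
  note \<phi> = schwartz_imp_integrable[OF this]
  note [measurable] = \<phi>(2)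
  let ?K = "LINT \<xi>|lborel. norm (\<phi> \<xi>)"
  let ?A = "\<lambda>p x. complex_of_real (w p * heat x (u p)) * fourier \<phi> x"
  let ?B = "\<lambda>p \<xi>. complex_of_real (w p * exp (- ((norm \<xi>)\<^sup>2 * u p))) * \<phi> \<xi>"
  have i1: "integrable (\<Omega> \<Otimes>\<^sub>M lborel) (\<lambda>(p, x). ?A p x)"
  proof (rule Bochner_Integration.integrable_bound)
    show "integrable (\<Omega> \<Otimes>\<^sub>M lborel) (\<lambda>z. ?K * (case z of (p, x :: real ^ 'n) \<Rightarrow> w p * heat x (u p)))"
      using int by (rule integrable_mult_right)
    have "norm (?A p x) \<le> norm (?K * (w p * heat x (u p)))" for p x
    proof -
      have "norm (fourier \<phi> x) \<le> \<bar>?K\<bar>" using norm_fourier_le[OF \<phi>, of x] by linarith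
      from mult_right_mono[OF this, of "\<bar>w p * heat x (u p)\<bar>"]
      show ?thesis by (simp only: norm_mult norm_of_real real_norm_def abs_mult mult.commute[of "\<bar>w p\<bar> * _"] abs_ge_zero) simp
    qed
    then show "AE z in \<Omega> \<Otimes>\<^sub>M lborel. norm (case z of (p, x) \<Rightarrow> ?A p x)
        \<le> norm (?K * (case z of (p, x :: real ^ 'n) \<Rightarrow> w p * heat x (u p)))"
      by auto
  qed measurable
  have iw: "integrable \<Omega> (\<lambda>p. complex_of_real (w p))" using w by simp
  have i2: "integrable (\<Omega> \<Otimes>\<^sub>M lborel) (\<lambda>(p, \<xi>). ?B p \<xi>)"
  proof (rule Bochner_Integration.integrable_bound)
    show "integrable (\<Omega> \<Otimes>\<^sub>M lborel) (\<lambda>(p, \<xi>). complex_of_real (w p) * \<phi> \<xi>)"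
      by (intro integrable_product \<Omega> iw \<phi> lborel.sigma_finite_measure_axioms)
    have *: "AE p in \<Omega>. AE \<xi> in lborel. norm (?B p \<xi>) \<le> norm (complex_of_real (w p) * \<phi> \<xi>)"
      using pos
      by eventually_elim (auto simp: norm_mult mult_left_le intro!: AE_I2 mult_right_mono)
    show "AE z in \<Omega> \<Otimes>\<^sub>M lborel. norm (case z of (p, \<xi>) \<Rightarrow> ?B p \<xi>)
        \<le> norm (case z of (p, \<xi>) \<Rightarrow> complex_of_real (w p) * \<phi> \<xi>)"
    proof (rule AE_pair_measure)
      show "AE p in \<Omega>. AE \<xi> in lborel. norm (case (p, \<xi>) of (p, \<xi>) \<Rightarrow> ?B p \<xi>)
        \<le> norm (case (p, \<xi>) of (p, \<xi>) \<Rightarrow> complex_of_real (w p) * \<phi> \<xi>)"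
        unfolding prod.case by (rule *)
    qed measurable
  qed measurable
  have "(LINT \<xi>|lborel. complex_of_real (?m \<xi>) * \<phi> \<xi>)
      = (LINT \<xi>|lborel. LINT p|\<Omega>. ?B p \<xi>)"
    by (simp flip: integral_complex_of_real integral_mult_left_zero)
  also have "\<dots> = (LINT p|\<Omega>. LINT \<xi>|lborel. ?B p \<xi>)"
    by (rule Fubini_integral[OF i2])
  also have "\<dots> = (LINT p|\<Omega>. complex_of_real (w p) * (LINT \<xi>|lborel. complex_of_real (exp (- ((norm \<xi>)\<^sup>2 * u p))) * \<phi> \<xi>))"
    by (simp add: mult.assoc flip: integral_mult_right_zero)
  also have "\<dots> = (LINT p|\<Omega>. complex_of_real (w p) * (LINT x|lborel. complex_of_real (heat x (u p)) * fourier \<phi> x))"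
  proof (rule integral_cong_AE)
    show "AE p in \<Omega>. complex_of_real (w p) * (LINT \<xi>|lborel. complex_of_real (exp (- ((norm \<xi>)\<^sup>2 * u p))) * \<phi> \<xi>)
       = complex_of_real (w p) * (LINT x|lborel. complex_of_real (heat x (u p)) * fourier \<phi> x)"
      using pos by eventually_elim (simp add: heat_fourier_duality[OF _ \<phi>])
  qed measurable
  also have "\<dots> = (LINT p|\<Omega>. LINT x|lborel. ?A p x)"
    by (simp add: mult.assoc flip: integral_mult_right_zero)
  also have "\<dots> = (LINT x|lborel. LINT p|\<Omega>. ?A p x)"
    by (rule Fubini_integral[OF i1, symmetric])
  also have "\<dots> = (LINT x|lborel. complex_of_real (?h x) * fourier \<phi> x)"
    by (simp flip: integral_complex_of_real integral_mult_left_zero)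
  finally show "(LINT \<xi>|lebesgue. complex_of_real (?m \<xi>) * \<phi> \<xi>) = (LINT x|lebesgue. complex_of_real (?h x) * fourier \<phi> x)"
    by (simp add: integrable_lebesgue_iff_lborel)
qed

lemma fourier_gauss_wave:
  fixes a :: "real ^ 'n"
  assumes e: "0 < e"
  shows "fourier (gauss_wave a e) y = complex_of_real ((pi / e) powr (real CARD('n) / 2) * exp (- ((norm (y - a))\<^sup>2 / (4 * e))))"
proof -
  have m: "gauss_wave a e \<in> borel_measurable borel"
    by (rule schwartz_imp_integrable[OF schwartz_gauss_wave[OF e]])
  have "gauss_wave a e x * exp (- (\<i> * complex_of_real (x \<bullet> y)))
      = complex_of_real (exp (- (e * (norm x)\<^sup>2))) * exp (- (\<i> * complex_of_real (x \<bullet> (y - a))))" for x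
    by (simp add: gauss_wave_def mult.assoc exp_add[symmetric] inner_diff_right algebra_simps)
  then show ?thesis
    unfolding fourier_eq_lborel[OF m] using gaussian_fourier(2)[OF e, of "y - a"] by simp
qed

abbreviation gaussian :: "real ^ 'n \<Rightarrow> real \<Rightarrow> real ^ 'n \<Rightarrow> real" where
  "gaussian a s x \<equiv> exp (- (s * (norm (x - a))\<^sup>2))"

text \<open>The weight is absorbed: \<open>1 + |x| \<le> (1 + |a|) (1 + |x - a|)\<close>, and the Gaussian beats every
  power of the last factor.\<close>

lemma integrable_mult_gaussian:
  fixes h :: "real ^ 'n \<Rightarrow> real"
  assumes h: "integrable lebesgue (\<lambda>x. h x / (1 + norm x) ^ k)" and s: "0 < s"
  shows "integrable lebesgue (\<lambda>x. h x * gaussian a s x)"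
proof -
  obtain C where C: "0 \<le> C" "\<And>r. 0 \<le> r \<Longrightarrow> (1 + r) ^ k \<le> C * exp (s * r\<^sup>2)"
    using power_le_gaussian[OF s] by blast
  have pos: "1 + norm x > 0" for x :: "real ^ 'n" by (intro add_pos_nonneg) auto
  have eq: "h x = h x / (1 + norm x) ^ k * (1 + norm x) ^ k" for x using pos[of x] by simp
  have [measurable]: "(\<lambda>x. norm (x :: real ^ 'n)) \<in> borel_measurable lebesgue" "(\<lambda>x. norm (x - a)) \<in> borel_measurable lebesgue"
    by (auto intro: measurable_completion)
  have [measurable]: "h \<in> borel_measurable lebesgue"
    by (subst eq[abs_def]) (use borel_measurable_integrable[OF h] in measurable)
  show ?thesis
  proof (rule Bochner_Integration.integrable_bound)
    show "integrable lebesgue (\<lambda>x. ((1 + norm a) ^ k * C) * (h x / (1 + norm x) ^ k))"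
      using h by (rule integrable_mult_right)
    have "norm (h x * gaussian a s x) \<le> norm (((1 + norm a) ^ k * C) * (h x / (1 + norm x) ^ k))" for x
    proof -
      have "1 + norm x \<le> (1 + norm a) * (1 + norm (x - a))"
      proof -
        have "norm x \<le> norm a + norm (x - a)" using norm_triangle_ineq[of a "x - a"] by simp
        moreover have "(1 + norm a) * (1 + norm (x - a)) = 1 + norm a + norm (x - a) + norm a * norm (x - a)"
          by (simp add: algebra_simps)
        moreover have "0 \<le> norm a * norm (x - a)" by simp
        ultimately show ?thesis by linarith
      qed
      then have "(1 + norm x) ^ k \<le> ((1 + norm a) * (1 + norm (x - a))) ^ k"
        by (intro power_mono) auto
      also have "\<dots> \<le> (1 + norm a) ^ k * (C * exp (s * (norm (x - a))\<^sup>2))"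
        unfolding power_mult_distrib by (intro mult_left_mono C) auto
      finally have "(1 + norm x) ^ k * gaussian a s x
          \<le> (1 + norm a) ^ k * (C * exp (s * (norm (x - a))\<^sup>2)) * gaussian a s x"
        by (intro mult_right_mono) auto
      also have "\<dots> = (1 + norm a) ^ k * C" by (simp add: exp_minus)
      finally have "\<bar>h x / (1 + norm x) ^ k\<bar> * ((1 + norm x) ^ k * gaussian a s x)
          \<le> \<bar>h x / (1 + norm x) ^ k\<bar> * ((1 + norm a) ^ k * C)"
        by (intro mult_left_mono) auto
      moreover have "\<bar>h x / (1 + norm x) ^ k\<bar> * ((1 + norm x) ^ k * gaussian a s x) = norm (h x * gaussian a s x)"
        using pos[of x] by (simp add: abs_mult)
      moreover have "\<bar>h x / (1 + norm x) ^ k\<bar> * ((1 + norm a) ^ k * C) = norm (((1 + norm a) ^ k * C) * (h x / (1 + norm x) ^ k))"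
        using C(1) pos[of a] by (simp add: abs_mult)
      ultimately show ?thesis by (simp only:)
    qed
    then show "AE x in lebesgue. norm (h x * gaussian a s x) \<le> norm (((1 + norm a) ^ k * C) * (h x / (1 + norm x) ^ k))"
      by simp
  qed measurable
qed

lemma tempered_fourier_gaussian_average:
  fixes h :: "real ^ 'n \<Rightarrow> real"
  assumes h: "has_tempered_fourier h m" and s: "0 < s"
  shows "integrable lebesgue (\<lambda>x. h x * gaussian a s x)"
    and "complex_of_real (LINT x|lebesgue. h x * gaussian a s x)
      = (LINT \<omega>|lebesgue. complex_of_real (m \<omega>) * gauss_wave a (1 / (4 * s)) \<omega>) / complex_of_real ((4 * pi * s) powr (real CARD('n) / 2))"
proof -
  show "integrable lebesgue (\<lambda>x. h x * gaussian a s x)"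
    using h s integrable_mult_gaussian unfolding has_tempered_fourier_def by blast
  have e: "0 < 1 / (4 * s)" using s by simp
  have "(LINT \<omega>|lebesgue. complex_of_real (m \<omega>) * gauss_wave a (1 / (4 * s)) \<omega>)
      = (LINT x|lebesgue. complex_of_real (h x) * fourier (gauss_wave a (1 / (4 * s))) x)"
    using h schwartz_gauss_wave[OF e, of a] unfolding has_tempered_fourier_def by blast
  also have "\<dots> = (LINT x|lebesgue. complex_of_real ((4 * pi * s) powr (real CARD('n) / 2)) * complex_of_real (h x * gaussian a s x))"
    unfolding fourier_gauss_wave[OF e] using s by (simp add: mult_ac)
  also have "\<dots> = complex_of_real ((4 * pi * s) powr (real CARD('n) / 2)) * complex_of_real (LINT x|lebesgue. h x * gaussian a s x)"
    by (simp only: integral_mult_right_zero integral_complex_of_real)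
  finally show "complex_of_real (LINT x|lebesgue. h x * gaussian a s x)
      = (LINT \<omega>|lebesgue. complex_of_real (m \<omega>) * gauss_wave a (1 / (4 * s)) \<omega>) / complex_of_real ((4 * pi * s) powr (real CARD('n) / 2))"
    using s by simp
qed

text \<open>If \<open>h = h1 - h2\<close> were positive at \<open>a\<close>, then its Gaussian averages around \<open>a\<close>, which all
  vanish, would split into a part near \<open>a\<close> of order at least \<open>exp (- s r\<^sup>2 / 4)\<close> and a far part of
  order at most \<open>exp (- s r\<^sup>2)\<close>. For large \<open>s\<close> this is impossible.\<close>

lemma tempered_fourier_unique_le:
  fixes h1 h2 :: "real ^ 'n \<Rightarrow> real"
  assumes c: "continuous_on (- {0}) h1" "continuous_on (- {0}) h2"
    and F: "has_tempered_fourier h1 m" "has_tempered_fourier h2 m" and a: "a \<noteq> 0"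
  shows "h1 a \<le> h2 a"
proof (rule ccontr)
  assume "\<not> h1 a \<le> h2 a"
  define h where "h x = h1 x - h2 x" for x
  define d where "d = h a / 2"
  have d: "d > 0" "h a > d" using \<open>\<not> h1 a \<le> h2 a\<close> by (auto simp: d_def h_def)
  have int: "integrable lebesgue (\<lambda>x. h x * gaussian a s x)"
    and zero: "(LINT x|lebesgue. h x * gaussian a s x) = 0" if s: "s > 0" for s
  proof -
    note i = tempered_fourier_gaussian_average(1)[OF F(1) s, of a] tempered_fourier_gaussian_average(1)[OF F(2) s, of a]
    show "integrable lebesgue (\<lambda>x. h x * gaussian a s x)"
      unfolding h_def left_diff_distrib using i by (rule Bochner_Integration.integrable_diff)
    have "complex_of_real (LINT x|lebesgue. h1 x * gaussian a s x) = complex_of_real (LINT x|lebesgue. h2 x * gaussian a s x)"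
      unfolding tempered_fourier_gaussian_average(2)[OF F(1) s] tempered_fourier_gaussian_average(2)[OF F(2) s] ..
    then show "(LINT x|lebesgue. h x * gaussian a s x) = 0"
      unfolding h_def left_diff_distrib by (subst Bochner_Integration.integral_diff[OF i]) simp
  qed
  have "continuous_on (- {0}) h" unfolding h_def using c by (intro continuous_intros)
  then have "isCont h a" using a by (subst (asm) continuous_on_eq_continuous_at) auto
  then have "\<forall>\<^sub>F x in nhds a. d < h x"
    using d(2) unfolding isCont_def tendsto_at_iff_tendsto_nhds by (rule order_tendstoD)
  then obtain r where r: "r > 0" "\<And>x. dist x a < r \<Longrightarrow> d < h x"
    unfolding eventually_nhds_metric by blast
  define V where "V = measure lebesgue (ball a (r / 2))"
  define A where "A = (LINT x|lebesgue. \<bar>h x * gaussian a 1 x\<bar>)"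
  have iA: "integrable lebesgue (\<lambda>x. \<bar>h x * gaussian a 1 x\<bar>)"
    using int[of 1] by (intro integrable_abs) auto
  have V: "V > 0" using r(1) by (simp add: V_def content_ball_pos)
  \<comment> \<open>lower bound on the inner half ball, upper bound outside the ball; the shell between them
    contributes positively\<close>
  have key: "d * V * exp (- (s * (r / 2)\<^sup>2)) \<le> A * exp (- ((s - 1) * r\<^sup>2))" if s: "s \<ge> 1" for s
  proof -
    let ?L = "\<lambda>x. d * exp (- (s * (r / 2)\<^sup>2)) * indicator (ball a (r / 2)) x
        - exp (- ((s - 1) * r\<^sup>2)) * \<bar>h x * gaussian a 1 x\<bar>"
    have ball: "emeasure lebesgue (ball a (r / 2)) < \<infinity>"
      using emeasure_lborel_ball_finite[of a "r / 2"] by simp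
    have E: "0 \<le> exp (- ((s - 1) * r\<^sup>2)) * \<bar>h x * gaussian a 1 x\<bar>" for x
      by simp
    have le: "?L x \<le> h x * gaussian a s x" for x
    proof -
      consider "dist x a < r / 2" | "r / 2 \<le> dist x a" "dist x a < r" | "r \<le> dist x a" by linarith
      then show ?thesis
      proof cases
        case 1
        then have "d < h x" using r by auto
        moreover have "exp (- (s * (r / 2)\<^sup>2)) \<le> gaussian a s x"
          using 1 s by (auto simp: dist_norm intro!: mult_left_mono power_mono)
        ultimately have "d * exp (- (s * (r / 2)\<^sup>2)) \<le> h x * gaussian a s x"
          using d by (intro mult_mono) auto
        moreover have "indicator (ball a (r / 2)) x = (1 :: real)"
          using 1 by (simp add: dist_commute)
        ultimately show ?thesis using E[of x] by (simp only: mult_1_right)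
      next
        case 2
        then have "h x > 0" using r(2)[of x] d by auto
        then have "0 \<le> h x * gaussian a s x" by simp
        moreover have "indicator (ball a (r / 2)) x = (0 :: real)"
          using 2 by (simp add: dist_commute)
        ultimately show ?thesis using E[of x] by (simp only: mult_zero_right)
      next
        case 3
        have "gaussian a s x = exp (- ((s - 1) * (norm (x - a))\<^sup>2)) * gaussian a 1 x"
          unfolding exp_add[symmetric] by (simp add: algebra_simps)
        also have "\<dots> \<le> exp (- ((s - 1) * r\<^sup>2)) * gaussian a 1 x"
          using 3 s r(1) by (intro mult_right_mono) (auto simp: dist_norm intro!: mult_left_mono power_mono)
        finally have "\<bar>h x\<bar> * gaussian a s x \<le> \<bar>h x\<bar> * (exp (- ((s - 1) * r\<^sup>2)) * gaussian a 1 x)"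
          by (intro mult_left_mono) auto
        also have "\<dots> = exp (- ((s - 1) * r\<^sup>2)) * \<bar>h x * gaussian a 1 x\<bar>"
          by (simp add: abs_mult)
        finally have "\<bar>h x * gaussian a s x\<bar> \<le> exp (- ((s - 1) * r\<^sup>2)) * \<bar>h x * gaussian a 1 x\<bar>"
          by (simp only: abs_mult abs_exp_cancel)
        moreover have "indicator (ball a (r / 2)) x = (0 :: real)"
          using 3 r(1) by (simp add: dist_commute)
        ultimately show ?thesis by (simp only: mult_zero_right)
      qed
    qed
    have "(LINT x|lebesgue. ?L x) \<le> (LINT x|lebesgue. h x * gaussian a s x)"
      using s int[of s] iA ball le
      by (intro integral_mono Bochner_Integration.integrable_diff integrable_mult_right) auto
    also have "\<dots> = 0" using zero[of s] s by simp
    finally have "(LINT x|lebesgue. ?L x) \<le> 0" .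
    moreover have "(LINT x|lebesgue. ?L x) = d * exp (- (s * (r / 2)\<^sup>2)) * V - exp (- ((s - 1) * r\<^sup>2)) * A"
      using iA ball unfolding V_def A_def
      by (subst Bochner_Integration.integral_diff) (auto intro!: integrable_mult_right)
    ultimately show ?thesis by (simp add: mult_ac)
  qed
  have "((\<lambda>s. A * exp (- ((s - 1) * r\<^sup>2)) * exp (s * (r / 2)\<^sup>2)) \<longlongrightarrow> 0) at_top"
  proof -
    have "A * exp (- ((s - 1) * r\<^sup>2)) * exp (s * (r / 2)\<^sup>2) = (A * exp (r\<^sup>2)) * exp (- (s * (3 / 4 * r\<^sup>2)))" for s
    proof -
      have "- ((s - 1) * r\<^sup>2) + s * (r / 2)\<^sup>2 = r\<^sup>2 + - (s * (3 / 4 * r\<^sup>2))"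
        by (simp add: power_divide algebra_simps)
      then show ?thesis by (simp only: mult.assoc exp_add[symmetric])
    qed
    moreover have "((\<lambda>s. (A * exp (r\<^sup>2)) * exp (- (s * (3 / 4 * r\<^sup>2)))) \<longlongrightarrow> 0) at_top"
    proof -
      have "3 / 4 * r\<^sup>2 > 0" using r(1) by simp
      then show ?thesis by real_asymp
    qed
    ultimately show ?thesis by (simp only:)
  qed
  moreover have "\<forall>\<^sub>F s in at_top. d * V \<le> A * exp (- ((s - 1) * r\<^sup>2)) * exp (s * (r / 2)\<^sup>2)"
    using eventually_ge_at_top[of 1]
  proof eventually_elim
    case (elim s)
    from mult_right_mono[OF key[OF elim], of "exp (s * (r / 2)\<^sup>2)"]
    show ?case by (simp add: mult.assoc exp_minus)
  qed
  ultimately have "d * V \<le> 0" by (rule tendsto_lowerbound) simp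
  then show False using d V by (simp add: mult_le_0_iff)
qed

lemma tempered_fourier_unique:
  fixes h1 h2 :: "real ^ 'n \<Rightarrow> real"
  assumes "continuous_on (- {0}) h1" "continuous_on (- {0}) h2"
    and "has_tempered_fourier h1 m" "has_tempered_fourier h2 m" and "a \<noteq> 0"
  shows "h1 a = h2 a"
  by (intro antisym tempered_fourier_unique_le[of h1 h2 m] tempered_fourier_unique_le[of h2 h1 m])
    (use assms in auto)

section \<open>Fractional integral of the Mittag-Leffler function\<close>

lemma has_bochner_integral_Beta:
  fixes a b t :: real
  assumes a: "0 < a" and b: "0 < b" and t: "0 < t"
  shows "has_bochner_integral lborel (\<lambda>x. indicator {0<..<t} x * (x powr (a - 1) * (t - x) powr (b - 1)))
           (t powr (a + b - 1) * Beta a b)"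
proof -
  have I: "((\<lambda>x. x powr (a - 1) * (1 - x) powr (b - 1)) has_integral Beta a b) {0..1}"
    by (rule has_integral_Beta_real[OF a b])
  have Bpos: "0 \<le> Beta a b" using a b by (simp add: Beta_def less_imp_le)
  have eq: "indicator {0<..<1} x * (x powr (a - 1) * (1 - x) powr (b - 1))
      = (indicator {0..1} x * (x powr (a - 1) * (1 - x) powr (b - 1)) :: real)" for x
    by (auto split: split_indicator)
  have "(\<integral>\<^sup>+x. ennreal (indicator {0..1} x * (x powr (a - 1) * (1 - x) powr (b - 1))) \<partial>lborel) = ennreal (Beta a b)"
    by (rule nn_integral_has_integral_lebesgue[OF _ I]) auto
  then have "has_bochner_integral lborel (\<lambda>x. indicator {0<..<1} x * (x powr (a - 1) * (1 - x) powr (b - 1))) (Beta a b)"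
    unfolding eq by (intro has_bochner_integral_nn_integral Bpos) auto
  from has_bochner_integral_mult_right[OF lborel_has_bochner_integral_real_affine_iff[THEN iffD1, OF _ this, of "1 / t" 0], of "t powr (a + b - 2)"]
  have *: "has_bochner_integral lborel (\<lambda>x. t powr (a + b - 2) * (indicator {0<..<1} (0 + 1 / t * x) *
      ((0 + 1 / t * x) powr (a - 1) * (1 - (0 + 1 / t * x)) powr (b - 1)))) (t powr (a + b - 2) * (Beta a b /\<^sub>R \<bar>1 / t\<bar>))"
    using t by simp
  have "t powr (a + b - 2) * (indicator {0<..<1} (0 + 1 / t * x) *
      ((0 + 1 / t * x) powr (a - 1) * (1 - (0 + 1 / t * x)) powr (b - 1)))
    = indicator {0<..<t} x * (x powr (a - 1) * (t - x) powr (b - 1))" for x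
  proof (cases "x \<in> {0<..<t}")
    case True
    then have x: "0 < x" "x < t" by auto
    have "1 - 1 / t * x = (t - x) / t" using t by (simp add: field_simps)
    then have "(1 / t * x) powr (a - 1) * (1 - 1 / t * x) powr (b - 1)
        = x powr (a - 1) * (t - x) powr (b - 1) / (t powr (a - 1) * t powr (b - 1))"
      using x t by (simp add: powr_divide)
    moreover have "t powr (a - 1) * t powr (b - 1) = t powr (a + b - 2)"
      by (simp add: powr_add[symmetric])
    moreover have "0 + 1 / t * x \<in> {0<..<1}" using x t by auto
    ultimately show ?thesis using True t by simp
  next
    case False
    then have "0 + 1 / t * x \<notin> {0<..<1}" using t by (auto simp: field_simps)
    then show ?thesis using False by simp
  qed
  moreover have "t powr (a + b - 2) * (Beta a b /\<^sub>R \<bar>1 / t\<bar>) = t powr (a + b - 1) * Beta a b"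
  proof -
    have "t powr (a + b - 2 + 1) = t powr (a + b - 2) * t powr 1"
      by (rule powr_add)
    then show ?thesis using t by (simp add: divide_inverse)
  qed
  ultimately show ?thesis using * by (simp only:)
qed

lemma powr_real_mult_eq_power:
  fixes x :: real
  assumes "0 < x"
  shows "x powr (real k * a) = (x powr a) ^ k"
proof -
  have "(x powr a) ^ k = (x powr a) powr real k"
    using assms by (intro powr_realpow[symmetric]) simp
  then show ?thesis by (simp only: powr_powr mult.commute)
qed

lemma Mittag_Leffler_sums:
  assumes a: "0 < a"
  shows "(\<lambda>k. x ^ k / Gamma (1 + real k * a)) sums Mittag_Leffler a x"
proof -
  have G: "Gamma (1 + real k * a) > 0" for k
    using a by (intro Gamma_real_pos add_pos_nonneg) auto
  have "summable (\<lambda>k. norm (x ^ k / Gamma (1 + real k * a)))"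
    using summable_Mittag_Leffler_norm[OF a, of x] by (simp add: power_abs abs_of_pos[OF G])
  from summable_sums[OF summable_norm_cancel[OF this]]
  show ?thesis by (simp only: Mittag_Leffler_def)
qed

text \<open>Termwise Beta integrals shift the Mittag-Leffler series by one index. The case \<open>l = 0\<close> is
  the limit of the general formula.\<close>

lemma Mittag_Leffler_fractional_integral:
  fixes a l t :: real
  assumes a: "0 < a" and l: "0 \<le> l" and t: "0 < t"
  shows "(LINT x|lborel. indicator {0<..<t} x * (t - x) powr (a - 1) * Mittag_Leffler a (- (l * x powr a)))
    = Gamma a * (if l = 0 then t powr a / Gamma (1 + a) else (1 - Mittag_Leffler a (- (l * t powr a))) / l)"
proof -
  have G: "Gamma (1 + real k * a) > 0" for k
    using a by (intro Gamma_real_pos add_pos_nonneg) auto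
  let ?f = "\<lambda>k x. (- l) ^ k / Gamma (1 + real k * a) * (indicator {0<..<t} x * (x powr ((1 + real k * a) - 1) * (t - x) powr (a - 1)))"
  let ?c = "\<lambda>k. t powr (1 + real k * a + a - 1) * Beta (1 + real k * a) a"
  have b: "has_bochner_integral lborel (\<lambda>x. indicator {0<..<t} x * (x powr ((1 + real k * a) - 1) * (t - x) powr (a - 1))) (?c k)" for k
    using a t by (intro has_bochner_integral_Beta add_pos_nonneg) auto
  have B: "Beta (1 + real k * a) a = Gamma (1 + real k * a) * Gamma a / Gamma (1 + real (Suc k) * a)" for k
    by (simp add: Beta_def algebra_simps)
  have P: "t powr (1 + real k * a + a - 1) = t powr a * (t powr a) ^ k" for k
  proof -
    have "1 + real k * a + a - 1 = a + real k * a" by simp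
    then show ?thesis by (simp only: powr_add powr_real_mult_eq_power[OF t])
  qed
  have F: "integral\<^sup>L lborel (?f k) = Gamma a * t powr a * ((- (l * t powr a)) ^ k / Gamma (1 + real (Suc k) * a))" for k
  proof -
    have "integral\<^sup>L lborel (?f k) = (- l) ^ k / Gamma (1 + real k * a) * ?c k"
      using has_bochner_integral_integral_eq[OF b] by simp
    also have "\<dots> = Gamma a * t powr a * (((- l) ^ k * (t powr a) ^ k) / Gamma (1 + real (Suc k) * a))"
      unfolding B P using G[of k] by simp
    also have "(- l) ^ k * (t powr a) ^ k = (- (l * t powr a)) ^ k"
      by (simp add: power_mult_distrib[symmetric])
    finally show ?thesis .
  qed
  have aF: "(LINT x|lborel. norm (?f k x)) = Gamma a * t powr a * (\<bar>l * t powr a\<bar> ^ k / Gamma (1 + real (Suc k) * a))" for k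
  proof -
    have "(LINT x|lborel. norm (?f k x)) = (LINT x|lborel. l ^ k / Gamma (1 + real k * a) * (indicator {0<..<t} x * (x powr ((1 + real k * a) - 1) * (t - x) powr (a - 1))))"
      using l G[of k] by (intro Bochner_Integration.integral_cong) (auto simp: abs_mult power_abs)
    also have "\<dots> = l ^ k / Gamma (1 + real k * a) * ?c k"
      using has_bochner_integral_integral_eq[OF b] by simp
    also have "\<dots> = Gamma a * t powr a * ((l ^ k * (t powr a) ^ k) / Gamma (1 + real (Suc k) * a))"
      unfolding B P using G[of k] by simp
    also have "l ^ k * (t powr a) ^ k = \<bar>l * t powr a\<bar> ^ k"
      using l by (simp add: power_mult_distrib[symmetric] abs_mult)
    finally show ?thesis .
  qed
  have summ: "summable (\<lambda>k. \<bar>z\<bar> ^ k / Gamma (1 + real (Suc k) * a))" for z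
  proof (rule summable_comparison_test')
    show "summable (\<lambda>k. \<bar>\<bar>z\<bar> + 1\<bar> ^ Suc k / Gamma (1 + real (Suc k) * a))"
      using summable_Mittag_Leffler_norm[OF a, of "\<bar>z\<bar> + 1"]
      by (subst summable_Suc_iff[where f = "\<lambda>k. \<bar>\<bar>z\<bar> + 1\<bar> ^ k / Gamma (1 + real k * a)"])
    fix k :: nat
    have "\<bar>z\<bar> ^ k \<le> (\<bar>z\<bar> + 1) ^ k" by (intro power_mono) auto
    also have "\<dots> \<le> (\<bar>z\<bar> + 1) ^ Suc k" by (intro power_increasing) auto
    finally have "\<bar>z\<bar> ^ k / Gamma (1 + real (Suc k) * a) \<le> \<bar>\<bar>z\<bar> + 1\<bar> ^ Suc k / Gamma (1 + real (Suc k) * a)"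
      using G[of "Suc k"] by (intro divide_right_mono) auto
    then show "norm (\<bar>z\<bar> ^ k / Gamma (1 + real (Suc k) * a)) \<le> \<bar>\<bar>z\<bar> + 1\<bar> ^ Suc k / Gamma (1 + real (Suc k) * a)"
      using G[of "Suc k"] by simp
  qed
  have termsum: "(\<lambda>k. ?f k x) sums (indicator {0<..<t} x * (t - x) powr (a - 1) * Mittag_Leffler a (- (l * x powr a)))" for x
  proof (cases "x \<in> {0<..<t}")
    case True
    have e: "(- l) ^ k * x powr (real k * a) = (- (l * x powr a)) ^ k" for k
    proof -
      have "x powr (real k * a) = (x powr a) ^ k"
        using True by (intro powr_real_mult_eq_power) simp
      then show ?thesis by (simp add: power_mult_distrib[symmetric])
    qed
    have fk: "?f k x = (t - x) powr (a - 1) * ((- (l * x powr a)) ^ k / Gamma (1 + real k * a))" for k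
      using True unfolding e[symmetric] by simp
    show ?thesis
      unfolding fk using True sums_mult[OF Mittag_Leffler_sums[OF a, of "- (l * x powr a)"], of "(t - x) powr (a - 1)"] by simp
  qed simp
  have "(\<lambda>k. integral\<^sup>L lborel (?f k)) sums (LINT x|lborel. (\<Sum>k. ?f k x))"
  proof (rule sums_integral)
    show "integrable lborel (?f k)" for k
      using b[of k] by (intro integrable_mult_right) (auto simp: has_bochner_integral_iff)
    show "AE x in lborel. summable (\<lambda>k. norm (?f k x))"
    proof (rule AE_I2)
      fix x
      show "summable (\<lambda>k. norm (?f k x))"
      proof (cases "x \<in> {0<..<t}")
        case True
        have "norm (?f k x) = (t - x) powr (a - 1) * (\<bar>l * x powr a\<bar> ^ k / Gamma (1 + real k * a))" for k
        proof -
          have "x powr (real k * a) = (x powr a) ^ k"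
            using True by (intro powr_real_mult_eq_power) simp
          then show ?thesis
            using True G[of k] l by (simp add: abs_mult power_abs power_mult_distrib)
        qed
        then show ?thesis
          using summable_mult[OF summable_Mittag_Leffler_norm[OF a, of "l * x powr a"]] by simp
      qed simp
    qed
    show "summable (\<lambda>k. LINT x|lborel. norm (?f k x))"
      unfolding aF by (intro summable_mult summ)
  qed
  then have S: "(\<lambda>k. Gamma a * t powr a * ((- (l * t powr a)) ^ k / Gamma (1 + real (Suc k) * a))) sums
     (LINT x|lborel. indicator {0<..<t} x * (t - x) powr (a - 1) * Mittag_Leffler a (- (l * x powr a)))"
    unfolding F using termsum by (simp add: sums_iff)
  show ?thesis
  proof (cases "l = 0")
    case True
    have "(\<lambda>k. Gamma a * t powr a * ((0::real) ^ k / Gamma (1 + real (Suc k) * a))) sums (Gamma a * t powr a * (1 / Gamma (1 + a)))"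
      using sums_mult[OF powser_sums_zero[of "\<lambda>k. 1 / Gamma (1 + real (Suc k) * a)"], of "Gamma a * t powr a"] by simp
    then show ?thesis using sums_unique2[OF S] True by simp
  next
    case False
    let ?z = "- (l * t powr a)"
    have "(\<lambda>k. ?z ^ Suc k / Gamma (1 + real (Suc k) * a)) sums (Mittag_Leffler a ?z - ?z ^ 0 / Gamma (1 + real 0 * a))"
      using Mittag_Leffler_sums[OF a, of ?z] by (subst sums_Suc_iff) simp
    from sums_mult[OF this, of "Gamma a * (- 1 / l)"]
    have "(\<lambda>k. Gamma a * (- 1 / l) * (?z ^ Suc k / Gamma (1 + real (Suc k) * a))) sums (Gamma a * (- 1 / l) * (Mittag_Leffler a ?z - 1))"
      by simp
    moreover have "Gamma a * (- 1 / l) * (?z ^ Suc k / Gamma (1 + real (Suc k) * a)) = Gamma a * t powr a * (?z ^ k / Gamma (1 + real (Suc k) * a))" for k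
      using False by simp
    ultimately have "(\<lambda>k. Gamma a * t powr a * (?z ^ k / Gamma (1 + real (Suc k) * a))) sums (Gamma a * (- 1 / l) * (Mittag_Leffler a ?z - 1))"
      by (simp only:)
    from sums_unique2[OF S this] show ?thesis using False by (simp add: field_simps)
  qed
qed

text \<open>The integrand is the derivative of \<open>(1 - exp (- c x\<^sup>a)) / c\<close>, which is continuous at \<open>0\<close>
  although the integrand may be unbounded there.\<close>

lemma has_bochner_integral_powr_exp:
  fixes a c t :: real
  assumes a: "0 < a" and c: "0 \<le> c" and t: "0 < t"
  shows "has_bochner_integral lborel (\<lambda>x. indicator {0<..<t} x * (a * x powr (a - 1) * exp (- (c * x powr a))))
           (if c = 0 then t powr a else (1 - exp (- (c * t powr a))) / c)"
proof -
  let ?F = "\<lambda>x. if c = 0 then x powr a else (1 - exp (- (c * x powr a))) / c"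
  let ?f = "\<lambda>x. a * x powr (a - 1) * exp (- (c * x powr a))"
  have "(?f has_integral (?F t - ?F 0)) {0..t}"
  proof (rule fundamental_theorem_of_calculus_interior)
    have "continuous_on {0..t} (\<lambda>x. x powr a)"
      using a by (intro continuous_on_powr' continuous_intros) auto
    then show "continuous_on {0..t} ?F"
      by (cases "c = 0") (auto intro!: continuous_intros)
    fix x assume "x \<in> {0<..<t}"
    then have "(?F has_real_derivative ?f x) (at x)"
      by (cases "c = 0") (auto intro!: derivative_eq_intros)
    then show "(?F has_vector_derivative ?f x) (at x)"
      by (simp add: has_real_derivative_iff_has_vector_derivative)
  qed (use t in simp)
  moreover have "?F 0 = 0" by simp
  ultimately have I: "(?f has_integral ?F t) {0..t}" by (simp only: diff_zero)
  have "(\<integral>\<^sup>+x. ennreal (indicator {0..t} x * ?f x) \<partial>lborel) = ennreal (?F t)"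
    by (rule nn_integral_has_integral_lebesgue[OF _ I]) (use a in auto)
  moreover have "AE x in lborel. indicator {0<..<t} x * ?f x = indicator {0..t} x * ?f x"
    using AE_lborel_singleton[of 0] AE_lborel_singleton[of t]
    by eventually_elim (auto split: split_indicator)
  ultimately have "(\<integral>\<^sup>+x. ennreal (indicator {0<..<t} x * ?f x) \<partial>lborel) = ennreal (?F t)"
    by (subst nn_integral_cong_AE[where v = "\<lambda>x. ennreal (indicator {0..t} x * ?f x)"]) auto
  moreover have "0 \<le> ?F t" using c t by auto
  ultimately show ?thesis
    using a by (intro has_bochner_integral_nn_integral) auto
qed

section \<open>The kernels by subordination\<close>

text \<open>The two laws drive the subordination: \<open>\<sigma>\<close> turns the exponential into the Mittag-Leffler
  function in time, \<open>\<nu>\<close> turns the Laplacian into its power \<open>\<beta>\<close>.\<close>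

locale subordination =
  fixes \<alpha> \<beta> :: real and \<sigma> \<nu> :: "real measure"
  assumes \<alpha>: "0 < \<alpha>" "\<alpha> < 1" and \<beta>: "0 < \<beta>" "\<beta> \<le> 1"
    and \<sigma>: "stable_law \<alpha> \<sigma>" and \<nu>: "stable_law \<beta> \<nu>"
begin

sublocale \<sigma>: prob_space \<sigma> using stable_lawD(1)[OF \<sigma>] .
sublocale \<nu>: prob_space \<nu> using stable_lawD(1)[OF \<nu>] .
sublocale P: pair_prob_space \<sigma> \<nu> ..

lemma sets_laws [measurable_cong]: "sets \<sigma> = sets borel" "sets \<nu> = sets borel"
  using stable_lawD(2)[OF \<sigma>] stable_lawD(2)[OF \<nu>] by auto

abbreviation P :: "(real \<times> real) measure" where "P \<equiv> \<sigma> \<Otimes>\<^sub>M \<nu>"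

lemma AE_P_pos: "AE p in P. 0 < fst p \<and> 0 < snd p"
proof (rule P.AE_pair_measure)
  show "AE x in \<sigma>. AE y in \<nu>. 0 < fst (x, y) \<and> 0 < snd (x, y)"
    using stable_lawD(3)[OF \<sigma>]
  proof eventually_elim
    case (elim x)
    show ?case using stable_lawD(3)[OF \<nu>] by eventually_elim (use elim in auto)
  qed
qed measurable

text \<open>The random time at which the heat kernel is evaluated; the two components of \<open>p\<close> are the
  values of the stable variables of index \<open>\<alpha>\<close> and \<open>\<beta>\<close>.\<close>

definition op_time :: "real \<Rightarrow> real \<times> real \<Rightarrow> real" where
  "op_time t p = (t / fst p) powr (\<alpha> / \<beta>) * snd p"

lemma op_time_measurable [measurable (raw)]:
  assumes [measurable]: "f \<in> borel_measurable M" "g \<in> measurable M P"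
  shows "(\<lambda>x. op_time (f x) (g x)) \<in> borel_measurable M"
proof -
  have [measurable]: "g \<in> measurable M (borel \<Otimes>\<^sub>M borel)"
    using assms(2) by (simp cong: measurable_cong_sets sets_pair_measure_cong add: sets_laws)
  show ?thesis unfolding op_time_def by measurable
qed

lemma AE_op_time_pos: "t \<noteq> 0 \<Longrightarrow> AE p in P. 0 < op_time t p"
  using AE_P_pos by eventually_elim (auto simp: op_time_def)

text \<open>The factor \<open>1\<close> is the weight in the mixture lemmas, which are stated for weighted averages.\<close>

definition Z_sub :: "real ^ 'n \<Rightarrow> real \<Rightarrow> real" where
  "Z_sub x t = (LINT p|P. 1 * heat x (op_time t p))"

abbreviation Y_integrand :: "real ^ 'n \<Rightarrow> real \<Rightarrow> real \<times> real \<Rightarrow> real" where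
  "Y_integrand x t p \<equiv> \<alpha> * t powr (\<alpha> - 1) * fst p powr (- \<alpha>) * heat x (op_time t p)"

definition Y_sub :: "real ^ 'n \<Rightarrow> real \<Rightarrow> real" where
  "Y_sub x t = (LINT p|P. Y_integrand x t p)"

lemma integrable_weight: "integrable P (\<lambda>p. fst p powr (- \<alpha>))"
proof (rule integrableI_nonneg)
  have "(\<integral>\<^sup>+p. ennreal (fst p powr (- \<alpha>)) \<partial>P) = (\<integral>\<^sup>+x. \<integral>\<^sup>+y. ennreal (fst (x, y) powr (- \<alpha>)) \<partial>\<nu> \<partial>\<sigma>)"
    by (rule \<nu>.nn_integral_fst[symmetric]) measurable
  also have "\<dots> = ennreal (Gamma (1 + \<alpha> / \<alpha>) / Gamma (1 + \<alpha>))"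
    using stable_negative_moment[OF \<sigma>, of \<alpha>] \<alpha> by (simp add: \<nu>.emeasure_space_1)
  finally show "(\<integral>\<^sup>+p. ennreal (fst p powr (- \<alpha>)) \<partial>P) < \<infinity>" by simp
qed auto

lemma integrable_weight_sigma: "integrable \<sigma> (\<lambda>s. s powr (- \<alpha>))"
  and weight_mean: "(LINT s|\<sigma>. s powr (- \<alpha>)) = 1 / Gamma (1 + \<alpha>)"
proof -
  have nn: "(\<integral>\<^sup>+s. ennreal (s powr (- \<alpha>)) \<partial>\<sigma>) = ennreal (1 / Gamma (1 + \<alpha>))"
    using stable_negative_moment[OF \<sigma>, of \<alpha>] \<alpha> Gamma_fact[of 1, where 'a = real] by simp
  show "integrable \<sigma> (\<lambda>s. s powr (- \<alpha>))"
    by (rule integrableI_nonneg) (auto simp: nn)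
  have "Gamma (1 + \<alpha>) > 0" using \<alpha> by (intro Gamma_real_pos) simp
  then show "(LINT s|\<sigma>. s powr (- \<alpha>)) = 1 / Gamma (1 + \<alpha>)"
    by (subst integral_eq_nn_integral) (auto simp: nn)
qed

text \<open>Integrating out the second variable turns \<open>exp (- l u)\<close> into \<open>exp (- l\<^sup>\<beta> (t / s)\<^sup>\<alpha>)\<close>.\<close>

lemma laplace_op_time:
  assumes l: "0 \<le> l" and t: "0 < t" and g: "integrable \<sigma> g"
  shows "(LINT p|P. g (fst p) * exp (- (l * op_time t p)))
       = (LINT s|\<sigma>. g s * exp (- (l powr \<beta> * t powr \<alpha> * s powr (- \<alpha>))))"
proof -
  note [measurable] = borel_measurable_integrable[OF g]
  have nn: "AE p in P. norm (g (fst p) * exp (- (l * op_time t p))) \<le> norm (g (fst p))"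
    using AE_op_time_pos[of t] t l by (auto elim!: eventually_mono simp: abs_mult mult_left_le)
  have "(\<integral>\<^sup>+p. ennreal (norm (g (fst p))) \<partial>P) = (\<integral>\<^sup>+x. \<integral>\<^sup>+y. ennreal (norm (g (fst (x, y)))) \<partial>\<nu> \<partial>\<sigma>)"
    by (rule \<nu>.nn_integral_fst[symmetric]) measurable
  also have "\<dots> < \<infinity>" using g by (simp add: \<nu>.emeasure_space_1 integrable_iff_bounded)
  finally have "integrable P (\<lambda>p. g (fst p))"
    by (simp add: integrable_iff_bounded)
  then have int: "integrable P (\<lambda>p. g (fst p) * exp (- (l * op_time t p)))"
    by (rule Bochner_Integration.integrable_bound[OF _ _ nn]) measurable
  have "(LINT p|P. g (fst p) * exp (- (l * op_time t p)))
      = (LINT s|\<sigma>. LINT v|\<nu>. g (fst (s, v)) * exp (- (l * op_time t (s, v))))"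
    by (rule P.integral_fst'[OF int, symmetric])
  also have "\<dots> = (LINT s|\<sigma>. g s * exp (- (l powr \<beta> * t powr \<alpha> * s powr (- \<alpha>))))"
  proof (rule integral_cong_AE)
    show "AE s in \<sigma>. (LINT v|\<nu>. g (fst (s, v)) * exp (- (l * op_time t (s, v)))) = g s * exp (- (l powr \<beta> * t powr \<alpha> * s powr (- \<alpha>)))"
      using stable_lawD(3)[OF \<sigma>]
    proof eventually_elim
      case (elim s)
      have "(LINT v|\<nu>. exp (- ((l * (t / s) powr (\<alpha> / \<beta>)) * v))) = exp (- ((l * (t / s) powr (\<alpha> / \<beta>)) powr \<beta>))"
        using l by (intro stable_lawD(4)[OF \<nu>]) simp
      also have "(l * (t / s) powr (\<alpha> / \<beta>)) powr \<beta> = l powr \<beta> * t powr \<alpha> * s powr (- \<alpha>)"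
      proof -
        have "((t / s) powr (\<alpha> / \<beta>)) powr \<beta> = (t / s) powr \<alpha>"
          using \<beta> by (simp add: powr_powr)
        also have "\<dots> = t powr \<alpha> / s powr \<alpha>"
          by (rule powr_divide)
        also have "\<dots> = t powr \<alpha> * s powr (- \<alpha>)"
          by (simp only: powr_minus divide_inverse)
        finally show ?thesis by (simp only: powr_mult mult.assoc)
      qed
      finally show ?case
        by (simp add: op_time_def mult.assoc)
    qed
  qed measurable
  finally show ?thesis .
qed

lemma laplace_op_time_Mittag_Leffler:
  assumes l: "0 \<le> l" and t: "0 < t"
  shows "(LINT p|P. 1 * exp (- (l * op_time t p))) = Mittag_Leffler \<alpha> (- (l powr \<beta> * t powr \<alpha>))"
  using laplace_op_time[OF l t, of "\<lambda>_. 1"] Mittag_Leffler_stable[OF \<sigma> \<alpha>(1), of "l powr \<beta> * t powr \<alpha>"]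
  by simp

lemma Z_sub_spec:
  assumes t: "0 < t"
  shows "continuous_on (- {0}) (\<lambda>x :: real ^ 'n. Z_sub x t)"
    and "has_tempered_fourier (\<lambda>x :: real ^ 'n. Z_sub x t)
           (\<lambda>\<omega>. Mittag_Leffler \<alpha> (- (norm \<omega> powr (2 * \<beta>) * t powr \<alpha>)))"
proof -
  show "continuous_on (- {0}) (\<lambda>x :: real ^ 'n. Z_sub x t)"
    unfolding Z_sub_def by (intro continuous_on_heat_mixture) auto
  have "has_tempered_fourier (\<lambda>x :: real ^ 'n. Z_sub x t) (\<lambda>\<omega>. LINT p|P. 1 * exp (- ((norm \<omega>)\<^sup>2 * op_time t p)))"
    unfolding Z_sub_def using t
    by (intro tempered_fourier_heat_mixture AE_op_time_pos P.sigma_finite_measure_axioms) auto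
  moreover have "((norm \<omega>)\<^sup>2) powr \<beta> = norm \<omega> powr (2 * \<beta>)" for \<omega> :: "real ^ 'n"
    by (cases "\<omega> = 0") (simp_all add: powr_powr[symmetric])
  ultimately show "has_tempered_fourier (\<lambda>x :: real ^ 'n. Z_sub x t)
           (\<lambda>\<omega>. Mittag_Leffler \<alpha> (- (norm \<omega> powr (2 * \<beta>) * t powr \<alpha>)))"
    using t by (simp only: laplace_op_time_Mittag_Leffler zero_le_power2)
qed

text \<open>The choice operator in the definition of the kernel picks some function with the prescribed
  transform; uniqueness makes the choice harmless off the origin.\<close>

lemma Z_kernel_eq:
  fixes x :: "real ^ 'n"
  assumes x: "x \<noteq> 0" and t: "0 < t"
  shows "Z_kernel \<alpha> \<beta> x t = Z_sub x t"
proof -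
  let ?m = "\<lambda>\<omega> :: real ^ 'n. Mittag_Leffler \<alpha> (- (norm \<omega> powr (2 * \<beta>) * t powr \<alpha>))"
  let ?S = "SOME h. continuous_on (- {0}) h \<and> has_tempered_fourier h ?m"
  have "continuous_on (- {0}) ?S \<and> has_tempered_fourier ?S ?m"
    by (rule someI[where P = "\<lambda>h. continuous_on (- {0}) h \<and> has_tempered_fourier h ?m"])
      (rule conjI[OF Z_sub_spec[OF t]])
  then have "?S x = Z_sub x t"
    using Z_sub_spec[OF t, where 'n = 'n] x by (intro tempered_fourier_unique[where m = ?m]) auto
  then show ?thesis using t by (simp add: Z_kernel_def)
qed

lemma integrable_lborel_P_product:
  assumes f: "integrable lborel f" and g: "integrable P g"
  shows "integrable (lborel \<Otimes>\<^sub>M P) (\<lambda>(\<tau>, p). f \<tau> * g p :: real)"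
proof -
  interpret Q: pair_sigma_finite lborel P ..
  note [measurable] = borel_measurable_integrable[OF f] borel_measurable_integrable[OF g]
  show ?thesis
  proof (rule Q.Fubini_integrable)
    show "integrable lborel (\<lambda>\<tau>. LINT p|P. norm (case (\<tau>, p) of (\<tau>, p) \<Rightarrow> f \<tau> * g p))"
      using f by (simp add: abs_mult)
    show "AE \<tau> in lborel. integrable P (\<lambda>p. case (\<tau>, p) of (\<tau>, p) \<Rightarrow> f \<tau> * g p)"
      using g by simp
  qed measurable
qed

lemma integrable_left_weight:
  assumes "0 < t"
  shows "integrable lborel (\<lambda>\<tau>. indicator {0<..<t} \<tau> * (t - \<tau>) powr (\<alpha> - 1))"
proof -
  have "integrable lborel (\<lambda>\<tau>. indicator {0<..<t} \<tau> * (\<tau> powr (1 - 1) * (t - \<tau>) powr (\<alpha> - 1)))"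
    using has_bochner_integral_Beta[of 1 \<alpha> t] \<alpha> assms by (simp add: has_bochner_integral_iff)
  moreover have "indicator {0<..<t} \<tau> * (\<tau> powr (1 - 1) * (t - \<tau>) powr (\<alpha> - 1)) = indicator {0<..<t} \<tau> * (t - \<tau>) powr (\<alpha> - 1)" for \<tau>
    by (auto split: split_indicator)
  ultimately show ?thesis by (simp only:)
qed

lemma integrable_right_weight:
  assumes "0 < t"
  shows "integrable lborel (\<lambda>\<tau>. indicator {0<..<t} \<tau> * (\<alpha> * \<tau> powr (\<alpha> - 1)))"
  using has_bochner_integral_powr_exp[of \<alpha> 0 t] \<alpha> assms by (simp add: has_bochner_integral_iff)

lemma AE_op_time_pos_pair: "AE z in lborel \<Otimes>\<^sub>M P. 0 < op_time (fst z) (snd z)"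
proof -
  interpret Q: pair_sigma_finite lborel P ..
  show ?thesis
  proof (rule Q.AE_pair_measure)
    show "AE \<tau> in lborel. AE p in P. 0 < op_time (fst (\<tau>, p)) (snd (\<tau>, p))"
      using AE_lborel_singleton[of 0] by eventually_elim (simp add: AE_op_time_pos)
  qed measurable
qed

text \<open>Both sides are, as functions of \<open>x\<close>, mixtures of heat kernels over \<open>(\<tau>, p)\<close>. Their Fourier
  transforms agree: with \<open>l = |\<xi>|\<^sup>2\<^sup>\<beta>\<close>, the left one is the fractional integral of \<open>E\<^sub>\<alpha>(- l \<tau>\<^sup>\<alpha>)\<close>,
  and on the right the integral over \<open>\<tau>\<close> is elementary for each value of the stable variable.\<close>

lemma fractional_integral_Z_sub:
  fixes x :: "real ^ 'n"
  assumes x: "x \<noteq> 0" and t: "0 < t"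
  shows "(LINT \<tau>|lborel. indicator {0<..<t} \<tau> * (t - \<tau>) powr (\<alpha> - 1) * Z_sub x \<tau>)
       = Gamma \<alpha> * (LINT \<tau>|lborel. indicator {0<..<t} \<tau> * Y_sub x \<tau>)"
proof -
  interpret Q: pair_sigma_finite lborel P ..
  let ?w1 = "\<lambda>z :: real \<times> real \<times> real. indicator {0<..<t} (fst z) * (t - fst z) powr (\<alpha> - 1)"
  let ?w2 = "\<lambda>z :: real \<times> real \<times> real. indicator {0<..<t} (fst z) * (\<alpha> * fst z powr (\<alpha> - 1)) * fst (snd z) powr (- \<alpha>)"
  let ?u = "\<lambda>z. op_time (fst z) (snd z)"
  let ?h1 = "\<lambda>x :: real ^ 'n. LINT z|(lborel \<Otimes>\<^sub>M P). ?w1 z * heat x (?u z)"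
  let ?h2 = "\<lambda>x :: real ^ 'n. LINT z|(lborel \<Otimes>\<^sub>M P). (Gamma \<alpha> * ?w2 z) * heat x (?u z)"
  let ?m1 = "\<lambda>\<xi> :: real ^ 'n. LINT z|(lborel \<Otimes>\<^sub>M P). ?w1 z * exp (- ((norm \<xi>)\<^sup>2 * ?u z))"
  let ?m2 = "\<lambda>\<xi> :: real ^ 'n. LINT z|(lborel \<Otimes>\<^sub>M P). (Gamma \<alpha> * ?w2 z) * exp (- ((norm \<xi>)\<^sup>2 * ?u z))"
  have w1: "integrable (lborel \<Otimes>\<^sub>M P) ?w1"
    using integrable_lborel_P_product[OF integrable_left_weight[OF t], of "\<lambda>_. 1"] by (simp add: case_prod_beta')
  have w2: "integrable (lborel \<Otimes>\<^sub>M P) (\<lambda>z. Gamma \<alpha> * ?w2 z)"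
    using integrable_lborel_P_product[OF integrable_right_weight[OF t] integrable_weight]
    by (intro integrable_mult_right) (simp add: case_prod_beta')
  have u: "?u \<in> borel_measurable (lborel \<Otimes>\<^sub>M P)" by measurable
  have fin: "sigma_finite_measure (lborel \<Otimes>\<^sub>M P)" by (rule Q.sigma_finite_measure_axioms)
  have sub: "integrable (lborel \<Otimes>\<^sub>M P) (\<lambda>z. w z * exp (- ((norm \<xi>)\<^sup>2 * ?u z)))"
    if w: "integrable (lborel \<Otimes>\<^sub>M P) w" for w and \<xi> :: "real ^ 'n"
  proof (rule Bochner_Integration.integrable_bound[OF w])
    note [measurable] = borel_measurable_integrable[OF w]
    show "(\<lambda>z. w z * exp (- ((norm \<xi>)\<^sup>2 * ?u z))) \<in> borel_measurable (lborel \<Otimes>\<^sub>M P)" by measurable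
    show "AE z in lborel \<Otimes>\<^sub>M P. norm (w z * exp (- ((norm \<xi>)\<^sup>2 * ?u z))) \<le> norm (w z)"
      using AE_op_time_pos_pair by eventually_elim (simp add: abs_mult mult_left_le)
  qed
  have m: "?m1 \<xi> = ?m2 \<xi>" for \<xi>
  proof -
    define l where "l = (norm \<xi>)\<^sup>2 powr \<beta>"
    have l: "0 \<le> l" by (simp add: l_def)
    have "?m1 \<xi> = (LINT \<tau>|lborel. LINT p|P. ?w1 (\<tau>, p) * exp (- ((norm \<xi>)\<^sup>2 * ?u (\<tau>, p))))"
      by (rule Q.integral_fst'[OF sub[OF w1], symmetric])
    also have "\<dots> = (LINT \<tau>|lborel. indicator {0<..<t} \<tau> * (t - \<tau>) powr (\<alpha> - 1) * Mittag_Leffler \<alpha> (- (l * \<tau> powr \<alpha>)))"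
    proof (rule Bochner_Integration.integral_cong[OF refl])
      fix \<tau> :: real
      show "(LINT p|P. ?w1 (\<tau>, p) * exp (- ((norm \<xi>)\<^sup>2 * ?u (\<tau>, p))))
          = indicator {0<..<t} \<tau> * (t - \<tau>) powr (\<alpha> - 1) * Mittag_Leffler \<alpha> (- (l * \<tau> powr \<alpha>))"
        using laplace_op_time_Mittag_Leffler[of "(norm \<xi>)\<^sup>2" \<tau>] by (cases "\<tau> \<in> {0<..<t}") (auto simp: l_def)
    qed
    also have "\<dots> = Gamma \<alpha> * (if l = 0 then t powr \<alpha> / Gamma (1 + \<alpha>) else (1 - Mittag_Leffler \<alpha> (- (l * t powr \<alpha>))) / l)"
      by (rule Mittag_Leffler_fractional_integral[OF \<alpha>(1) l t])
    finally have m1: "?m1 \<xi> = \<dots>" .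
    interpret R: pair_sigma_finite \<sigma> lborel ..
    let ?k = "\<lambda>s \<tau>. indicator {0<..<t} \<tau> * (\<alpha> * \<tau> powr (\<alpha> - 1)) * (s powr (- \<alpha>) * exp (- (l * \<tau> powr \<alpha> * s powr (- \<alpha>))))"
    have k: "has_bochner_integral lborel (?k s) (if l = 0 then t powr \<alpha> * s powr (- \<alpha>) else (1 - exp (- (l * t powr \<alpha> * s powr (- \<alpha>)))) / l)"
      if s: "s > 0" for s
    proof -
      have "has_bochner_integral lborel (\<lambda>\<tau>. s powr (- \<alpha>) * (indicator {0<..<t} \<tau> * (\<alpha> * \<tau> powr (\<alpha> - 1) * exp (- ((l * s powr (- \<alpha>)) * \<tau> powr \<alpha>)))))
         (s powr (- \<alpha>) * (if l * s powr (- \<alpha>) = 0 then t powr \<alpha> else (1 - exp (- ((l * s powr (- \<alpha>)) * t powr \<alpha>))) / (l * s powr (- \<alpha>))))"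
        using l t \<alpha> by (intro has_bochner_integral_mult_right has_bochner_integral_powr_exp) auto
      moreover have "s powr (- \<alpha>) * (if l * s powr (- \<alpha>) = 0 then t powr \<alpha> else (1 - exp (- ((l * s powr (- \<alpha>)) * t powr \<alpha>))) / (l * s powr (- \<alpha>)))
         = (if l = 0 then t powr \<alpha> * s powr (- \<alpha>) else (1 - exp (- (l * t powr \<alpha> * s powr (- \<alpha>)))) / l)"
        using s by (auto simp: mult_ac)
      moreover have "s powr (- \<alpha>) * (indicator {0<..<t} \<tau> * (\<alpha> * \<tau> powr (\<alpha> - 1) * exp (- ((l * s powr (- \<alpha>)) * \<tau> powr \<alpha>)))) = ?k s \<tau>" for \<tau>
        by (simp add: mult_ac)
      ultimately show ?thesis by (simp only:)
    qed
    have kint: "integrable (\<sigma> \<Otimes>\<^sub>M lborel) (\<lambda>(s, \<tau>). ?k s \<tau>)"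
    proof (rule R.Fubini_integrable)
      have "AE s in \<sigma>. (LINT \<tau>|lborel. norm (case (s, \<tau>) of (s, \<tau>) \<Rightarrow> ?k s \<tau>)) = (if l = 0 then t powr \<alpha> * s powr (- \<alpha>) else (1 - exp (- (l * t powr \<alpha> * s powr (- \<alpha>)))) / l)"
        using stable_lawD(3)[OF \<sigma>]
      proof eventually_elim
        case (elim s)
        have "norm (case (s, \<tau>) of (s, \<tau>) \<Rightarrow> ?k s \<tau>) = ?k s \<tau>" for \<tau> using \<alpha> by (auto simp: abs_mult)
        then show ?case using has_bochner_integral_integral_eq[OF k[OF elim]] by (simp only:)
      qed
      moreover have "integrable \<sigma> (\<lambda>s. if l = 0 then t powr \<alpha> * s powr (- \<alpha>) else (1 - exp (- (l * t powr \<alpha> * s powr (- \<alpha>)))) / l)"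
      proof (cases "l = 0")
        case True
        then show ?thesis using integrable_weight_sigma by simp
      next
        case False
        have "\<bar>(1 - exp (- (l * t powr \<alpha> * s powr (- \<alpha>)))) / l\<bar> \<le> 1 / l" for s
          using l by (simp add: abs_divide divide_right_mono)
        then show ?thesis
          using False by (intro \<sigma>.integrable_const_bound[where B = "1 / l"]) auto
      qed
      ultimately show "integrable \<sigma> (\<lambda>s. LINT \<tau>|lborel. norm (case (s, \<tau>) of (s, \<tau>) \<Rightarrow> ?k s \<tau>))"
        by (subst integrable_cong_AE) auto
      show "AE s in \<sigma>. integrable lborel (\<lambda>\<tau>. case (s, \<tau>) of (s, \<tau>) \<Rightarrow> ?k s \<tau>)"
        using stable_lawD(3)[OF \<sigma>] by eventually_elim (use k in \<open>auto simp: has_bochner_integral_iff\<close>)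
    qed measurable
    have "?m2 \<xi> = (LINT \<tau>|lborel. LINT p|P. (Gamma \<alpha> * ?w2 (\<tau>, p)) * exp (- ((norm \<xi>)\<^sup>2 * ?u (\<tau>, p))))"
      by (rule Q.integral_fst'[OF sub[OF w2], symmetric])
    also have "\<dots> = (LINT \<tau>|lborel. Gamma \<alpha> * (LINT s|\<sigma>. ?k s \<tau>))"
    proof (rule Bochner_Integration.integral_cong[OF refl])
      fix \<tau> :: real
      show "(LINT p|P. (Gamma \<alpha> * ?w2 (\<tau>, p)) * exp (- ((norm \<xi>)\<^sup>2 * ?u (\<tau>, p)))) = Gamma \<alpha> * (LINT s|\<sigma>. ?k s \<tau>)"
      proof (cases "\<tau> \<in> {0<..<t}")
        case True
        then show ?thesis
          using laplace_op_time[of "(norm \<xi>)\<^sup>2" \<tau>, OF _ _ integrable_weight_sigma]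
          by (simp add: l_def mult.assoc)
      qed simp
    qed
    also have "\<dots> = Gamma \<alpha> * (LINT s|\<sigma>. LINT \<tau>|lborel. ?k s \<tau>)"
      using R.Fubini_integral[OF kint] by simp
    also have "(LINT s|\<sigma>. LINT \<tau>|lborel. ?k s \<tau>) = (LINT s|\<sigma>. (if l = 0 then t powr \<alpha> * s powr (- \<alpha>) else (1 - exp (- (l * t powr \<alpha> * s powr (- \<alpha>)))) / l))"
    proof (rule integral_cong_AE)
      show "AE s in \<sigma>. (LINT \<tau>|lborel. ?k s \<tau>) = (if l = 0 then t powr \<alpha> * s powr (- \<alpha>) else (1 - exp (- (l * t powr \<alpha> * s powr (- \<alpha>)))) / l)"
        using stable_lawD(3)[OF \<sigma>] by eventually_elim (rule has_bochner_integral_integral_eq[OF k])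
    qed measurable
    also have "\<dots> = (if l = 0 then t powr \<alpha> / Gamma (1 + \<alpha>) else (1 - Mittag_Leffler \<alpha> (- (l * t powr \<alpha>))) / l)"
    proof (cases "l = 0")
      case True
      then show ?thesis by (simp add: weight_mean)
    next
      case False
      have "integrable \<sigma> (\<lambda>s. exp (- (l * t powr \<alpha> * s powr (- \<alpha>))))"
        using l by (intro \<sigma>.integrable_const_bound[where B = 1]) auto
      then have "(LINT s|\<sigma>. (1 - exp (- (l * t powr \<alpha> * s powr (- \<alpha>)))) / l) = (1 - Mittag_Leffler \<alpha> (- (l * t powr \<alpha>))) / l"
        using Mittag_Leffler_stable[OF \<sigma> \<alpha>(1), of "l * t powr \<alpha>"] l \<sigma>.prob_space by simp
      then show ?thesis using False by simp
    qed
    finally show ?thesis using m1 by simp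
  qed
  have "?h1 x = ?h2 x"
  proof (rule tempered_fourier_unique[OF _ _ _ _ x])
    show "continuous_on (- {0}) ?h1" by (rule continuous_on_heat_mixture[OF w1 u])
    show "continuous_on (- {0}) ?h2" by (rule continuous_on_heat_mixture[OF w2 u])
    show "has_tempered_fourier ?h1 ?m1"
      by (rule tempered_fourier_heat_mixture[OF fin w1 u AE_op_time_pos_pair])
    show "has_tempered_fourier ?h2 ?m1"
      unfolding m by (rule tempered_fourier_heat_mixture[OF fin w2 u AE_op_time_pos_pair])
  qed
  moreover have "?h1 x = (LINT \<tau>|lborel. LINT p|P. ?w1 (\<tau>, p) * heat x (?u (\<tau>, p)))"
    by (rule Q.integral_fst'[OF integrable_mult_heat[OF w1 u x], symmetric])
  moreover have "?h2 x = (LINT \<tau>|lborel. LINT p|P. (Gamma \<alpha> * ?w2 (\<tau>, p)) * heat x (?u (\<tau>, p)))"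
    by (rule Q.integral_fst'[OF integrable_mult_heat[OF w2 u x], symmetric])
  moreover have i1: "(LINT p|P. ?w1 (\<tau>, p) * heat x (?u (\<tau>, p))) = indicator {0<..<t} \<tau> * (t - \<tau>) powr (\<alpha> - 1) * Z_sub x \<tau>" for \<tau>
    by (simp add: Z_sub_def mult.assoc)
  moreover have i2: "(LINT p|P. (Gamma \<alpha> * ?w2 (\<tau>, p)) * heat x (?u (\<tau>, p))) = Gamma \<alpha> * (indicator {0<..<t} \<tau> * Y_sub x \<tau>)" for \<tau>
    by (simp add: Y_sub_def mult_ac flip: integral_mult_right_zero)
  ultimately show ?thesis
    by (simp only: i1 i2 integral_mult_right_zero)
qed

end

section \<open>Scaling, mass and regularity of the kernel Y\<close>

lemma heat_unit_scale:
  fixes x e :: "real ^ 'n"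
  assumes x: "x \<noteq> 0" and e: "norm e = 1"
  shows "heat x u = norm x powr (- real CARD('n)) * heat e (u / (norm x)\<^sup>2)"
proof -
  have "e \<noteq> 0" using e by auto
  then show ?thesis using heat_scale[OF x, of u] heat_scale[of e "u / (norm x)\<^sup>2"] e by simp
qed

context subordination
begin

lemma Y_sub_measurable [measurable]: "Y_sub x \<in> borel_measurable borel"
proof -
  have "(\<lambda>t. LINT p|P. Y_integrand x t p) \<in> borel_measurable borel"
    by measurable
  then show ?thesis by (simp add: Y_sub_def[abs_def])
qed

lemma Y_sub_nonneg: "0 \<le> Y_sub x t"
  unfolding Y_sub_def using \<alpha> by (intro Bochner_Integration.integral_nonneg) auto

lemma integrable_Y_sub_integrand:
  assumes "x \<noteq> 0"
  shows "integrable P (\<lambda>p. Y_integrand x t p)"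
  using assms integrable_weight by (intro integrable_mult_heat integrable_mult_right) auto

text \<open>The heat kernel depends on \<open>u / |x|\<^sup>2\<close> up to the factor \<open>|x|\<^sup>-\<^sup>N\<close>, and the operational time
  is homogeneous of degree \<open>\<alpha> / \<beta>\<close> in \<open>t\<close>.\<close>

lemma Y_sub_scale:
  fixes x e :: "real ^ 'n"
  assumes x: "x \<noteq> 0" and e: "norm e = 1" and t: "0 < t"
  defines "L \<equiv> norm x powr (2 * \<beta> / \<alpha>)"
  shows "Y_sub x t = norm x powr (- real CARD('n)) * L powr (\<alpha> - 1) * Y_sub e (t / L)"
proof -
  have L: "L > 0" using x by (simp add: L_def)
  have LL: "L powr (\<alpha> / \<beta>) = (norm x)\<^sup>2"
    using x \<alpha> \<beta> by (simp add: L_def powr_powr)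
  have op: "op_time t p / (norm x)\<^sup>2 = op_time (t / L) p" for p
  proof -
    have "(t / L / fst p) powr (\<alpha> / \<beta>) = (t / fst p) powr (\<alpha> / \<beta>) / (norm x)\<^sup>2"
    proof -
      have "t / L / fst p = (t / fst p) / L" by simp
      then show ?thesis by (simp only: powr_divide LL)
    qed
    then show ?thesis by (simp add: op_time_def)
  qed
  have pw: "t powr (\<alpha> - 1) = L powr (\<alpha> - 1) * (t / L) powr (\<alpha> - 1)"
    using L t by (simp flip: powr_mult)
  have "Y_integrand x t p
      = norm x powr (- real CARD('n)) * L powr (\<alpha> - 1) * (Y_integrand e (t / L) p)" for p
    unfolding heat_unit_scale[OF x e] op pw by (simp only: mult_ac)
  then show ?thesis
    unfolding Y_sub_def by (simp only: integral_mult_right_zero)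
qed

text \<open>For fixed values of the stable variables the integrand is a generalized Gamma density in \<open>t\<close>
  with the negative exponent \<open>a = - \<alpha> / \<beta>\<close>.\<close>

lemma Y_sub_integrand_eq:
  fixes e :: "real ^ 'n"
  assumes e: "norm e = 1" and s: "0 < s" and v: "0 < v" and t: "0 < t"
  defines "A \<equiv> s powr (\<alpha> / \<beta>) / (4 * v)" and "a \<equiv> - \<alpha> / \<beta>" and "q \<equiv> real CARD('n) / 2 - \<beta>"
  shows "(\<alpha> * t powr (\<alpha> - 1) * s powr (- \<alpha>)) * heat e (op_time t (s, v))
    = (\<alpha> * s powr (- \<alpha>) * pi powr (- real CARD('n) / 2) * A powr (real CARD('n) / 2)) * (t powr (a * q - 1) * exp (- (A * t powr a)))"
proof -
  let ?n = "real CARD('n) / 2"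
  have A: "A > 0" using s v by (simp add: A_def)
  have op: "op_time t (s, v) = t powr (\<alpha> / \<beta>) / (4 * A)"
    using s v by (simp add: op_time_def A_def powr_divide)
  have op_pos: "op_time t (s, v) > 0" unfolding op using A t by simp
  have "1 / (4 * op_time t (s, v)) = A / t powr (\<alpha> / \<beta>)"
    unfolding op using A by simp
  also have "\<dots> = A * t powr a"
    by (simp add: a_def powr_minus divide_inverse)
  finally have e1: "1 / (4 * op_time t (s, v)) = A * t powr a" .
  have "4 * pi * op_time t (s, v) = pi * (t powr (\<alpha> / \<beta>) / A)"
    unfolding op by simp
  then have "(4 * pi * op_time t (s, v)) powr (- ?n) = pi powr (- ?n) * ((t powr (\<alpha> / \<beta>)) powr (- ?n) / A powr (- ?n))"
    by (simp only: powr_mult powr_divide)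
  also have "(t powr (\<alpha> / \<beta>)) powr (- ?n) = t powr (a * ?n)"
    by (simp add: powr_powr a_def)
  also have "t powr (a * ?n) / A powr (- ?n) = A powr ?n * t powr (a * ?n)"
    by (simp only: powr_minus divide_inverse inverse_inverse_eq mult.commute)
  finally have e2: "(4 * pi * op_time t (s, v)) powr (- real CARD('n) / 2) = pi powr (- real CARD('n) / 2) * (A powr ?n * t powr (a * ?n))"
    by simp
  have "a * q - 1 = (\<alpha> - 1) + a * ?n"
    using \<beta> by (simp add: a_def q_def field_simps)
  then have e3: "t powr (a * q - 1) = t powr (\<alpha> - 1) * t powr (a * ?n)"
    by (simp only: powr_add)
  have "heat e (op_time t (s, v)) = pi powr (- real CARD('n) / 2) * (A powr ?n * t powr (a * ?n)) * exp (- (A * t powr a))"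
    using op_pos e by (simp only: heat_def e2 e1 one_power2 if_True)
  then show ?thesis unfolding e3 by (simp only: mult_ac)
qed

text \<open>Integrating in \<open>t\<close> first, the stable variable of index \<open>\<alpha>\<close> cancels, and what remains is the
  moment of order \<open>- \<beta>\<close> of the other one. The constant is the value on the unit sphere of the
  Green function \<open>c E\<close> of \<open>(- \<Delta>)\<^sup>\<beta>\<close>.\<close>

lemma nn_integral_Y_sub_unit:
  fixes e :: "real ^ 'n"
  assumes e: "norm e = 1" and N: "2 * \<beta> < real CARD('n)"
  shows "(\<integral>\<^sup>+t. ennreal (indicator {0<..} t * Y_sub e t) \<partial>lborel) = ennreal (c_const (real CARD('n)) \<beta>)"
proof -
  interpret Q: pair_sigma_finite P lborel ..
  let ?n = "real CARD('n) / 2"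
  let ?F = "\<lambda>t p. Y_integrand e t p"
  have e0: "e \<noteq> 0" using e by auto
  define q where "q = ?n - \<beta>"
  have q: "q > 0" using N by (simp add: q_def)
  define c where "c = \<beta> * pi powr (- ?n) * Gamma q * 4 powr (- \<beta>)"
  have "Gamma q > 0" using q by (rule Gamma_real_pos)
  then have c: "c \<ge> 0" using \<beta> by (simp add: c_def)
  have "(\<integral>\<^sup>+t. ennreal (indicator {0<..} t * Y_sub e t) \<partial>lborel) = (\<integral>\<^sup>+t. (\<integral>\<^sup>+p. ennreal (indicator {0<..} t * ?F t p) \<partial>P) \<partial>lborel)"
  proof (rule nn_integral_cong)
    fix t :: real
    have "(\<integral>\<^sup>+p. ennreal (indicator {0<..} t * ?F t p) \<partial>P) = ennreal (LINT p|P. indicator {0<..} t * ?F t p)"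
      using integrable_Y_sub_integrand[OF e0, of t] \<alpha>
      by (intro nn_integral_eq_integral) auto
    then show "ennreal (indicator {0<..} t * Y_sub e t) = (\<integral>\<^sup>+p. ennreal (indicator {0<..} t * ?F t p) \<partial>P)"
      by (simp add: Y_sub_def)
  qed
  also have "\<dots> = (\<integral>\<^sup>+p. (\<integral>\<^sup>+t. ennreal (indicator {0<..} t * ?F t p) \<partial>lborel) \<partial>P)"
    by (rule Q.Fubini') measurable
  also have "\<dots> = (\<integral>\<^sup>+p. ennreal (c * snd p powr (- \<beta>)) \<partial>P)"
  proof (rule nn_integral_cong_AE)
    show "AE p in P. (\<integral>\<^sup>+t. ennreal (indicator {0<..} t * ?F t p) \<partial>lborel) = ennreal (c * snd p powr (- \<beta>))"
      using AE_P_pos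
    proof eventually_elim
      case (elim p)
      obtain s v where p: "p = (s, v)" by (cases p)
      have s: "s > 0" and v: "v > 0" using elim by (auto simp: p)
      define A where "A = s powr (\<alpha> / \<beta>) / (4 * v)"
      define a where "a = - \<alpha> / \<beta>"
      define C where "C = \<alpha> * s powr (- \<alpha>) * pi powr (- real CARD('n) / 2) * A powr ?n"
      have A: "A > 0" using s v by (simp add: A_def)
      have a: "a \<noteq> 0" "\<bar>a\<bar> = \<alpha> / \<beta>" using \<alpha> \<beta> by (auto simp: a_def abs_divide)
      have C: "C \<ge> 0" using \<alpha> by (simp add: C_def)
      have "(\<integral>\<^sup>+t. ennreal (indicator {0<..} t * ?F t p) \<partial>lborel)
          = (\<integral>\<^sup>+t. ennreal C * ennreal (indicator {0<..} t * (t powr (a * q - 1) * exp (- (A * t powr a)))) \<partial>lborel)"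
      proof (rule nn_integral_cong)
        fix t :: real
        show "ennreal (indicator {0<..} t * ?F t p) = ennreal C * ennreal (indicator {0<..} t * (t powr (a * q - 1) * exp (- (A * t powr a))))"
        proof (cases "t > 0")
          case True
          have "?F t p = C * (t powr (a * q - 1) * exp (- (A * t powr a)))"
            using Y_sub_integrand_eq[OF e s v True] by (simp only: p fst_conv C_def A_def a_def q_def)
          then show ?thesis using True C by (simp only:) (simp add: ennreal_mult')
        qed simp
      qed
      also have "\<dots> = ennreal C * ennreal (Gamma q * A powr (- q) / \<bar>a\<bar>)"
        by (subst nn_integral_cmult, measurable) (simp only: nn_integral_gamma_powr[OF a(1) q A])
      also have "\<dots> = ennreal (C * (Gamma q * A powr (- q) / \<bar>a\<bar>))"
        by (rule ennreal_mult'[OF C, symmetric])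
      also have "C * (Gamma q * A powr (- q) / \<bar>a\<bar>) = c * v powr (- \<beta>)"
      proof -
        have "A powr ?n * A powr (- q) = A powr \<beta>"
          by (simp add: q_def flip: powr_add)
        also have "A powr \<beta> = s powr \<alpha> / (4 * v) powr \<beta>"
          unfolding A_def using \<beta> by (simp add: powr_divide powr_powr)
        also have "\<dots> = s powr \<alpha> * (4 powr (- \<beta>) * v powr (- \<beta>))"
          by (simp add: powr_mult powr_minus divide_inverse)
        finally have "s powr (- \<alpha>) * (A powr ?n * A powr (- q)) = 4 powr (- \<beta>) * v powr (- \<beta>)"
          using s by (simp add: powr_minus)
        moreover have "C * (Gamma q * A powr (- q) / \<bar>a\<bar>)
            = \<beta> * pi powr (- ?n) * Gamma q * (s powr (- \<alpha>) * (A powr ?n * A powr (- q)))"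
          unfolding a(2) C_def using \<alpha> \<beta> by simp
        ultimately show ?thesis by (simp add: c_def)
      qed
      finally show ?case by (simp add: p)
    qed
  qed
  also have "\<dots> = (\<integral>\<^sup>+x. \<integral>\<^sup>+y. ennreal (c * snd (x, y) powr (- \<beta>)) \<partial>\<nu> \<partial>\<sigma>)"
    by (rule \<nu>.nn_integral_fst[symmetric]) measurable
  also have "\<dots> = (\<integral>\<^sup>+y. ennreal c * ennreal (y powr (- \<beta>)) \<partial>\<nu>)"
    using c by (simp add: \<sigma>.emeasure_space_1 ennreal_mult)
  also have "\<dots> = ennreal c * ennreal (Gamma (1 + \<beta> / \<beta>) / Gamma (1 + \<beta>))"
    using stable_negative_moment[OF \<nu>, of \<beta>] \<beta> by (subst nn_integral_cmult) auto
  also have "Gamma (1 + \<beta> / \<beta>) / Gamma (1 + \<beta>) = 1 / Gamma (1 + \<beta>)"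
    using \<beta> Gamma_fact[of 1, where 'a = real] by simp
  also have "ennreal c * ennreal (1 / Gamma (1 + \<beta>)) = ennreal (c * (1 / Gamma (1 + \<beta>)))"
    by (rule ennreal_mult'[OF c, symmetric])
  also have "c * (1 / Gamma (1 + \<beta>)) = c_const (real CARD('n)) \<beta>"
  proof -
    have "\<beta> \<notin> \<int>\<^sub>\<le>\<^sub>0" using \<beta> nonpos_Ints_nonpos[of \<beta>] by auto
    then have g1: "Gamma (1 + \<beta>) = \<beta> * Gamma \<beta>" using Gamma_plus1[of \<beta>] by (simp add: add.commute)
    have "(2::real) powr (2 * \<beta>) = (2 powr 2) powr \<beta>" by (rule powr_powr[symmetric])
    then have f4: "(4::real) powr (- \<beta>) = inverse (2 powr (2 * \<beta>))"
      by (simp add: powr_minus)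
    have qeq: "q = (real CARD('n) - 2 * \<beta>) / 2" by (simp add: q_def diff_divide_distrib)
    have pn: "pi powr (- ?n) = inverse (pi powr ?n)" by (rule powr_minus)
    have gen: "(\<beta> * inverse u * G * inverse w) * (1 / (\<beta> * h)) = G / (u * w * h)" for u G w h :: real
      using \<beta> by (simp add: divide_inverse)
    show ?thesis
      unfolding c_def g1 f4 pn gen c_const_def qeq ..
  qed
  finally show ?thesis .
qed

text \<open>For each value of the stable variables the integrand is a power of \<open>t\<close> times \<open>exp (- A t\<^sup>a)\<close>
  with \<open>a < 0\<close>, which is increasing; the power changes by at most a constant factor over \<open>[t, 2
  t]\<close>.\<close>

lemma Y_sub_doubling:
  fixes e :: "real ^ 'n"
  assumes e: "norm e = 1"
  shows "\<exists>K>0. \<forall>t t'. 0 < t \<longrightarrow> t \<le> t' \<longrightarrow> t' \<le> 2 * t \<longrightarrow> Y_sub e t \<le> K * Y_sub e t'"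
proof -
  define a where "a = - \<alpha> / \<beta>"
  define q where "q = real CARD('n) / 2 - \<beta>"
  define r where "r = a * q - 1"
  \<comment> \<open>The two cases are the signs of \<open>r\<close>: over \<open>[t, 2 t]\<close> a decreasing power drops at most by the
    factor \<open>2\<^sup>r\<close>, and an increasing one does not drop.\<close>
  let ?K = "max 1 (2 powr (- r))"
  have e0: "e \<noteq> 0" using e by auto
  have a: "a < 0" using \<alpha> \<beta> by (simp add: a_def)
  have "Y_sub e t \<le> ?K * Y_sub e t'" if t: "0 < t" "t \<le> t'" "t' \<le> 2 * t" for t t'
  proof -
    have t': "t' > 0" using t by simp
    have r: "t powr r \<le> ?K * t' powr r"
    proof (cases "r \<le> 0")
      case True
      have "2 powr r * t powr r = (2 * t) powr r" by (simp add: powr_mult)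
      also have "\<dots> \<le> t' powr r" using True t t' by (intro powr_mono2') auto
      finally have "2 powr (- r) * (2 powr r * t powr r) \<le> 2 powr (- r) * t' powr r"
        by (intro mult_left_mono) auto
      then have "t powr r \<le> 2 powr (- r) * t' powr r"
        by (simp add: mult.assoc[symmetric] flip: powr_add)
      also have "\<dots> \<le> ?K * t' powr r" by (intro mult_right_mono) auto
      finally show ?thesis .
    next
      case False
      have "t powr r \<le> 1 * t' powr r" using False t by (simp add: powr_mono2)
      also have "\<dots> \<le> ?K * t' powr r" by (intro mult_right_mono) auto
      finally show ?thesis .
    qed
    have "Y_sub e t \<le> (LINT p|P. ?K * (Y_integrand e t' p))"
      unfolding Y_sub_def
    proof (rule integral_mono_AE)
      show "AE p in P. Y_integrand e t p
          \<le> ?K * (Y_integrand e t' p)"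
        using AE_P_pos
      proof eventually_elim
        case (elim p)
        obtain s v where p: "p = (s, v)" by (cases p)
        have s: "s > 0" and v: "v > 0" using elim by (auto simp: p)
        define A where "A = s powr (\<alpha> / \<beta>) / (4 * v)"
        define C where "C = \<alpha> * s powr (- \<alpha>) * pi powr (- real CARD('n) / 2) * A powr (real CARD('n) / 2)"
        have A: "A > 0" using s v by (simp add: A_def)
        have C: "C \<ge> 0" using \<alpha> by (simp add: C_def)
        have "A * t' powr a \<le> A * t powr a"
          using A t a by (intro mult_left_mono powr_mono2') auto
        then have "t powr r * exp (- (A * t powr a)) \<le> (?K * t' powr r) * exp (- (A * t' powr a))"
          using r by (intro mult_mono) auto
        then have "C * (t powr r * exp (- (A * t powr a))) \<le> C * ((?K * t' powr r) * exp (- (A * t' powr a)))"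
          using C by (rule mult_left_mono)
        also have "\<dots> = ?K * (C * (t' powr r * exp (- (A * t' powr a))))"
          by (simp only: mult_ac)
        finally show ?case
          using Y_sub_integrand_eq[OF e s v t(1)] Y_sub_integrand_eq[OF e s v t']
          by (simp only: p fst_conv C_def A_def a_def q_def r_def)
      qed
    qed (intro integrable_mult_right integrable_Y_sub_integrand[OF e0])+
    then show ?thesis by (simp only: integral_mult_right_zero Y_sub_def)
  qed
  then show ?thesis by (intro exI[of _ ?K]) auto
qed

lemma isCont_heat_time:
  assumes "0 < u"
  shows "isCont (heat x) u"
proof -
  have "isCont (\<lambda>u. (4 * pi * u) powr (- real CARD('a) / 2) * exp (- ((norm x)\<^sup>2 / (4 * u)))) u"
    using assms by (intro continuous_intros) auto
  moreover have "\<forall>\<^sub>F u in nhds u. heat x u = (4 * pi * u) powr (- real CARD('a) / 2) * exp (- ((norm x)\<^sup>2 / (4 * u)))"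
    using eventually_nhds_in_open[of "{0<..}" u] assms by (auto elim!: eventually_mono simp: heat_def)
  ultimately show ?thesis by (simp only: isCont_cong)
qed

lemma continuous_on_Y_sub:
  fixes x :: "real ^ 'n"
  assumes x: "x \<noteq> 0" and c: "0 < c"
  shows "continuous_on {c..b} (Y_sub x)"
  unfolding continuous_on_sequentially
proof (intro allI impI ballI, elim conjE)
  fix T and t assume t: "t \<in> {c..b}" and T: "\<forall>n. T n \<in> {c..b}" "T \<longlonglongrightarrow> t"
  obtain B where B: "\<And>(y :: real ^ 'n) u. norm x \<le> norm y \<Longrightarrow> heat y u \<le> B"
    using heat_bounded[of "norm x", where 'n = 'n] x by auto
  have t0: "t > 0" using t c by simp
  show "(Y_sub x \<circ> T) \<longlonglongrightarrow> Y_sub x t"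
    unfolding o_def Y_sub_def
  proof (rule integral_dominated_convergence[where w = "\<lambda>p. (\<alpha> * c powr (\<alpha> - 1) * fst p powr (- \<alpha>)) * B"])
    show "integrable P (\<lambda>p. (\<alpha> * c powr (\<alpha> - 1) * fst p powr (- \<alpha>)) * B)"
      using integrable_weight by (intro integrable_mult_left integrable_mult_right)
    show "AE p in P. (\<lambda>n. Y_integrand x (T n) p)
        \<longlonglongrightarrow> Y_integrand x t p"
      using AE_P_pos
    proof eventually_elim
      case (elim p)
      have op: "0 < op_time t p" using elim t0 by (simp add: op_time_def)
      have "(\<lambda>n. op_time (T n) p) \<longlonglongrightarrow> op_time t p"
        unfolding op_time_def using elim t0 T(2) by (intro tendsto_intros) auto
      then have "(\<lambda>n. heat x (op_time (T n) p)) \<longlonglongrightarrow> heat x (op_time t p)"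
        by (intro isCont_tendsto_compose[OF isCont_heat_time] op)
      then show ?case using T(2) t0 by (intro tendsto_intros) auto
    qed
    show "AE p in P. norm (Y_integrand x (T n) p)
        \<le> (\<alpha> * c powr (\<alpha> - 1) * fst p powr (- \<alpha>)) * B" for n
    proof (rule AE_I2)
      fix p
      have "T n powr (\<alpha> - 1) \<le> c powr (\<alpha> - 1)"
        using T(1) c \<alpha> by (intro powr_mono2') auto
      then have "Y_integrand x (T n) p \<le> (\<alpha> * c powr (\<alpha> - 1) * fst p powr (- \<alpha>)) * B"
        using \<alpha> B[of x] by (intro mult_mono mult_right_mono mult_left_mono) auto
      then show "norm (Y_integrand x (T n) p)
        \<le> (\<alpha> * c powr (\<alpha> - 1) * fst p powr (- \<alpha>)) * B"
        using \<alpha> by simp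
    qed
  qed measurable
qed

lemma integrable_Y_sub_unit:
  fixes e :: "real ^ 'n"
  assumes e: "norm e = 1" and N: "2 * \<beta> < real CARD('n)"
  shows "integrable lborel (\<lambda>t. indicator {0<..} t * Y_sub e t)"
    and "(LINT t|lborel. indicator {0<..} t * Y_sub e t) = c_const (real CARD('n)) \<beta>"
proof -
  have c: "0 \<le> c_const (real CARD('n)) \<beta>"
    using N \<beta> unfolding c_const_def by (intro divide_nonneg_nonneg mult_nonneg_nonneg less_imp_le[OF Gamma_real_pos]) auto
  have "has_bochner_integral lborel (\<lambda>t. indicator {0<..} t * Y_sub e t) (c_const (real CARD('n)) \<beta>)"
    using nn_integral_Y_sub_unit[OF assms] c
    by (intro has_bochner_integral_nn_integral AE_I2 mult_nonneg_nonneg Y_sub_nonneg) auto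
  then show "integrable lborel (\<lambda>t. indicator {0<..} t * Y_sub e t)"
    and "(LINT t|lborel. indicator {0<..} t * Y_sub e t) = c_const (real CARD('n)) \<beta>"
    by (auto simp: has_bochner_integral_iff)
qed

lemma integrable_Y_sub:
  fixes x :: "real ^ 'n"
  assumes x: "x \<noteq> 0" and N: "2 * \<beta> < real CARD('n)"
  shows "integrable lborel (\<lambda>t. indicator {0<..} t * Y_sub x t)"
proof -
  obtain e :: "real ^ 'n" where e: "norm e = 1" using vector_choose_size[of 1] by auto
  define L where "L = norm x powr (2 * \<beta> / \<alpha>)"
  have L: "L > 0" using x by (simp add: L_def)
  have "integrable lborel (\<lambda>t. norm x powr (- real CARD('n)) * L powr (\<alpha> - 1) * (indicator {0<..} (0 + 1 / L * t) * Y_sub e (0 + 1 / L * t)))"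
    using L by (intro integrable_mult_right lborel_integrable_real_affine integrable_Y_sub_unit[OF e N]) auto
  moreover have "norm x powr (- real CARD('n)) * L powr (\<alpha> - 1) * (indicator {0<..} (0 + 1 / L * t) * Y_sub e (0 + 1 / L * t))
      = indicator {0<..} t * Y_sub x t" for t
  proof (cases "t > 0")
    case True
    then have "0 + 1 / L * t \<in> {0<..}" using L by simp
    with True Y_sub_scale[OF x e True] show ?thesis by (simp add: L_def)
  next
    case False
    then have "0 + 1 / L * t \<notin> {0<..}" using L by (simp add: zero_less_divide_iff)
    with False show ?thesis by simp
  qed
  ultimately show ?thesis by (simp only:)
qed

text \<open>The fractional integral of \<open>Z\<close> is the indefinite integral of a continuous function, so its
  derivative exists in the classical sense.\<close>

lemma Y_kernel_eq:
  fixes x :: "real ^ 'n"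
  assumes x: "x \<noteq> 0" and t: "0 < t" and N: "2 * \<beta> < real CARD('n)"
  shows "Y_kernel \<alpha> \<beta> x t = Y_sub x t"
proof -
  have G: "Gamma \<alpha> > 0" using \<alpha> by (intro Gamma_real_pos)
  let ?J = "\<lambda>t. LINT \<tau>:{0<..<t}|lebesgue. Z_kernel \<alpha> \<beta> x \<tau> * (t - \<tau>) powr (\<alpha> - 1)"
  let ?F = "\<lambda>t. LINT \<tau>|lborel. indicator {0<..<t} \<tau> * Y_sub x \<tau>"
  have [measurable]: "Z_sub x \<in> borel_measurable borel"
  proof -
    have "(\<lambda>t. LINT p|P. 1 * heat x (op_time t p)) \<in> borel_measurable borel" by measurable
    then show ?thesis by (simp add: Z_sub_def[abs_def])
  qed
  have J: "?J u = Gamma \<alpha> * ?F u" if u: "u > 0" for u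
  proof -
    have "?J u = (LINT \<tau>|lebesgue. indicator {0<..<u} \<tau> * (u - \<tau>) powr (\<alpha> - 1) * Z_sub x \<tau>)"
      unfolding set_lebesgue_integral_def
      by (intro Bochner_Integration.integral_cong) (auto simp: Z_kernel_eq[OF x] split: split_indicator)
    also have "\<dots> = (LINT \<tau>|lborel. indicator {0<..<u} \<tau> * (u - \<tau>) powr (\<alpha> - 1) * Z_sub x \<tau>)"
      by (rule integrable_lebesgue_iff_lborel) measurable
    finally show ?thesis using fractional_integral_Z_sub[OF x u] by simp
  qed
  \<comment> \<open>The kernel may be singular at time \<open>0\<close>; the fundamental theorem is applied on \<open>[t / 2, 2 t]\<close>,
    and the integral up to \<open>t / 2\<close> is a constant.\<close>
  define c where "c = t / 2"
  have c: "0 < c" "c < t" using t by (auto simp: c_def)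
  have int: "integrable lborel (\<lambda>\<tau>. indicator A \<tau> * Y_sub x \<tau>)" if "A \<subseteq> {0<..}" "A \<in> sets borel" for A
  proof -
    have "integrable lborel (\<lambda>\<tau>. indicator A \<tau> * (indicator {0<..} \<tau> * Y_sub x \<tau>))"
      using integrable_real_mult_indicator[OF _ integrable_Y_sub[OF x N], of A] that by (simp add: mult.commute)
    moreover have "indicator A \<tau> * (indicator {0<..} \<tau> * Y_sub x \<tau>) = indicator A \<tau> * Y_sub x \<tau>" for \<tau>
      using that by (auto split: split_indicator)
    ultimately show ?thesis by (simp only:)
  qed
  have F: "?F u = ?F c + (LBINT y=c..u. Y_sub x y)" if u: "c < u" for u
  proof -
    have "?F u = (LINT \<tau>|lborel. indicator {0<..<c} \<tau> * Y_sub x \<tau> + indicator {c<..<u} \<tau> * Y_sub x \<tau>)"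
    proof (rule integral_cong_AE)
      show "AE \<tau> in lborel. indicator {0<..<u} \<tau> * Y_sub x \<tau> = indicator {0<..<c} \<tau> * Y_sub x \<tau> + indicator {c<..<u} \<tau> * Y_sub x \<tau>"
        using AE_lborel_singleton[of c] by eventually_elim (use u c in \<open>auto split: split_indicator\<close>)
    qed measurable
    also have "\<dots> = ?F c + (LINT \<tau>|lborel. indicator {c<..<u} \<tau> * Y_sub x \<tau>)"
      using c by (intro Bochner_Integration.integral_add int) auto
    also have "(LINT \<tau>|lborel. indicator {c<..<u} \<tau> * Y_sub x \<tau>) = (LBINT y=c..u. Y_sub x y)"
      using u by (simp add: interval_lebesgue_integral_def set_lebesgue_integral_def)
    finally show ?thesis .
  qed
  have "((\<lambda>u. LBINT y=c..u. Y_sub x y) has_vector_derivative Y_sub x t) (at t within {c..2 * t})"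
    using c continuous_on_Y_sub[OF x c(1)] by (intro interval_integral_FTC2) auto
  then have "((\<lambda>u. LBINT y=c..u. Y_sub x y) has_real_derivative Y_sub x t) (at t)"
    using c by (subst (asm) at_within_Icc_at) (auto simp: has_real_derivative_iff_has_vector_derivative)
  then have "((\<lambda>u. Gamma \<alpha> * (?F c + (LBINT y=c..u. Y_sub x y))) has_real_derivative Gamma \<alpha> * Y_sub x t) (at t)"
    by (auto intro!: derivative_eq_intros)
  moreover have "\<forall>\<^sub>F u in nhds t. Gamma \<alpha> * (?F c + (LBINT y=c..u. Y_sub x y)) = ?J u"
    using eventually_nhds_in_open[of "{c<..}" t] c by (auto elim!: eventually_mono simp: J F)
  ultimately have "(?J has_real_derivative Gamma \<alpha> * Y_sub x t) (at t)"
    by (subst (asm) DERIV_cong_ev[OF refl _ refl]) auto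
  then show ?thesis
    unfolding Y_kernel_def using G by (simp add: DERIV_imp_deriv)
qed

end

section \<open>Mass functions and convolution against a concentrating kernel\<close>

text \<open>Finiteness of the norm carries measurability, because of the value \<open>\<infinity>\<close> in the definition.\<close>

lemma Lp_norm_1_finite:
  assumes fin: "Lp_norm 1 M h < \<infinity>"
  shows "integrable M h" and "ennreal \<bar>LINT x|M. h x\<bar> \<le> Lp_norm 1 M h"
proof -
  have m [measurable]: "h \<in> borel_measurable M"
    using fin by (auto simp: Lp_norm_def split: if_splits)
  define I where "I = (\<integral>\<^sup>+ x. ennreal \<bar>h x\<bar> \<partial>M)"
  have Lp: "Lp_norm 1 M h = (if I = \<infinity> then \<infinity> else ennreal (enn2real I powr (1 / enn2real 1)))"
    using m by (simp add: Lp_norm_def I_def Let_def)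
  then have I: "I < \<infinity>"
    using fin by (auto simp: less_top split: if_splits)
  then show int: "integrable M h"
    unfolding I_def by (simp add: integrable_iff_bounded)
  have "Lp_norm 1 M h = ennreal (enn2real I)"
    using I by (auto simp: Lp)
  also have "\<dots> = I" using I by (simp add: less_top)
  also have "\<dots> = ennreal (LINT x|M. \<bar>h x\<bar>)"
    unfolding I_def using int by (intro nn_integral_eq_integral) auto
  finally show "ennreal \<bar>LINT x|M. h x\<bar> \<le> Lp_norm 1 M h"
    by (simp add: ennreal_leI integral_abs_bound)
qed

text \<open>Lebesgue measure on the product is only the completion of the product measure, so Fubini's
  measurability statement is applied to a Borel function that agrees with \<open>f\<close> almost everywhere.\<close>

lemma borel_measurable_partial_integral:
  fixes f :: "real ^ 'n \<Rightarrow> real \<Rightarrow> real"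
  assumes f: "(\<lambda>(x, t). f x t) \<in> borel_measurable (lebesgue_on (UNIV \<times> {0<..}))"
    and ft: "\<And>t. 0 < t \<Longrightarrow> (\<lambda>x. f x t) \<in> borel_measurable lebesgue"
  shows "(\<lambda>t. indicator {0<..} t * (LINT x|lebesgue. f x t)) \<in> borel_measurable lebesgue"
proof -
  let ?S = "UNIV \<times> {0<..} :: ((real ^ 'n) \<times> real) set"
  define F where "F z = (if z \<in> ?S then (case z of (x, t) \<Rightarrow> f x t) else 0)" for z
  have "open ?S" by (intro open_Times) auto
  then have S: "?S \<in> sets lebesgue" by (intro sets_completionI_sets) auto
  have "F \<in> borel_measurable lebesgue"
    using f borel_measurable_if[OF S, of "\<lambda>(x, t). f x t"] by (simp only: F_def[abs_def])
  then obtain G where G: "G \<in> borel_measurable lborel" "AE z in lborel. F z = G z"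
    using completion_ex_borel_measurable_real by blast
  from G(2) obtain N where N: "N \<in> null_sets lborel" "{z. F z \<noteq> G z} \<subseteq> N"
    by (auto simp: eventually_ae_filter)
  have [measurable]: "G \<in> borel_measurable (borel \<Otimes>\<^sub>M borel)"
    using G(1) by (simp add: borel_prod)
  have [measurable]: "N \<in> sets (borel \<Otimes>\<^sub>M borel)"
    using N(1) unfolding borel_prod by auto
  have "AE z in lborel \<Otimes>\<^sub>M lborel. z \<notin> N"
    using AE_not_in[OF N(1)] unfolding lborel_prod .
  then have "AE x in lborel. AE t in lborel. (x, t) \<notin> N"
    by (rule lborel_pair.AE_pair)
  moreover have "{z \<in> space (lborel \<Otimes>\<^sub>M lborel). (fst z, snd z) \<notin> N} \<in> sets (lborel \<Otimes>\<^sub>M lborel)"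
    by measurable
  ultimately have "AE t in lborel. AE x in lborel. (x, t) \<notin> N"
    using lborel_pair.AE_commute[of "\<lambda>x t. (x, t) \<notin> N"] by simp
  then have ae: "AE t in lborel. (LINT x|lborel. G (x, t)) * indicator {0<..} t = indicator {0<..} t * (LINT x|lebesgue. f x t)"
  proof eventually_elim
    case (elim t)
    show ?case
    proof (cases "t > 0")
      case True
      have "(LINT x|lebesgue. f x t) = (LINT x|lebesgue. G (x, t))"
      proof (rule integral_cong_AE)
        show "AE x in lebesgue. f x t = G (x, t)"
          using AE_completion[OF elim]
        proof eventually_elim
          case (elim x)
          then have "F (x, t) = G (x, t)" using N(2) by blast
          then show ?case using True by (simp add: F_def)
        qed
        show "(\<lambda>x. G (x, t)) \<in> borel_measurable lebesgue"
          by (rule measurable_completion) measurable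
      qed (rule ft[OF True])
      also have "\<dots> = (LINT x|lborel. G (x, t))"
        by (rule integrable_lebesgue_iff_lborel) measurable
      finally show ?thesis by simp
    qed simp
  qed
  show ?thesis
  proof (rule borel_measurable_AE)
    show "(\<lambda>t. (LINT x|lborel. G (x, t)) * indicator {0<..} t) \<in> borel_measurable lebesgue"
      by (rule measurable_completion) measurable
    show "AE t in lebesgue. (LINT x|lborel. G (x, t)) * indicator {0<..} t = indicator {0<..} t * (LINT x|lebesgue. f x t)"
      using ae by (rule AE_completion)
  qed
qed

lemma has_bochner_integral_decay:
  fixes \<gamma> t :: real
  assumes "\<gamma> < 1" "0 \<le> t"
  shows "has_bochner_integral lborel (\<lambda>s. indicator {0..t} s * (1 + s) powr (- \<gamma>)) (((1 + t) powr (1 - \<gamma>) - 1) / (1 - \<gamma>))"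
proof -
  have "has_bochner_integral lborel (\<lambda>s. (1 + s) powr (- \<gamma>) * indicator {0..t} s)
      ((1 + t) powr (1 - \<gamma>) / (1 - \<gamma>) - (1 + 0) powr (1 - \<gamma>) / (1 - \<gamma>))"
  proof (rule has_bochner_integral_FTC_Icc_nonneg)
    fix s :: real assume "s \<in> {0..t}"
    then show "((\<lambda>s. (1 + s) powr (1 - \<gamma>) / (1 - \<gamma>)) has_real_derivative (1 + s) powr (- \<gamma>)) (at s)"
      using assms(1) by (auto intro!: derivative_eq_intros)
  qed (use assms in auto)
  then show ?thesis by (simp add: mult.commute diff_divide_distrib)
qed

lemma tail_integral_tendsto_0:
  fixes y :: "real \<Rightarrow> real"
  assumes int: "integrable lborel (\<lambda>r. indicator {0<..} r * y r)" and y: "y \<in> borel_measurable borel"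
  shows "((\<lambda>a. LINT r|lborel. indicator {a<..} r * (indicator {0<..} r * y r)) \<longlongrightarrow> 0) at_top"
proof -
  note [measurable] = y
  have "((\<lambda>a. LINT r|lborel. indicator {a<..} r * (indicator {0<..} r * y r)) \<longlongrightarrow> (LINT r :: real|lborel. 0)) at_top"
  proof (rule integral_dominated_convergence_at_top[where w = "\<lambda>r. \<bar>indicator {0<..} r * y r\<bar>"])
    show "integrable lborel (\<lambda>r. \<bar>indicator {0<..} r * y r\<bar>)" using int by (rule integrable_abs)
    show "\<forall>\<^sub>F a in at_top. AE r in lborel. norm (indicator {a<..} r * (indicator {0<..} r * y r)) \<le> \<bar>indicator {0<..} r * y r\<bar>"
      by (auto intro!: always_eventually split: split_indicator)
    show "AE r in lborel. ((\<lambda>a. indicator {a<..} r * (indicator {0<..} r * y r)) \<longlongrightarrow> 0) at_top"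
    proof (rule AE_I2)
      fix r :: real
      have "\<forall>\<^sub>F a in at_top. indicator {a<..} r * (indicator {0<..} r * y r) = 0"
        using eventually_ge_at_top[of r] by eventually_elim auto
      then show "((\<lambda>a. indicator {a<..} r * (indicator {0<..} r * y r)) \<longlongrightarrow> 0) at_top"
        by (rule tendsto_eventually)
    qed
  qed measurable
  then show ?thesis by simp
qed

text \<open>Average the doubling inequality over \<open>[r, 2 r]\<close>. As the tail tends to \<open>0\<close>, this says \<open>y(r) =
  o(1 / r)\<close>.\<close>

lemma doubling_pointwise_bound:
  fixes y :: "real \<Rightarrow> real"
  assumes y: "y \<in> borel_measurable borel" "\<And>r. 0 \<le> y r"
    and int: "integrable lborel (\<lambda>r. indicator {0<..} r * y r)"
    and K: "0 < K" "\<And>r r'. 0 < r \<Longrightarrow> r \<le> r' \<Longrightarrow> r' \<le> 2 * r \<Longrightarrow> y r \<le> K * y r'"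
    and r: "0 < r" "a < r"
  shows "r * y r \<le> K * (LINT r|lborel. indicator {a<..} r * (indicator {0<..} r * y r))"
proof -
  note [measurable] = y(1)
  have "r * y r = (LINT s|lborel. y r * indicator {r..2 * r} s)"
    using r by simp
  also have "\<dots> \<le> (LINT s|lborel. K * (indicator {a<..} s * (indicator {0<..} s * y s)))"
  proof (rule integral_mono)
    show "integrable lborel (\<lambda>s. y r * indicator {r..2 * r} s)"
      by (intro integrable_mult_right integrable_real_indicator) (auto simp: emeasure_lborel_Icc_eq)
    have "integrable lborel (\<lambda>s. indicator {a<..} s *\<^sub>R (indicator {0<..} s * y s))"
      by (rule integrable_mult_indicator[OF _ int]) simp
    then show "integrable lborel (\<lambda>s. K * (indicator {a<..} s * (indicator {0<..} s * y s)))"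
      by simp
    fix s
    show "y r * indicator {r..2 * r} s \<le> K * (indicator {a<..} s * (indicator {0<..} s * y s))"
      using K(2)[OF r(1), of s] r K(1) y(2) by (auto split: split_indicator)
  qed
  finally show ?thesis by simp
qed

lemma powr_ratio_close_to_1:
  fixes \<gamma> e :: real
  assumes e: "0 < e"
  shows "\<exists>\<eta> T. 0 < \<eta> \<and> \<eta> < 1 \<and> (\<forall>t s. T \<le> t \<longrightarrow> (1 - \<eta>) * t \<le> s \<longrightarrow> s \<le> t \<longrightarrow> \<bar>(t / (1 + s)) powr \<gamma> - 1\<bar> < e)"
proof -
  have "isCont (\<lambda>z::real. z powr \<gamma>) 1" by (intro continuous_intros) auto
  then obtain d0 where d0: "d0 > 0" "\<And>z::real. \<bar>z - 1\<bar> < d0 \<Longrightarrow> \<bar>z powr \<gamma> - 1\<bar> < e"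
    using e unfolding continuous_at_eps_delta dist_real_def by (metis powr_one_eq_one)
  define d where "d = min d0 1"
  have d: "0 < d" "d \<le> 1" "d \<le> d0" using d0(1) by (auto simp: d_def)
  \<comment> \<open>small enough that \<open>t \<le> (1 + d) (1 - \<eta>) t\<close> with room to spare, which bounds the ratio from
    above\<close>
  define \<eta> where "\<eta> = d / (2 * (1 + d))"
  have \<eta>: "0 < \<eta>" "\<eta> < 1" "(1 + d) * (1 - \<eta>) = 1 + d / 2"
    using d(1) by (auto simp: \<eta>_def field_simps)
  show ?thesis
  proof (rule exI[of _ \<eta>], rule exI[of _ "1 / d"], intro conjI allI impI \<eta>)
    fix t s assume ts: "1 / d \<le> t" "(1 - \<eta>) * t \<le> s" "s \<le> t"
    have t: "t > 0" using ts(1) d(1) by (intro less_le_trans[OF _ ts(1)]) simp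
    have s: "s \<ge> 0" using t \<eta> by (intro order_trans[OF _ ts(2)]) simp
    have dt: "1 \<le> d * t" using ts(1) d(1) by (simp add: field_simps)
    have "(1 - d) * (1 + s) \<le> (1 - d) * (1 + t)" using d ts(3) by (intro mult_left_mono) auto
    also have "\<dots> < t" using dt d(1) by (simp add: algebra_simps)
    finally have 1: "(1 - d) * (1 + s) < t" .
    have "(1 + d) * ((1 - \<eta>) * t) \<le> (1 + d) * s" using d ts(2) by (intro mult_left_mono) auto
    then have "(1 + d / 2) * t \<le> (1 + d) * s" by (simp only: mult.assoc[symmetric] \<eta>(3))
    moreover have "t \<le> (1 + d / 2) * t" using t d by simp
    ultimately have 2: "t < (1 + d) * (1 + s)" using d by (simp add: distrib_left)
    have "t / (1 + s) < 1 + d" using 2 s by (simp add: pos_divide_less_eq)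
    moreover have "1 - d < t / (1 + s)" using 1 s by (simp add: pos_less_divide_eq)
    ultimately have "\<bar>t / (1 + s) - 1\<bar> < d" by linarith
    then show "\<bar>(t / (1 + s)) powr \<gamma> - 1\<bar> < e" using d by (intro d0(2)) simp
  qed
qed

text \<open>Split at \<open>s = (1 - \<eta>) t\<close>. Late times contribute \<open>m c\<close> up to a small relative error, since
  there \<open>t\<^sup>\<gamma> M(s)\<close> is close to \<open>m\<close>. At early times the kernel \<open>y((t - s) / L) / L\<close> is bounded by a
  constant times \<open>tail / t\<close>, where \<open>tail\<close> is the mass of \<open>y\<close> beyond \<open>\<eta> t / L\<close>, and \<open>\<integral>\<^sub>0\<^sup>t (1 +
  s)\<^sup>-\<^sup>\<gamma> ds\<close> is at most a constant times \<open>t\<^sup>1\<^sup>-\<^sup>\<gamma>\<close> because \<open>\<gamma> < 1\<close>.\<close>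

lemma convolution_asymptotics:
  fixes y M :: "real \<Rightarrow> real" and \<gamma> C m c K :: real
  assumes y: "y \<in> borel_measurable borel" "\<And>r. 0 \<le> y r"
    and int: "integrable lborel (\<lambda>r. indicator {0<..} r * y r)"
    and c: "(LINT r|lborel. indicator {0<..} r * y r) = c"
    and K: "0 < K" "\<And>r r'. 0 < r \<Longrightarrow> r \<le> r' \<Longrightarrow> r' \<le> 2 * r \<Longrightarrow> y r \<le> K * y r'"
    and M: "(\<lambda>s. indicator {0<..} s * M s) \<in> borel_measurable lebesgue"
    and C: "0 \<le> C" "\<And>s. 0 < s \<Longrightarrow> \<bar>M s\<bar> \<le> C * (1 + s) powr (- \<gamma>)"
    and lim: "((\<lambda>s. M s * (1 + s) powr \<gamma>) \<longlongrightarrow> m) at_top"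
    and \<gamma>: "\<gamma> < 1" and e: "0 < e"
  shows "\<exists>T \<delta>. 0 < T \<and> 0 < \<delta> \<and> (\<forall>t L. T \<le> t \<longrightarrow> 0 < L \<longrightarrow> L \<le> \<delta> * t \<longrightarrow>
     \<bar>t powr \<gamma> * (LINT s:{0<..<t}|lebesgue. M s * (y ((t - s) / L) / L)) - m * c\<bar> \<le> e)"
proof -
  note [measurable] = y(1)
  let ?Y = "\<lambda>r. indicator {0<..} r * y r"
  define tail where "tail a = (LINT r|lborel. indicator {a<..} r * ?Y r)" for a
  have c0: "0 \<le> c" unfolding c[symmetric] using y(2) by (intro Bochner_Integration.integral_nonneg) auto
  have tail0: "0 \<le> tail a" for a
    unfolding tail_def using y(2) by (intro Bochner_Integration.integral_nonneg) auto
  \<comment> \<open>\<open>e1\<close> bounds the relative errors at late times, so that their total \<open>(2 + |m|) e1 c\<close> is at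
    most \<open>e / 2\<close>\<close>
  define e1 where "e1 = min 1 (e / (2 * (2 + \<bar>m\<bar>) * (c + 1)))"
  have e1: "0 < e1" "e1 \<le> 1" "(2 + \<bar>m\<bar>) * e1 * c \<le> e / 2"
  proof -
    have pos: "0 < 2 * (2 + \<bar>m\<bar>) * (c + 1)" using c0 by (intro mult_pos_pos) auto
    then show "0 < e1" "e1 \<le> 1" using e by (auto simp: e1_def)
    have "e1 * (2 * (2 + \<bar>m\<bar>) * (c + 1)) \<le> e"
      using pos by (simp add: e1_def min_le_iff_disj pos_le_divide_eq[symmetric])
    moreover have "2 * ((2 + \<bar>m\<bar>) * e1 * c) \<le> e1 * (2 * (2 + \<bar>m\<bar>) * (c + 1))"
      using \<open>0 < e1\<close> by (simp add: algebra_simps)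
    ultimately show "(2 + \<bar>m\<bar>) * e1 * c \<le> e / 2" by linarith
  qed
  obtain \<eta> T1 where \<eta>: "0 < \<eta>" "\<eta> < 1"
    and T1: "\<And>t s. T1 \<le> t \<Longrightarrow> (1 - \<eta>) * t \<le> s \<Longrightarrow> s \<le> t \<Longrightarrow> \<bar>(t / (1 + s)) powr \<gamma> - 1\<bar> < e1"
    using powr_ratio_close_to_1[OF e1(1), of \<gamma>] by blast
  have "\<forall>\<^sub>F s in at_top. dist (M s * (1 + s) powr \<gamma>) m < e1"
    using lim e1(1) by (rule tendstoD)
  then obtain T2 where T2: "\<And>s. T2 \<le> s \<Longrightarrow> \<bar>M s * (1 + s) powr \<gamma> - m\<bar> < e1"
    unfolding eventually_at_top_linorder dist_real_def by blast
  \<comment> \<open>the coefficient of the tail mass in the estimate for early times, including the part of \<open>m c\<close>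
    that they miss\<close>
  define D where "D = \<bar>m\<bar> + C * K * 2 powr (1 - \<gamma>) / ((1 - \<gamma>) * \<eta>)"
  have D: "0 \<le> D" using C(1) K(1) \<gamma> \<eta> by (simp add: D_def)
  have "(tail \<longlongrightarrow> 0) at_top"
    using tail_integral_tendsto_0[OF int y(1)] by (simp add: tail_def[abs_def])
  then have "\<forall>\<^sub>F a in at_top. dist (tail a) 0 < e / (2 * (D + 1))"
    using e D by (intro tendstoD) auto
  then obtain A where A: "\<And>a. A \<le> a \<Longrightarrow> tail a < e / (2 * (D + 1))"
    unfolding eventually_at_top_linorder dist_real_def by fastforce
  define T where "T = Max {1, T1, \<bar>T2\<bar> / (1 - \<eta>)}"
  have T: "1 \<le> T" "T1 \<le> T" "\<bar>T2\<bar> / (1 - \<eta>) \<le> T" by (auto simp: T_def)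
  define \<delta> where "\<delta> = \<eta> / max 1 A"
  have \<delta>: "\<delta> > 0" using \<eta> by (simp add: \<delta>_def)
  have main: "\<bar>t powr \<gamma> * (LINT s:{0<..<t}|lebesgue. M s * (y ((t - s) / L) / L)) - m * c\<bar> \<le> e"
    if t: "T \<le> t" and L: "0 < L" "L \<le> \<delta> * t" for t L
  proof -
    have t1: "1 \<le> t" "T1 \<le> t" using t T by auto
    have T2t: "T2 \<le> (1 - \<eta>) * t"
    proof -
      have "\<bar>T2\<bar> \<le> t * (1 - \<eta>)" using t T(3) \<eta> by (simp add: pos_divide_le_eq[symmetric])
      then show ?thesis by (simp add: mult.commute)
    qed
    define a where "a = \<eta> * t / L"
    have a: "0 < a" "A \<le> a"
    proof -
      show "0 < a" using \<eta> t1 L by (simp add: a_def)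
      have "L * max 1 A \<le> \<eta> * t" using L(2) by (simp add: \<delta>_def pos_le_divide_eq)
      then have "max 1 A \<le> a"
        using mult_imp_le_div_pos[OF L(1), of "max 1 A" "\<eta> * t"] by (simp only: a_def mult.commute[of L])
      then show "A \<le> a" by simp
    qed
    have tail_a: "D * tail a \<le> e / 2"
    proof -
      have "D * tail a \<le> D * (e / (2 * (D + 1)))"
        using A[OF a(2)] D by (intro mult_left_mono) auto
      also have "\<dots> \<le> e / 2" using D e by (simp add: field_simps)
      finally show ?thesis .
    qed
    define k where "k s = y ((t - s) / L) / L" for s
    have [measurable]: "k \<in> borel_measurable borel" unfolding k_def by measurable
    let ?k1 = "\<lambda>s. indicator {..<t} s * k s" and ?k2 = "\<lambda>s. indicator {..<(1 - \<eta>) * t} s * k s"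
      and ?w = "\<lambda>s. indicator {0..t} s * (1 + s) powr (- \<gamma>)"
    have affine: "has_bochner_integral lborel (\<lambda>s. h (t / L + (- 1 / L) * s) / L) (LINT r|lborel. h r)"
      if h: "integrable lborel h" for h :: "real \<Rightarrow> real"
    proof -
      have "has_bochner_integral lborel (\<lambda>s. h (t / L + (- 1 / L) * s)) ((LINT r|lborel. h r) /\<^sub>R \<bar>- 1 / L\<bar>)"
        using L h by (intro lborel_has_bochner_integral_real_affine_iff[THEN iffD1]) (auto simp: has_bochner_integral_iff)
      from has_bochner_integral_mult_left[OF this, of "1 / L"] L show ?thesis by simp
    qed
    have arg: "t / L + (- 1 / L) * s = (t - s) / L" for s by (simp add: diff_divide_distrib)
    have k1: "has_bochner_integral lborel (\<lambda>s. indicator {..<t} s * k s) c"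
    proof -
      have "?Y (t / L + (- 1 / L) * s) / L = indicator {..<t} s * k s" for s
        unfolding arg k_def using L by (auto split: split_indicator simp: zero_less_divide_iff)
      then show ?thesis using affine[OF int] c by (simp only:)
    qed
    have k2: "has_bochner_integral lborel (\<lambda>s. indicator {..<(1 - \<eta>) * t} s * k s) (tail a)"
    proof -
      have "integrable lborel (\<lambda>r. indicator {a<..} r *\<^sub>R ?Y r)"
        by (rule integrable_mult_indicator[OF _ int]) simp
      then have "integrable lborel (\<lambda>r. indicator {a<..} r * ?Y r)" by simp
      from affine[OF this]
      have "has_bochner_integral lborel (\<lambda>s. indicator {a<..} ((t - s) / L) * ?Y ((t - s) / L) / L) (tail a)"
        unfolding arg tail_def .
      moreover have "indicator {a<..} ((t - s) / L) * ?Y ((t - s) / L) / L = indicator {..<(1 - \<eta>) * t} s * k s" for s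
      proof (cases "s < (1 - \<eta>) * t")
        case True
        then have "a < (t - s) / L" unfolding a_def using L by (intro divide_strict_right_mono) (auto simp: algebra_simps)
        then show ?thesis using True a by (simp add: k_def)
      next
        case False
        then have "(t - s) / L \<le> a" unfolding a_def using L by (intro divide_right_mono) (auto simp: algebra_simps)
        then show ?thesis using False by simp
      qed
      ultimately show ?thesis by (simp only:)
    qed
    have k_nonneg: "0 \<le> k s" for s using y(2) L by (simp add: k_def)
    define B where "B = t powr \<gamma> * C * (K * tail a / (\<eta> * t))"
    have B0: "0 \<le> B" using C(1) K(1) tail0 \<eta> t1 by (simp add: B_def)
    let ?G = "\<lambda>s. (t powr \<gamma> * (indicator {0<..} s * M s) - m) * ?k1 s"
    let ?U = "\<lambda>s. (2 + \<bar>m\<bar>) * e1 * ?k1 s + \<bar>m\<bar> * ?k2 s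
        + B * ?w s"
    have U: "has_bochner_integral lborel ?U ((2 + \<bar>m\<bar>) * e1 * c + \<bar>m\<bar> * tail a + B * (((1 + t) powr (1 - \<gamma>) - 1) / (1 - \<gamma>)))"
      using t1 by (intro has_bochner_integral_add has_bochner_integral_mult_right k1 k2 has_bochner_integral_decay \<gamma>) auto
    have GU: "\<bar>?G s\<bar> \<le> ?U s" for s
    proof -
      have n1: "0 \<le> (2 + \<bar>m\<bar>) * e1 * ?k1 s"
        using k_nonneg[of s] e1(1) by (intro mult_nonneg_nonneg) auto
      have n2: "0 \<le> \<bar>m\<bar> * ?k2 s"
        using k_nonneg[of s] by (intro mult_nonneg_nonneg) auto
      have n3: "0 \<le> B * ?w s"
        using B0 by (intro mult_nonneg_nonneg) auto
      consider "t \<le> s" | "(1 - \<eta>) * t \<le> s" "s < t" | "s \<le> 0" | "0 < s" "s < (1 - \<eta>) * t" by linarith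
      then show ?thesis
      proof cases
        case 1
        then have "\<bar>?G s\<bar> = 0" by simp
        then show ?thesis using n1 n2 n3 by linarith
      next
        case 2
        have "0 < (1 - \<eta>) * t" using \<eta> t1 by simp
        then have s: "0 < s" using 2(1) by linarith
        define z where "z = (t / (1 + s)) powr \<gamma>"
        define w where "w = M s * (1 + s) powr \<gamma>"
        have z: "\<bar>z - 1\<bar> < e1" unfolding z_def using t1 2 by (intro T1) auto
        have w: "\<bar>w - m\<bar> < e1" unfolding w_def using T2t 2 by (intro T2) auto
        have "t powr \<gamma> * M s = z * w"
          using s by (simp add: z_def w_def powr_divide)
        moreover have "\<bar>z * w - m\<bar> \<le> (2 + \<bar>m\<bar>) * e1"
        proof -
          \<comment> \<open>here \<open>|z| \<le> 2\<close> because \<open>e1 \<le> 1\<close>\<close>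
          have "z * w - m = z * (w - m) + (z - 1) * m" by (simp add: algebra_simps)
          then have "\<bar>z * w - m\<bar> \<le> \<bar>z\<bar> * \<bar>w - m\<bar> + \<bar>z - 1\<bar> * \<bar>m\<bar>"
            by (metis abs_mult abs_triangle_ineq)
          also have "\<dots> \<le> 2 * e1 + e1 * \<bar>m\<bar>"
            using z w e1 by (intro add_mono mult_mono) auto
          finally show ?thesis by (simp add: algebra_simps)
        qed
        ultimately have "\<bar>t powr \<gamma> * M s - m\<bar> * k s \<le> (2 + \<bar>m\<bar>) * e1 * k s"
          using k_nonneg by (intro mult_right_mono) auto
        moreover have "\<bar>?G s\<bar> = \<bar>t powr \<gamma> * M s - m\<bar> * k s"
          using s 2 by (simp add: abs_mult abs_of_nonneg[OF k_nonneg])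
        ultimately have "\<bar>?G s\<bar> \<le> (2 + \<bar>m\<bar>) * e1 * k s" by linarith
        moreover have i: "indicator {..<t} s * k s = k s" using 2 by simp
        ultimately have "\<bar>?G s\<bar> \<le> (2 + \<bar>m\<bar>) * e1 * ?k1 s"
          by (simp only: i)
        then show ?thesis using n2 n3 by linarith
      next
        case 3
        have "s < (1 - \<eta>) * t" "s < t" using 3 \<eta> t1 by (auto intro: le_less_trans)
        then have "\<bar>?G s\<bar> = \<bar>m\<bar> * ?k2 s"
          using 3 by (simp add: abs_mult abs_of_nonneg[OF k_nonneg])
        then show ?thesis using n1 n3 by linarith
      next
        case 4
        have st: "s < t" using 4 \<eta> t1 by (intro less_le_trans[OF 4(2)]) (simp add: algebra_simps)
        define r where "r = (t - s) / L"
        have r: "a < r" "0 < r"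
        proof -
          show "a < r" unfolding a_def r_def using L 4 by (intro divide_strict_right_mono) (auto simp: algebra_simps)
          then show "0 < r" using a by simp
        qed
        have "r * y r \<le> K * tail a"
          unfolding tail_def by (rule doubling_pointwise_bound[OF y int K r(2,1)])
        then have "(t - s) * k s \<le> K * tail a" by (simp add: r_def k_def)
        moreover have "\<eta> * t * k s \<le> (t - s) * k s"
          using 4 k_nonneg by (intro mult_right_mono) (auto simp: algebra_simps)
        ultimately have k: "k s \<le> K * tail a / (\<eta> * t)"
          using \<eta> t1 by (simp add: pos_le_divide_eq mult.commute)
        have "\<bar>?G s\<bar> = \<bar>t powr \<gamma> * M s - m\<bar> * k s"
          using 4 st by (simp add: abs_mult abs_of_nonneg[OF k_nonneg])
        also have "\<dots> \<le> (t powr \<gamma> * \<bar>M s\<bar> + \<bar>m\<bar>) * k s"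
          using k_nonneg[of s] abs_triangle_ineq4[of "t powr \<gamma> * M s" m] by (intro mult_right_mono) (auto simp: abs_mult)
        also have "\<dots> = t powr \<gamma> * \<bar>M s\<bar> * k s + \<bar>m\<bar> * k s" by (rule distrib_right)
        also have "t powr \<gamma> * \<bar>M s\<bar> * k s \<le> t powr \<gamma> * (C * (1 + s) powr (- \<gamma>)) * (K * tail a / (\<eta> * t))"
          using C 4(1) k k_nonneg[of s] by (intro mult_mono mult_left_mono) auto
        also have "\<dots> = B * (1 + s) powr (- \<gamma>)" by (simp add: B_def)
        finally have "\<bar>?G s\<bar> \<le> B * (1 + s) powr (- \<gamma>) + \<bar>m\<bar> * k s" by simp
        moreover have i: "indicator {0..t} s * (1 + s) powr (- \<gamma>) = (1 + s) powr (- \<gamma>)"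
          "indicator {..<(1 - \<eta>) * t} s * k s = k s"
          using 4 st by simp_all
        ultimately have "\<bar>?G s\<bar> \<le> B * ?w s
            + \<bar>m\<bar> * ?k2 s"
          by (simp only: i)
        then show ?thesis using n1 by linarith
      qed
    qed
    have [measurable]: "(\<lambda>s. indicator {..<t} s * k s) \<in> borel_measurable lebesgue"
      by (rule measurable_completion) measurable
    note [measurable] = M
    have k1L: "integrable lebesgue (\<lambda>s. indicator {..<t} s * k s)" "(LINT s|lebesgue. indicator {..<t} s * k s) = c"
    proof -
      have m: "(\<lambda>s. indicator {..<t} s * k s) \<in> borel_measurable borel" by measurable
      show "integrable lebesgue (\<lambda>s. indicator {..<t} s * k s)" "(LINT s|lebesgue. indicator {..<t} s * k s) = c"
        using k1 unfolding has_bochner_integral_iff integrable_lebesgue_iff_lborel[OF m] by simp_all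
    qed
    have UL: "integrable lebesgue ?U" "(LINT s|lebesgue. ?U s) = (2 + \<bar>m\<bar>) * e1 * c + \<bar>m\<bar> * tail a + B * (((1 + t) powr (1 - \<gamma>) - 1) / (1 - \<gamma>))"
    proof -
      have m: "?U \<in> borel_measurable borel" by measurable
      show "integrable lebesgue ?U" "(LINT s|lebesgue. ?U s) = (2 + \<bar>m\<bar>) * e1 * c + \<bar>m\<bar> * tail a + B * (((1 + t) powr (1 - \<gamma>) - 1) / (1 - \<gamma>))"
        using U unfolding has_bochner_integral_iff integrable_lebesgue_iff_lborel[OF m] by (simp_all only:)
    qed
    have GI: "integrable lebesgue ?G"
      by (rule Bochner_Integration.integrable_bound[OF UL(1)]) (measurable, intro AE_I2, simp only: real_norm_def order_trans[OF GU abs_ge_self])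
    have "(LINT s|lebesgue. ?G s + m * ?k1 s) = (LINT s|lebesgue. ?G s) + m * c"
      by (subst Bochner_Integration.integral_add[OF GI]) (use k1L in auto)
    moreover have "?G s + m * ?k1 s = t powr \<gamma> * (indicator {0<..<t} s *\<^sub>R (M s * k s))" for s
      by (auto split: split_indicator simp: algebra_simps)
    ultimately have eq: "t powr \<gamma> * (LINT s:{0<..<t}|lebesgue. M s * k s) - m * c = (LINT s|lebesgue. ?G s)"
      by (simp add: set_lebesgue_integral_def k_def)
    have "\<bar>LINT s|lebesgue. ?G s\<bar> \<le> (LINT s|lebesgue. \<bar>?G s\<bar>)" by (rule integral_abs_bound)
    also have "\<dots> \<le> (LINT s|lebesgue. ?U s)"
      by (rule integral_mono[OF integrable_abs[OF GI] UL(1) GU])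
    also have "\<dots> \<le> e / 2 + D * tail a"
    proof -
      have "(1 + t) powr (1 - \<gamma>) \<le> (2 * t) powr (1 - \<gamma>)"
        using t1 \<gamma> by (intro powr_mono2) auto
      then have "((1 + t) powr (1 - \<gamma>) - 1) / (1 - \<gamma>) \<le> 2 powr (1 - \<gamma>) * t powr (1 - \<gamma>) / (1 - \<gamma>)"
        using \<gamma> t1 by (intro divide_right_mono) (auto simp: powr_mult)
      then have "B * (((1 + t) powr (1 - \<gamma>) - 1) / (1 - \<gamma>)) \<le> B * (2 powr (1 - \<gamma>) * t powr (1 - \<gamma>) / (1 - \<gamma>))"
        using B0 by (rule mult_left_mono)
      also have "\<dots> = (t powr \<gamma> * t powr (1 - \<gamma>)) / t * (C * K * 2 powr (1 - \<gamma>) / ((1 - \<gamma>) * \<eta>)) * tail a"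
        by (simp add: B_def mult_ac)
      also have "t powr \<gamma> * t powr (1 - \<gamma>) = t"
        using t1 by (simp flip: powr_add)
      finally have "B * (((1 + t) powr (1 - \<gamma>) - 1) / (1 - \<gamma>)) \<le> C * K * 2 powr (1 - \<gamma>) / ((1 - \<gamma>) * \<eta>) * tail a"
        using t1 by simp
      moreover have "D * tail a = \<bar>m\<bar> * tail a + C * K * 2 powr (1 - \<gamma>) / ((1 - \<gamma>) * \<eta>) * tail a"
        by (simp only: D_def distrib_right)
      ultimately show ?thesis
        unfolding UL(2) using e1(3) by linarith
    qed
    also have "\<dots> \<le> e" using tail_a by simp
    finally have "\<bar>t powr \<gamma> * (LINT s:{0<..<t}|lebesgue. M s * k s) - m * c\<bar> \<le> e"
      by (simp only: eq)
    then show ?thesis by (simp only: k_def)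
  qed
  show ?thesis
  proof (rule exI[of _ T], rule exI[of _ \<delta>], intro conjI allI impI)
    show "0 < T" using T(1) by simp
  qed (use \<delta> main in auto)
qed

section \<open>The asymptotic statement\<close>

theorem proposition1p1:
  fixes f :: "real ^ 'n \<Rightarrow> real \<Rightarrow> real" and g :: "real ^ 'n \<Rightarrow> real"
    and \<alpha> \<beta> \<gamma> \<theta> N M\<^sub>0 :: real and p :: ennreal and M :: "real \<Rightarrow> real"
  assumes "0 < \<alpha>" "\<alpha> < 1" and "0 < \<beta>" "\<beta> \<le> 1"
    and "N = real CARD('n)" and "N > 4 * \<beta>" and "\<theta> = \<alpha> / (2 * \<beta>)"
    and "\<gamma> < 1" and "1 \<le> p"
    and "(\<lambda>(x, t). f x t) \<in> borel_measurable (lebesgue_on (UNIV \<times> {0<..}))"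
    and "\<exists>C>0. \<forall>t>0. Lp_norm 1 lebesgue (\<lambda>x. f x t) \<le> ennreal (C * (1 + t) powr (- \<gamma>))"
    and "integrable lebesgue g"
    and "((\<lambda>t. Lp_norm 1 lebesgue (\<lambda>x. f x t * (1 + t) powr \<gamma> - g x)) \<longlongrightarrow> 0) at_top"
    and "p < ennreal (p_crit N \<beta>) \<Longrightarrow>
      ((\<lambda>R. SUP t\<in>{0<..}. ennreal ((1 + t) powr \<gamma>) *
              Lp_norm 1 (lebesgue_on {x. norm x > R}) (\<lambda>x. f x t)) \<longlongrightarrow> 0) at_top"
    and "p \<ge> ennreal (p_crit N \<beta>) \<Longrightarrow>
      \<exists>q. ennreal (q_crit N \<beta> p) < q \<and> q \<le> p \<and>
        ((\<lambda>R. ennreal (R powr (N * (1 - enn2real (1 / q)))) *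
              (SUP t\<in>{0<..}. ennreal ((1 + t) powr \<gamma>) *
                 Lp_norm q (lebesgue_on {x. norm x > R}) (\<lambda>x. f x t))) \<longlongrightarrow> 0) at_top"
    and "\<And>t. M t = (LINT x|lebesgue. f x t)"
    and "M\<^sub>0 = (LINT x|lebesgue. g x)"
  shows "(M\<^sub>0 \<noteq> 0 \<longrightarrow>
            (\<lambda>(x :: real ^ 'n, t :: real). LINT s:{0<..<t}|lebesgue. M s * Y_kernel \<alpha> \<beta> x (t - s))
              \<sim>[inner_region \<theta>]
            (\<lambda>(x :: real ^ 'n, t :: real). t powr (- \<gamma>) * M\<^sub>0 * c_const N \<beta> * E_fun \<beta> x)) \<and>
         (M\<^sub>0 = 0 \<longrightarrow>
            (\<lambda>(x :: real ^ 'n, t :: real). LINT s:{0<..<t}|lebesgue. M s * Y_kernel \<alpha> \<beta> x (t - s))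
              \<in> o[inner_region \<theta>](\<lambda>(x :: real ^ 'n, t :: real). t powr (- \<gamma>) * c_const N \<beta> * E_fun \<beta> x))"
proof -
  note \<alpha> = assms(1,2) and \<beta> = assms(3,4) and N = assms(5,6) and \<theta> = assms(7) and \<gamma> = assms(8)
    and f_meas = assms(10) and f_bound = assms(11) and g = assms(12) and f_lim = assms(13)
    and M = assms(16) and M0 = assms(17)
  obtain \<sigma> where \<sigma>: "stable_law \<alpha> \<sigma>" using stable_law_exists[of \<alpha>] \<alpha> by auto
  obtain \<nu> where \<nu>: "stable_law \<beta> \<nu>" using stable_law_exists[of \<beta>] \<beta> by auto
  interpret subordination \<alpha> \<beta> \<sigma> \<nu> by unfold_locales (fact \<alpha> \<beta> \<sigma> \<nu>)+
  have N2: "2 * \<beta> < real CARD('n)" using N \<beta> by simp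
  let ?c = "c_const N \<beta>"
  have c_pos: "?c > 0"
    using N \<beta> unfolding c_const_def
    by (intro divide_pos_pos mult_pos_pos Gamma_real_pos) auto
  obtain e :: "real ^ 'n" where e: "norm e = 1" using vector_choose_size[of 1] by auto
  obtain K where K: "K > 0" "\<And>r r'. 0 < r \<Longrightarrow> r \<le> r' \<Longrightarrow> r' \<le> 2 * r \<Longrightarrow> Y_sub e r \<le> K * Y_sub e r'"
    using Y_sub_doubling[OF e] by blast
  obtain C where C: "C > 0" "\<And>t. 0 < t \<Longrightarrow> Lp_norm 1 lebesgue (\<lambda>x. f x t) \<le> ennreal (C * (1 + t) powr (- \<gamma>))"
    using f_bound by blast
  have f_fin: "Lp_norm 1 lebesgue (\<lambda>x. f x t) < \<infinity>" if "0 < t" for t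
    using le_less_trans[OF C(2)[OF that]] by simp
  have f_int: "integrable lebesgue (\<lambda>x. f x t)" if "0 < t" for t
    using Lp_norm_1_finite(1)[OF f_fin[OF that]] .
  have M_bound: "\<bar>M t\<bar> \<le> C * (1 + t) powr (- \<gamma>)" if t: "0 < t" for t
  proof -
    have "ennreal \<bar>M t\<bar> \<le> ennreal (C * (1 + t) powr (- \<gamma>))"
      unfolding M using Lp_norm_1_finite(2)[OF f_fin[OF t]] C(2)[OF t] by (rule order_trans)
    then show ?thesis using C(1) by (subst (asm) ennreal_le_iff) auto
  qed
  have M_meas: "(\<lambda>s. indicator {0<..} s * M s) \<in> borel_measurable lebesgue"
    unfolding M using f_int by (intro borel_measurable_partial_integral f_meas borel_measurable_integrable)
  have M_lim: "((\<lambda>t. M t * (1 + t) powr \<gamma>) \<longlongrightarrow> M\<^sub>0) at_top"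
  proof (rule tendstoI)
    fix d :: real assume d: "0 < d"
    have "\<forall>\<^sub>F t in at_top. Lp_norm 1 lebesgue (\<lambda>x. f x t * (1 + t) powr \<gamma> - g x) < ennreal d"
      using f_lim d by (intro order_tendstoD) auto
    then show "\<forall>\<^sub>F t in at_top. dist (M t * (1 + t) powr \<gamma>) M\<^sub>0 < d"
      using eventually_gt_at_top[of 0]
    proof eventually_elim
      case (elim t)
      have fin: "Lp_norm 1 lebesgue (\<lambda>x. f x t * (1 + t) powr \<gamma> - g x) < \<infinity>"
        using elim(1) by (rule less_trans) simp
      have "(LINT x|lebesgue. f x t * (1 + t) powr \<gamma> - g x) = M t * (1 + t) powr \<gamma> - M\<^sub>0"
        unfolding M M0 using f_int[OF elim(2)] g
        by (subst Bochner_Integration.integral_diff) (auto intro: integrable_mult_left)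
      then have "ennreal \<bar>M t * (1 + t) powr \<gamma> - M\<^sub>0\<bar> < ennreal d"
        using le_less_trans[OF Lp_norm_1_finite(2)[OF fin] elim(1)] by simp
      then show ?case by (simp add: dist_real_def ennreal_less_iff)
    qed
  qed
  let ?I = "\<lambda>(x :: real ^ 'n, t :: real). LINT s:{0<..<t}|lebesgue. M s * Y_kernel \<alpha> \<beta> x (t - s)"
  let ?R = "\<lambda>(x :: real ^ 'n, t :: real). t powr (- \<gamma>) * M\<^sub>0 * ?c * E_fun \<beta> x"
  let ?H = "\<lambda>(x :: real ^ 'n, t :: real). t powr (- \<gamma>) * ?c * E_fun \<beta> x"
  have small: "(\<lambda>z. ?I z - ?R z) \<in> o[inner_region \<theta>](?H)"
  proof (rule landau_o.smallI)
    fix d :: real assume d: "0 < d"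
    obtain T \<delta> where T: "0 < T" and \<delta>: "0 < \<delta>"
      and main: "\<And>t L. T \<le> t \<Longrightarrow> 0 < L \<Longrightarrow> L \<le> \<delta> * t \<Longrightarrow>
        \<bar>t powr \<gamma> * (LINT s:{0<..<t}|lebesgue. M s * (Y_sub e ((t - s) / L) / L)) - M\<^sub>0 * ?c\<bar> \<le> d * ?c"
    proof -
      have "0 < d * ?c" using d c_pos by simp
      then show ?thesis
        using convolution_asymptotics[OF Y_sub_measurable Y_sub_nonneg integrable_Y_sub_unit(1)[OF e N2]
            integrable_Y_sub_unit(2)[OF e N2] K M_meas less_imp_le[OF C(1)] M_bound M_lim \<gamma>, of "d * ?c"] that
        unfolding N(1) by blast
    qed
    \<comment> \<open>\<open>|x| t\<^sup>-\<^sup>\<theta> < \<delta>\<^sup>\<theta>\<close> is the condition \<open>L < \<delta> t\<close>, as \<open>L\<^sup>\<theta> = |x|\<close>\<close>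
    define \<delta>' where "\<delta>' = \<delta> powr \<theta>"
    have \<theta>_pos: "0 < \<theta>" using \<alpha> \<beta> \<theta> by simp
    have \<delta>': "0 < \<delta>'" using \<delta> by (simp add: \<delta>'_def)
    have "\<forall>\<^sub>F z :: (real ^ 'n) \<times> real in inner_region \<theta>. T \<le> snd z \<and> norm (fst z) * snd z powr (- \<theta>) < \<delta>' \<and> fst z \<noteq> 0"
    proof (intro eventually_conj)
      have "\<forall>\<^sub>F z :: (real ^ 'n) \<times> real in filtercomap snd at_top. T \<le> snd z"
        by (rule eventually_filtercomapI) (rule eventually_ge_at_top)
      then show "\<forall>\<^sub>F z :: (real ^ 'n) \<times> real in inner_region \<theta>. T \<le> snd z"
        unfolding inner_region_def by (rule filter_leD[rotated]) (simp add: le_infI1)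
      have "\<forall>\<^sub>F z :: (real ^ 'n) \<times> real in filtercomap (\<lambda>(x, t). norm x * t powr (- \<theta>)) (nhds 0).
          (\<lambda>(x, t). norm x * t powr (- \<theta>)) z < \<delta>'"
        by (rule eventually_filtercomapI) (rule order_tendstoD(2)[OF filterlim_ident \<delta>'])
      then show "\<forall>\<^sub>F z :: (real ^ 'n) \<times> real in inner_region \<theta>. norm (fst z) * snd z powr (- \<theta>) < \<delta>'"
        unfolding inner_region_def case_prod_beta by (rule filter_leD[rotated]) (simp add: le_infI1)
      have "\<forall>\<^sub>F z :: (real ^ 'n) \<times> real in principal {(x, t). x \<noteq> 0}. fst z \<noteq> 0"
        by (auto simp: eventually_principal)
      then show "\<forall>\<^sub>F z :: (real ^ 'n) \<times> real in inner_region \<theta>. fst z \<noteq> 0"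
        unfolding inner_region_def by (rule filter_leD[rotated]) simp
    qed
    then show "\<forall>\<^sub>F z in inner_region \<theta>. norm (?I z - ?R z) \<le> d * norm (?H z)"
    proof eventually_elim
      case (elim z)
      obtain x t where z: "z = (x, t)" by (cases z)
      have t: "T \<le> t" "0 < t" and x: "x \<noteq> 0" and xt: "norm x * t powr (- \<theta>) < \<delta>'"
        using elim T by (auto simp: z)
      define L where "L = norm x powr (2 * \<beta> / \<alpha>)"
      have L: "0 < L" using x by (simp add: L_def)
      have Lt: "L \<le> \<delta> * t"
      proof -
        have inv: "\<theta> * (2 * \<beta> / \<alpha>) = 1" using \<alpha> \<beta> \<theta> by simp
        have "norm x < \<delta>' * t powr \<theta>"
          using xt t(2) by (simp add: powr_minus field_simps)
        then have "L \<le> (\<delta>' * t powr \<theta>) powr (2 * \<beta> / \<alpha>)"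
          unfolding L_def using \<alpha> \<beta> by (intro powr_mono2) auto
        also have "\<delta>' * t powr \<theta> = (\<delta> * t) powr \<theta>"
          by (simp add: \<delta>'_def powr_mult)
        also have "((\<delta> * t) powr \<theta>) powr (2 * \<beta> / \<alpha>) = \<delta> * t"
          unfolding powr_powr inv using \<delta> t by simp
        finally show ?thesis .
      qed
      let ?J = "LINT s:{0<..<t}|lebesgue. M s * (Y_sub e ((t - s) / L) / L)"
      have E: "E_fun \<beta> x = norm x powr (- real CARD('n)) * L powr \<alpha>"
      proof -
        have "L powr \<alpha> = norm x powr (2 * \<beta>)" unfolding L_def powr_powr using \<alpha> by simp
        then show ?thesis by (simp add: E_fun_def flip: powr_add)
      qed
      have kernel: "M s * Y_kernel \<alpha> \<beta> x (t - s) = E_fun \<beta> x * (M s * (Y_sub e ((t - s) / L) / L))"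
        if s: "s < t" for s
      proof -
        have "Y_kernel \<alpha> \<beta> x (t - s) = norm x powr (- real CARD('n)) * L powr (\<alpha> - 1) * Y_sub e ((t - s) / L)"
          using Y_kernel_eq[OF x _ N2, of "t - s"] Y_sub_scale[OF x e, of "t - s"] s by (simp add: L_def)
        moreover have "L powr (\<alpha> - 1) = L powr \<alpha> / L" using L by (simp add: powr_diff)
        ultimately show ?thesis by (simp add: E)
      qed
      have I: "?I z = E_fun \<beta> x * ?J"
      proof -
        have "?I z = (LINT s:{0<..<t}|lebesgue. E_fun \<beta> x * (M s * (Y_sub e ((t - s) / L) / L)))"
          unfolding z prod.case by (rule set_lebesgue_integral_cong) (auto simp: kernel)
        then show ?thesis by simp
      qed
      have E0: "0 \<le> E_fun \<beta> x" by (simp add: E_fun_def)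
      have "?I z - ?R z = E_fun \<beta> x * t powr (- \<gamma>) * (t powr \<gamma> * ?J - M\<^sub>0 * ?c)"
      proof -
        have "t powr (- \<gamma>) * t powr \<gamma> = 1" using t by (simp flip: powr_add)
        then have "E_fun \<beta> x * t powr (- \<gamma>) * (t powr \<gamma> * ?J - M\<^sub>0 * ?c)
            = E_fun \<beta> x * (1 * ?J) - E_fun \<beta> x * t powr (- \<gamma>) * M\<^sub>0 * ?c"
          by (simp add: right_diff_distrib mult.assoc[symmetric])
        then show ?thesis unfolding I by (simp add: z mult_ac)
      qed
      then have "norm (?I z - ?R z) = E_fun \<beta> x * t powr (- \<gamma>) * \<bar>t powr \<gamma> * ?J - M\<^sub>0 * ?c\<bar>"
        using E0 by (simp add: abs_mult)
      also have "\<dots> \<le> E_fun \<beta> x * t powr (- \<gamma>) * (d * ?c)"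
        using E0 main[OF t(1) L Lt] by (intro mult_left_mono) auto
      also have "\<dots> = d * norm (?H z)"
        using E0 c_pos by (simp add: z abs_mult)
      finally show ?case .
    qed
  qed
  show ?thesis
  proof (intro conjI impI)
    assume m: "M\<^sub>0 \<noteq> 0"
    have "?R = (\<lambda>z. M\<^sub>0 * ?H z)" by (auto simp: fun_eq_iff)
    then have "(\<lambda>z. ?I z - ?R z) \<in> o[inner_region \<theta>](?R)"
      using small m by simp
    then show "?I \<sim>[inner_region \<theta>] ?R"
      by (simp add: asymp_equiv_altdef)
  next
    assume "M\<^sub>0 = 0"
    then show "?I \<in> o[inner_region \<theta>](?H)" using small by (simp add: case_prod_beta')
  qed
qed

end
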